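(* Let $\alpha$ be the parameter of a family of very simple increasing trees, let $S(\mathcal{T}_n)$ be the number of nodes in the subtree consisting of the centroid (the one nearest to the root) and all of its descendants in a random tree of size $n$, and let $\mathcal{S}$ be the limiting random variable of $S(\mathcal{T}_n)/n$ (defined in the context). Then for every positive integer $r$, $$\lim_{n\to\infty}E_n\big((S/n)^r\big)=E(\mathcal{S}^r),$$ and $$E(\mathcal{S}^r)=P(\mathcal{S}=1)+\frac{\alpha}{\alpha-1}\left(\frac{\alpha}{\alpha-r}\left(2^{-(r-1)}-2^{-(\alpha-1)}\right)-\frac{1}{r-1}\left(1-2^{-(r-1)}\right)\right),$$ where for $r=1$ the term $\frac{1}{r-1}(1-2^{-(r-1)})$ is read as its limit $\ln2$. In particular, the limit of the mean is $$E(\mathcal{S})=1+\frac{\alpha}{(\alpha-1)^2}\left(1-2^{-(\alpha-1)}-(\alpha-1)\ln2\right).$$ (If $\alpha\in\{1,r\}$, the right-hand sides are to be read as their limits as the parameter tends to $\alpha$.)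
   Context: Random trees. An increasing tree of size $n$ is a rooted tree with $n$ nodes labelled $1,\dots,n$ such that labels increase along every path leading away from the root (so the root has label $1$). A family of very simple increasing trees is given by real constants $c_1>0$ and $c_2$; put $\alpha=1+c_2/c_1>0$. The admissible cases are: $c_2=0$, $\alpha=1$ (general recursive trees); $c_2<0$, $0<\alpha<1$ (general plane-oriented trees); $c_2>0$, $\alpha=d/(d-1)$ with an integer $d\ge2$ (general $d$-ary increasing trees). A plane (i.e. ordered) increasing tree $T$ has weight $\omega(T)=\prod_v\phi_{\mathrm{outdeg}(v)}$, where $\sum_i\phi_iu^i=\phi(u)$ with $\phi(u)=\exp(c_1u)$ if $c_2=0$ and $\phi(u)=(1+c_2u)^{1+c_1/c_2}$ otherwise; a random tree $\mathcal{T}_n$ of size $n$ is drawn with probability proportional to its weight. Equivalently (ignoring the order of children), the random tree is produced by the growth process which starts with the root $1$ and, for $i=2,\dots,n$, attaches node $i$ as a child to an existing node of current out-degree $k$ with probability $\frac{\alpha-(\alpha-1)k}{i+\alpha-2}$. $E_n$ denotes expectation for a random tree of size $n$. Centroid. A centroid of a tree is a node minimising the sum of distances to all other nodes; equivalently, each branch at the node (maximal subtree not containing it) contains at most half of the nodes of the tree. Every tree has one centroid or two adjacent centroids; "the centroid" means the one nearest to the root. Limit variable. The law of $\mathcal{S}$ is given on $[1/2,1)$ by the density $f(\theta)=4\frac{\alpha}{\alpha-1}\left(\alpha(2\theta)^{-(\alpha+1)}-(2\theta)^{-2}\right)$ and at $1$ by the point mass $P(\mathcal{S}=1)=1-\frac{\alpha}{\alpha-1}\left(1-2^{-(\alpha-1)}\right)$;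 for $\alpha=1$ these become $f(\theta)=\frac{1-\ln(2\theta)}{\theta^2}$ and $P(\mathcal{S}=1)=1-\ln2$. *)

theory Defs
  imports "HOL-Probability.Probability"
begin

definition vsit_alpha :: "real \<Rightarrow> real \<Rightarrow> real" where
  "vsit_alpha c1 c2 = 1 + c2 / c1"

definition very_simple_increasing :: "real \<Rightarrow> real \<Rightarrow> bool" where
  "very_simple_increasing c1 c2 \<longleftrightarrow> c1 > 0 \<and>
     (c2 = 0 \<or>
      c2 < 0 \<and> 0 < vsit_alpha c1 c2 \<or>
      c2 > 0 \<and> (\<exists>d::nat. d \<ge> 2 \<and> vsit_alpha c1 c2 = real d / (real d - 1)))"

definition phi :: "real \<Rightarrow> real \<Rightarrow> real \<Rightarrow> real" where
  "phi c1 c2 u = (if c2 = 0 then exp (c1 * u) else (1 + c2 * u) powr (1 + c1 / c2))"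

text \<open>The Taylor coefficients of \<^term>\<open>phi c1 c2\<close> at 0.\<close>

definition phi_coeff :: "real \<Rightarrow> real \<Rightarrow> nat \<Rightarrow> real" where
  "phi_coeff c1 c2 k = (deriv ^^ k) (phi c1 c2) 0 / fact k"

subsection \<open>Plane increasing trees\<close>

text \<open>Plane rooted trees: the children of a node form a list, so their order matters.\<close>

datatype ptree = Node (root: nat) (children: "ptree list")

primrec nodes :: "ptree \<Rightarrow> nat list" where
  "nodes (Node v ts) = v # concat (map nodes ts)"

primrec increasing :: "ptree \<Rightarrow> bool" where
  "increasing (Node v ts) \<longleftrightarrow> list_all (\<lambda>t. v < root t) ts \<and> list_all id (map increasing ts)"

definition increasing_trees :: "nat \<Rightarrow> ptree set" where
  "increasing_trees n = {T. increasing T \<and> distinct (nodes T) \<and> set (nodes T) = {1..n}}"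

primrec weight :: "real \<Rightarrow> real \<Rightarrow> ptree \<Rightarrow> real" where
  "weight c1 c2 (Node v ts) = phi_coeff c1 c2 (length ts) * prod_list (map (weight c1 c2) ts)"

text \<open>
  For admissible parameters and \<open>n \<ge> 1\<close> the function below is a probability mass function;
  see \<open>pmf_random_tree\<close>.
\<close>

definition random_tree :: "real \<Rightarrow> real \<Rightarrow> nat \<Rightarrow> ptree pmf" where
  "random_tree c1 c2 n = embed_pmf (\<lambda>T.
     if T \<in> increasing_trees n
     then weight c1 c2 T / (\<Sum>T'\<in>increasing_trees n. weight c1 c2 T')
     else 0)"

subsection \<open>The centroid and its subtree\<close>

text \<open>Nodes are identified with their labels; \<open>edges\<close> consists of the (parent, child) pairs.\<close>

primrec edges :: "ptree \<Rightarrow> (nat \<times> nat) set" where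
  "edges (Node v ts) = (\<lambda>t. (v, root t)) ` set ts \<union> \<Union> (set (map edges ts))"

definition tree_dist :: "ptree \<Rightarrow> nat \<Rightarrow> nat \<Rightarrow> nat" where
  "tree_dist T u v = (LEAST k. (u, v) \<in> (edges T \<union> (edges T)\<inverse>) ^^ k)"

definition total_dist :: "ptree \<Rightarrow> nat \<Rightarrow> nat" where
  "total_dist T v = (\<Sum>u\<in>set (nodes T). tree_dist T v u)"

definition is_centroid :: "ptree \<Rightarrow> nat \<Rightarrow> bool" where
  "is_centroid T v \<longleftrightarrow> is_arg_min (total_dist T) (\<lambda>w. w \<in> set (nodes T)) v"

definition centroid :: "ptree \<Rightarrow> nat" where
  "centroid T = (ARG_MIN (tree_dist T (root T)) v. is_centroid T v)"

definition centroid_subtree_size :: "ptree \<Rightarrow> nat" where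
  "centroid_subtree_size T = card {w. (centroid T, w) \<in> (edges T)\<^sup>*}"

subsection \<open>The limit law\<close>

definition limit_density :: "real \<Rightarrow> real \<Rightarrow> real" where
  "limit_density a \<theta> =
     (if a = 1 then (1 - ln (2 * \<theta>)) / \<theta>\<^sup>2
      else 4 * (a / (a - 1)) * (a * (2 * \<theta>) powr (- (a + 1)) - (2 * \<theta>) powr (- 2)))"

definition limit_atom :: "real \<Rightarrow> real" where
  "limit_atom a = (if a = 1 then 1 - ln 2 else 1 - a / (a - 1) * (1 - 2 powr (- (a - 1))))"

text \<open>The absolutely continuous part on \<open>[1/2, 1)\<close> plus the point mass at 1; see \<open>emeasure_limit_law\<close>.\<close>

definition limit_law :: "real \<Rightarrow> real measure" where
  "limit_law a = measure_of UNIV (sets borel) (\<lambda>A.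
     (\<integral>\<^sup>+\<theta>\<in>A \<inter> {1/2..<1}. ennreal (limit_density a \<theta>) \<partial>lborel)
       + ennreal (limit_atom a) * indicator A 1)"

definition limit_moment :: "real \<Rightarrow> nat \<Rightarrow> real" where
  "limit_moment a r = (\<integral>x. x ^ r \<partial>limit_law a)"

subsection \<open>The closed forms\<close>

text \<open>
  Both expressions are only meaningful where their denominators do not vanish, apart from the
  term \<open>(1 - 2 powr (-(r-1))) / (r-1)\<close>, which is \<open>ln 2\<close> for \<open>r = 1\<close>.
\<close>

definition moment_formula :: "nat \<Rightarrow> real \<Rightarrow> real" where
  "moment_formula r a = limit_atom a + a / (a - 1) *
     (a / (a - real r) * (2 powr (- (real r - 1)) - 2 powr (- (a - 1)))
      - (if r = 1 then ln 2 else 1 / (real r - 1) * (1 - 2 powr (- (real r - 1)))))"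

definition mean_formula :: "real \<Rightarrow> real" where
  "mean_formula a = 1 + a / (a - 1)\<^sup>2 * (1 - 2 powr (- (a - 1)) - (a - 1) * ln 2)"

subsection \<open>Well-definedness of the random tree\<close>

lemma higher_deriv_phi:
  assumes "1 + c2 * u > 0"
  shows "(deriv ^^ k) (phi c1 c2) u =
    (\<Prod>j<k. c1 + c2 - real j * c2) *
      (if c2 = 0 then exp (c1 * u) else (1 + c2 * u) powr (1 + c1 / c2 - real k))"
  using assms
proof (induction k arbitrary: u)
  case 0
  then show ?case by (simp add: phi_def)
next
  case (Suc k)
  let ?P = "\<Prod>j<k. c1 + c2 - real j * c2"
  let ?g = "\<lambda>u. ?P * (if c2 = 0 then exp (c1 * u) else (1 + c2 * u) powr (1 + c1 / c2 - real k))"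
  have op: "open {u. 1 + c2 * u > 0}"
    by (intro open_Collect_less continuous_intros)
  have ev: "eventually (\<lambda>v. (deriv ^^ k) (phi c1 c2) v = ?g v) (nhds u)"
    using eventually_nhds_in_open[OF op, of u] Suc by (auto elim!: eventually_mono)
  have "(deriv ^^ Suc k) (phi c1 c2) u = deriv ?g u"
    using deriv_cong_ev[OF ev refl] by simp
  also have "\<dots> = (\<Prod>j<Suc k. c1 + c2 - real j * c2) *
      (if c2 = 0 then exp (c1 * u) else (1 + c2 * u) powr (1 + c1 / c2 - real (Suc k)))"
  proof (cases "c2 = 0")
    case True
    have "((\<lambda>u. ?P * exp (c1 * u)) has_field_derivative ?P * (exp (c1 * u) * c1)) (at u)"
      by (auto intro!: derivative_eq_intros)
    then show ?thesis using True by (simp add: DERIV_imp_deriv)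
  next
    case False
    have "((\<lambda>u. ?P * (1 + c2 * u) powr (1 + c1 / c2 - real k)) has_field_derivative
        ?P * ((1 + c1 / c2 - real k) * (1 + c2 * u) powr (1 + c1 / c2 - real k - 1) * c2)) (at u)"
      using Suc.prems by (auto intro!: derivative_eq_intros)
    then have "deriv ?g u = ?P * ((1 + c1 / c2 - real k) * (1 + c2 * u) powr (1 + c1 / c2 - real k - 1) * c2)"
      using False by (simp add: DERIV_imp_deriv)
    also have "\<dots> = ?P * (c1 + c2 - real k * c2) * (1 + c2 * u) powr (1 + c1 / c2 - real (Suc k))"
      using False by (simp add: field_simps)
    finally show ?thesis using False by simp
  qed
  finally show ?case .
qed

lemma phi_coeff_eq: "phi_coeff c1 c2 k = (\<Prod>j<k. c1 + c2 - real j * c2) / fact k"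
  by (simp add: phi_coeff_def higher_deriv_phi)

lemma phi_coeff_nonneg:
  assumes "very_simple_increasing c1 c2"
  shows "phi_coeff c1 c2 k \<ge> 0"
proof -
  from assms have c1: "c1 > 0" by (simp add: very_simple_increasing_def)
  have "(\<Prod>j<k. c1 + c2 - real j * c2) \<ge> 0"
  proof (cases "c2 > 0")
    case False
    have "c1 + c2 > 0"
      using assms False by (auto simp: very_simple_increasing_def vsit_alpha_def field_simps)
    moreover have "real j * c2 \<le> 0" for j :: nat
      using False by (simp add: mult_nonneg_nonpos)
    ultimately show ?thesis
      by (intro prod_nonneg) (smt (verit))
  next
    case True
    with assms obtain d :: nat where d: "d \<ge> 2" "1 + c2 / c1 = real d / (real d - 1)"
      by (auto simp: very_simple_increasing_def vsit_alpha_def)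
    have "(c1 + c2) * (real d - 1) = real d * c1"
      using d c1 by (simp add: field_simps)
    then have eq: "c1 + c2 - real j * c2 = c2 * (real d - real j)" for j
      by (simp add: algebra_simps)
    show ?thesis
    proof (cases "k \<le> d")
      case True
      then show ?thesis unfolding eq using \<open>c2 > 0\<close> by (intro prod_nonneg) simp
    next
      case False
      have "(\<Prod>j<k. c1 + c2 - real j * c2) = 0"
        unfolding eq using False by (intro prod_zero) (auto intro!: bexI[of _ d])
      then show ?thesis by (metis order_refl)
    qed
  qed
  then show ?thesis by (simp add: phi_coeff_eq)
qed

lemma weight_nonneg:
  assumes "very_simple_increasing c1 c2"
  shows "weight c1 c2 T \<ge> 0"
proof (induction T)
  case (Node v ts)
  have "prod_list (map (weight c1 c2) ts) \<ge> 0"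
    using Node by (induction ts) auto
  then show ?case using phi_coeff_nonneg[OF assms] by simp
qed

lemma finite_increasing_trees: "finite (increasing_trees n)"
proof -
  define F where "F N = {T. length (nodes T) \<le> N \<and> set (nodes T) \<subseteq> {1..n}}" for N
  have "finite (F N)" for N
  proof (induction N)
    case 0
    have "nodes T \<noteq> []" for T by (cases T) simp
    then have "F 0 = {}" by (auto simp: F_def)
    then show ?case by simp
  next
    case (Suc N)
    have len: "length ts \<le> length (concat (map nodes ts))" for ts
    proof (induction ts)
      case (Cons t ts)
      then show ?case by (cases t) simp
    qed simp
    have mem: "length (nodes t) \<le> length (concat (map nodes ts))" if "t \<in> set ts" for t ts
      using that by (induction ts) auto
    have "F (Suc N) \<subseteq> (\<lambda>(v, ts). Node v ts) ` ({1..n} \<times> {ts. set ts \<subseteq> F N \<and> length ts \<le> N})"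
    proof
      fix T assume T: "T \<in> F (Suc N)"
      obtain v ts where [simp]: "T = Node v ts" by (cases T)
      have le: "length (concat (map nodes ts)) \<le> N"
        using T by (simp add: F_def)
      have "length ts \<le> N" using len[of ts] le by linarith
      moreover have "t \<in> F N" if "t \<in> set ts" for t
        using mem[OF that] le T that by (auto simp: F_def)
      moreover have "v \<in> {1..n}" using T by (simp add: F_def)
      ultimately show "T \<in> (\<lambda>(v, ts). Node v ts) ` ({1..n} \<times> {ts. set ts \<subseteq> F N \<and> length ts \<le> N})"
        by force
    qed
    then show ?case
      by (rule finite_subset) (intro finite_imageI finite_cartesian_product finite_lists_length_le Suc.IH, simp)
  qed
  moreover have "increasing_trees n \<subseteq> F n"
    by (auto simp: increasing_trees_def F_def dest!: distinct_card)
  ultimately show ?thesis using finite_subset by blast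
qed

lemma sum_weight_pos:
  assumes "very_simple_increasing c1 c2" "n \<ge> 1"
  shows "(\<Sum>T\<in>increasing_trees n. weight c1 c2 T) > 0"
proof -
  define path where "path = rec_nat (\<lambda>v. Node v []) (\<lambda>_ p v. Node v [p (Suc v)])"
  have path [simp]: "path 0 v = Node v []" "path (Suc k) v = Node v [path k (Suc v)]" for k v
    by (simp_all add: path_def)
  have root [simp]: "root (path k v) = v" for k v by (cases k) auto
  have nodes: "nodes (path k v) = [v..<v + k + 1]" for k v
    by (induction k arbitrary: v) (auto simp: upt_rec)
  have inc: "increasing (path k v)" for k v
    by (induction k arbitrary: v) auto
  have c1: "c1 > 0" using assms by (simp add: very_simple_increasing_def)
  have "c1 + c2 > 0"
    using assms c1 by (auto simp: very_simple_increasing_def vsit_alpha_def field_simps)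
  then have w: "weight c1 c2 (path k v) > 0" for k v
    by (induction k arbitrary: v) (auto simp: phi_coeff_eq)
  have "path (n - 1) 1 \<in> increasing_trees n"
    using assms by (auto simp: increasing_trees_def inc nodes)
  then show ?thesis
    using w weight_nonneg[OF assms(1)] finite_increasing_trees by (intro sum_pos2) auto
qed

lemma pmf_random_tree:
  assumes "very_simple_increasing c1 c2" "n \<ge> 1"
  shows "pmf (random_tree c1 c2 n) T =
    (if T \<in> increasing_trees n
     then weight c1 c2 T / (\<Sum>T'\<in>increasing_trees n. weight c1 c2 T') else 0)"
proof -
  let ?Z = "\<Sum>T'\<in>increasing_trees n. weight c1 c2 T'"
  let ?f = "\<lambda>T. if T \<in> increasing_trees n then weight c1 c2 T / ?Z else 0"
  have Z: "?Z > 0" by (rule sum_weight_pos[OF assms])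
  have nn: "?f T \<ge> 0" for T using Z weight_nonneg[OF assms(1)] by simp
  have "(\<integral>\<^sup>+T. ennreal (?f T) \<partial>count_space UNIV) = (\<Sum>T\<in>increasing_trees n. ennreal (?f T))"
    by (rule nn_integral_count_space'[OF finite_increasing_trees]) auto
  also have "\<dots> = ennreal (\<Sum>T\<in>increasing_trees n. ?f T)"
    by (intro sum_ennreal nn)
  also have "(\<Sum>T\<in>increasing_trees n. ?f T) = 1"
    using Z by (simp add: sum_divide_distrib[symmetric])
  finally show ?thesis
    unfolding random_tree_def using nn by (subst pmf_embed_pmf) auto
qed

subsection \<open>Well-definedness of the limit law\<close>

lemma sets_limit_law [simp]: "sets (limit_law a) = sets borel"
  by (simp add: limit_law_def) (metis sets.sigma_sets_eq space_borel)

lemma space_limit_law [simp]: "space (limit_law a) = UNIV"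
  by (simp add: limit_law_def)

lemma borel_measurable_limit_density [measurable]: "limit_density a \<in> borel_measurable borel"
  unfolding limit_density_def by measurable

lemma emeasure_limit_law:
  assumes "A \<in> sets borel"
  shows "emeasure (limit_law a) A =
    (\<integral>\<^sup>+\<theta>\<in>A \<inter> {1/2..<1}. ennreal (limit_density a \<theta>) \<partial>lborel)
      + ennreal (limit_atom a) * indicator A 1"
proof -
  let ?h = "\<lambda>\<theta>. ennreal (limit_density a \<theta>) * indicator {1/2..<1} \<theta>"
  let ?D = "density lborel ?h" and ?R = "return borel (1::real)"
  let ?\<mu> = "\<lambda>A. (\<integral>\<^sup>+\<theta>\<in>A \<inter> {1/2..<1}. ennreal (limit_density a \<theta>) \<partial>lborel)
      + ennreal (limit_atom a) * indicator A (1::real)"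
  have eq: "?\<mu> A = emeasure ?D A + ennreal (limit_atom a) * emeasure ?R A" if "A \<in> sets borel" for A
    using that
    by (subst emeasure_density) (auto intro!: nn_integral_cong split: split_indicator)
  have "countably_additive (sets borel) ?\<mu>"
  proof (rule countably_additiveI)
    fix B :: "nat \<Rightarrow> real set"
    assume B: "range B \<subseteq> sets borel" "disjoint_family B" "\<Union> (range B) \<in> sets borel"
    have "(\<Sum>i. ?\<mu> (B i)) = (\<Sum>i. emeasure ?D (B i) + ennreal (limit_atom a) * emeasure ?R (B i))"
      using B by (intro suminf_cong eq) auto
    also have "\<dots> = (\<Sum>i. emeasure ?D (B i)) + ennreal (limit_atom a) * (\<Sum>i. emeasure ?R (B i))"
      by (subst suminf_add[symmetric]) (auto intro!: summableI)
    also have "(\<Sum>i. emeasure ?D (B i)) = emeasure ?D (\<Union> (range B))"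
      using B by (intro suminf_emeasure) auto
    also have "(\<Sum>i. emeasure ?R (B i)) = emeasure ?R (\<Union> (range B))"
      using B by (intro suminf_emeasure) auto
    finally show "(\<Sum>i. ?\<mu> (B i)) = ?\<mu> (\<Union> (range B))"
      using eq[OF B(3)] by simp
  qed
  moreover have "positive (sets borel) ?\<mu>"
    by (simp add: positive_def)
  moreover have "sigma_algebra UNIV (sets (borel :: real measure))"
    by (metis sets.sigma_algebra_axioms space_borel)
  ultimately show ?thesis
    unfolding limit_law_def using assms by (intro emeasure_measure_of_sigma)
qed

end

theory Submission
  imports Defs "HOL-Real_Asymp.Real_Asymp"
begin

text \<open>
  Let \<open>s v\<close> be the number of nodes in the subtree rooted at \<open>v\<close>. For a child \<open>w\<close> of \<open>v\<close>, the sums of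
  distances from \<open>w\<close> and from \<open>v\<close> differ by \<open>n - 2 * s w\<close>. So the centroid nearest to the root is the
  lowest of the nodes with \<open>s v > n / 2\<close>, which form a path from the root (\<open>sum_dist_minimal\<close>,
  \<open>centroid_subtree_size_eq\<close>). Each node of this path except the centroid has exactly one child on
  it. Hence the value of a function \<open>f\<close> at the size \<open>S\<close> of the centroid's subtree is the sum of
  \<open>f (s v)\<close> over the path minus the sum of \<open>f (s v)\<close> over its edges \<open>(v, w)\<close>
  (\<open>lowest_heavy_telescope\<close>). By linearity, the mean of \<open>f S\<close> only requires, for all \<open>k\<close> and \<open>j\<close>, the
  mean number of nodes \<open>v\<close> with \<open>s v = k\<close> and the mean number of edges \<open>(v, w)\<close> with \<open>s v = k\<close> and
  \<open>s w = j\<close>.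

  These means are computed by induction on \<open>n\<close>. The largest label sits on a leaf, and the recurrence
  \<open>phi_coeff_Suc\<close> for the Taylor coefficients of \<open>\<phi>\<close> says that inserting a leaf with label \<open>n + 1\<close>
  below \<open>u\<close>, at any position, multiplies the weight by \<open>c1 * (\<alpha> - (\<alpha> - 1) * k)\<close> in total, where \<open>k\<close>
  is the out-degree of \<open>u\<close> (\<open>sum_increasing_trees_Suc\<close>). The sum of these factors over the subtree
  of \<open>v\<close> is \<open>c1 * (s v + \<alpha> - 1)\<close>, so it depends on \<open>s v\<close> alone (\<open>attach_weight_subtree\<close>). This
  gives closed linear recurrences for both means, solved by \<open>expected_nodes\<close> and \<open>expected_pairs\<close>.
  In particular, for \<open>k < n\<close> the mean number of subtrees of size \<open>k\<close> is
  \<open>\<alpha> * (n + \<alpha> - 1) / ((k + \<alpha> - 1) * (k + \<alpha>))\<close>.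

  The mean of \<open>(S / n) ^ r\<close> becomes a term for \<open>k = n\<close>, which is the probability that the root is the
  centroid and tends to the atom, plus a sum over \<open>n / 2 < k < n\<close>. The latter is a Riemann sum for
  the integral of \<open>\<theta> ^ r\<close> against the limit density: the asymptotics come from
  \<open>pochhammer \<alpha> m / fact m \<sim> m powr (\<alpha> - 1) / Gamma \<alpha>\<close>, or from the harmonic numbers if \<open>\<alpha> = 1\<close>
  (\<open>heavy_child_prob_limit\<close>), and the convergence from dominated convergence
  (\<open>riemann_dominated\<close>, \<open>expectation_limit\<close>). The closed forms follow from antiderivatives. As
  \<open>0 < \<alpha> \<le> 2\<close>, the exceptional cases \<open>\<alpha> \<in> {1, r}\<close> are \<open>\<alpha> = r = 2\<close>, \<open>\<alpha> = r = 1\<close> and \<open>\<alpha> = 1 < r\<close>;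
  there the singularity of the formula is removable and its limit is compared with the integral.
\<close>

section \<open>Growing an increasing tree by one leaf\<close>

text \<open>
  All trees that arise from a tree by inserting a leaf with label \<open>x\<close>. A node offers one place
  before each of its children and one after the last, so a forest is traversed from left to right,
  and a leaf is put either between two trees or inside one of them. Lists are used so that sums over
  the results follow the recursion.
\<close>

fun grow :: "nat \<Rightarrow> ptree \<Rightarrow> ptree list" and grow_forest :: "nat \<Rightarrow> ptree list \<Rightarrow> ptree list list" where
  "grow x (Node v ts) = map (Node v) (grow_forest x ts)"
| "grow_forest x [] = [[Node x []]]"
| "grow_forest x (t # ts) =
     (Node x [] # t # ts) # map (\<lambda>t'. t' # ts) (grow x t) @ map ((#) t) (grow_forest x ts)"

text \<open>
  The inverse operation. The traversal of a forest stops once \<open>x\<close> is found as a root, since labels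
  are distinct.
\<close>

fun prune :: "nat \<Rightarrow> ptree \<Rightarrow> ptree" and prune_forest :: "nat \<Rightarrow> ptree list \<Rightarrow> ptree list" where
  "prune x (Node v ts) = Node v (prune_forest x ts)"
| "prune_forest x [] = []"
| "prune_forest x (t # ts) = (if root t = x then ts else prune x t # prune_forest x ts)"

abbreviation forest_nodes :: "ptree list \<Rightarrow> nat list" where
  "forest_nodes ts \<equiv> concat (map nodes ts)"

abbreviation forest_edges :: "ptree list \<Rightarrow> (nat \<times> nat) set" where
  "forest_edges ts \<equiv> \<Union> (set (map edges ts))"

abbreviation forest_weight :: "real \<Rightarrow> real \<Rightarrow> ptree list \<Rightarrow> real" where
  "forest_weight c1 c2 ts \<equiv> prod_list (map (weight c1 c2) ts)"

lemma root_in_nodes: "root t \<in> set (nodes t)"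
  by (cases t) auto

lemma root_grow: "t' \<in> set (grow x t) \<Longrightarrow> root t' = root t"
  by (cases t) auto

lemma nodes_grow:
  "T' \<in> set (grow x T) \<Longrightarrow> mset (nodes T') = add_mset x (mset (nodes T))"
  "ts' \<in> set (grow_forest x ts) \<Longrightarrow> mset (forest_nodes ts') = add_mset x (mset (forest_nodes ts))"
  by (induction x T and x ts arbitrary: T' and ts' rule: grow_grow_forest.induct) auto

lemma prune_fresh:
  "x \<notin> set (nodes T) \<Longrightarrow> prune x T = T"
  "x \<notin> set (forest_nodes ts) \<Longrightarrow> prune_forest x ts = ts"
  by (induction x T and x ts rule: prune_prune_forest.induct) (use root_in_nodes in auto)

lemma prune_grow:
  "x \<notin> set (nodes T) \<Longrightarrow> T' \<in> set (grow x T) \<Longrightarrow> prune x T' = T"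
  "x \<notin> set (forest_nodes ts) \<Longrightarrow> ts' \<in> set (grow_forest x ts) \<Longrightarrow> prune_forest x ts' = ts"
proof (induction x T and x ts arbitrary: T' and ts' rule: grow_grow_forest.induct)
  case (3 x t ts)
  then show ?case
    using root_in_nodes[of t] root_grow[of _ x t] by (auto simp: prune_fresh)
qed auto

lemma distinct_grow:
  "x \<notin> set (nodes T) \<Longrightarrow> distinct (grow x T)"
  "x \<notin> set (forest_nodes ts) \<Longrightarrow> distinct (grow_forest x ts)"
proof (induction x T and x ts rule: grow_grow_forest.induct)
  case (3 x t ts)
  have "Node x [] \<noteq> t'" if "t' = t \<or> t' \<in> set (grow x t)" for t'
  proof
    assume "Node x [] = t'"
    then have "root t = x" using that root_grow[of t' x t] by auto
    then show False using root_in_nodes[of t] 3(3) by auto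
  qed
  moreover have "t \<notin> set (grow x t)"
    using nodes_grow(1)[of t x t] by auto
  ultimately show ?case using 3 by (auto simp: distinct_map inj_on_def)
qed (auto simp: distinct_map inj_on_def)

text \<open>
  A node of an increasing tree that carries the largest label has no children, so removing it and
  inserting a leaf at the same place restores the tree.
\<close>

lemma grow_prune:
  "x \<in> set (nodes T) \<Longrightarrow> root T \<noteq> x \<Longrightarrow> increasing T \<Longrightarrow> distinct (nodes T) \<Longrightarrow>
     \<forall>y\<in>set (nodes T). y \<le> x \<Longrightarrow> T \<in> set (grow x (prune x T))"
  "x \<in> set (forest_nodes ts) \<Longrightarrow> list_all increasing ts \<Longrightarrow> distinct (forest_nodes ts) \<Longrightarrow>
     \<forall>y\<in>set (forest_nodes ts). y \<le> x \<Longrightarrow> ts \<in> set (grow_forest x (prune_forest x ts))"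
proof (induction x T and x ts rule: prune_prune_forest.induct)
  case (1 x v ts)
  then show ?case by (auto simp: list.pred_map list_all_iff)
next
  case (3 x t ts)
  have head: "s # us \<in> set (grow_forest x us)" if "s = Node x []" for s us
    using that by (cases us) auto
  show ?case
  proof (cases "root t = x")
    case True
    obtain us where t: "t = Node x us" using True by (cases t) auto
    have "us = []"
    proof (rule ccontr)
      assume "us \<noteq> []"
      then obtain u us' where "us = u # us'" by (cases us) auto
      then show False using 3(4,6) t root_in_nodes[of u] by force
    qed
    then show ?thesis using head t by simp
  next
    case False
    then show ?thesis
    proof (cases "x \<in> set (nodes t)")
      case True
      then have "x \<notin> set (forest_nodes ts)" using 3 by auto
      then show ?thesis using True False 3 by (auto simp: prune_fresh)
    next
      case nt: False
      then show ?thesis using False 3 by (auto simp: prune_fresh)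
    qed
  qed
qed auto

text \<open>
  The last conjunct is the condition that a parent \<open>v\<close> imposes on the roots of its subtrees; a new
  root \<open>x\<close> satisfies it because \<open>x\<close> exceeds all other labels.
\<close>

lemma increasing_grow_iff:
  "\<forall>y\<in>set (nodes T). y < x \<Longrightarrow> T' \<in> set (grow x T) \<Longrightarrow> increasing T' \<longleftrightarrow> increasing T"
  "\<forall>y\<in>set (forest_nodes ts). y < x \<Longrightarrow> ts' \<in> set (grow_forest x ts) \<Longrightarrow>
     (list_all increasing ts' \<longleftrightarrow> list_all increasing ts) \<and>
     (\<forall>v<x. list_all (\<lambda>t. v < root t) ts' \<longleftrightarrow> list_all (\<lambda>t. v < root t) ts)"
proof (induction x T and x ts arbitrary: T' and ts' rule: grow_grow_forest.induct)
  case (1 x v ts)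
  then obtain ts' where "T' = Node v ts'" "ts' \<in> set (grow_forest x ts)" by auto
  then show ?case using 1 by (auto simp: list.pred_map o_def)
next
  case (3 x t ts)
  then show ?case by (auto simp: root_grow)
qed auto

lemma increasing_trees_Suc:
  assumes "n \<ge> 1"
  shows "increasing_trees (Suc n) = (\<Union>T\<in>increasing_trees n. set (grow (Suc n) T))"
proof (intro equalityI subsetI)
  fix T assume "T \<in> (\<Union>T\<in>increasing_trees n. set (grow (Suc n) T))"
  then obtain T0 where T0: "T0 \<in> increasing_trees n" "T \<in> set (grow (Suc n) T0)" by auto
  have m: "mset (nodes T) = mset (Suc n # nodes T0)" using nodes_grow(1)[OF T0(2)] by simp
  have "distinct (nodes T)"
    using mset_eq_imp_distinct_iff[OF m] T0(1) by (auto simp: increasing_trees_def)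
  moreover have "set (nodes T) = {1..Suc n}"
    using mset_eq_setD[OF m] T0(1) by (auto simp: increasing_trees_def)
  moreover have "increasing T"
    using increasing_grow_iff(1)[OF _ T0(2)] T0(1) by (auto simp: increasing_trees_def)
  ultimately show "T \<in> increasing_trees (Suc n)" by (auto simp: increasing_trees_def)
next
  fix T assume T: "T \<in> increasing_trees (Suc n)"
  have rt: "root T \<noteq> Suc n"
  proof
    assume r: "root T = Suc n"
    obtain ts where t: "T = Node (Suc n) ts" using r by (cases T) auto
    show False
    proof (cases ts)
      case Nil
      then have "{Suc n} = {1..Suc n}" using T t by (simp add: increasing_trees_def)
      moreover have "1 \<in> {1..Suc n}" by simp
      ultimately show False using assms by (metis Suc_n_not_le_n singletonD)
    next
      case (Cons u us)
      have "root u \<in> set (nodes T)" using t Cons root_in_nodes[of u] by simp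
      then have "root u \<in> {1..Suc n}" using T by (simp add: increasing_trees_def)
      moreover have "root u > Suc n" using T t Cons by (simp add: increasing_trees_def)
      ultimately show False by auto
    qed
  qed
  have in': "Suc n \<in> set (nodes T)" "increasing T" "distinct (nodes T)" "\<forall>y\<in>set (nodes T). y \<le> Suc n"
    using T by (auto simp: increasing_trees_def)
  let ?P = "prune (Suc n) T"
  have g: "T \<in> set (grow (Suc n) ?P)" using grow_prune(1) in' rt by blast
  have m: "mset (nodes T) = mset (Suc n # nodes ?P)" using nodes_grow(1)[OF g] by simp
  have d: "distinct (Suc n # nodes ?P)" using mset_eq_imp_distinct_iff[OF m] in' by blast
  have s: "insert (Suc n) (set (nodes ?P)) = {1..Suc n}"
    using mset_eq_setD[OF m] T by (auto simp: increasing_trees_def)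
  have s': "set (nodes ?P) = {1..n}" using s d atLeastAtMostSuc_conv[of 1 n]
    by (metis One_nat_def Suc_le_mono insert_ident distinct.simps(2) le0 atLeastAtMost_iff Suc_n_not_le_n)
  moreover have "increasing ?P" using increasing_grow_iff(1)[OF _ g] in' s' by auto
  ultimately show "T \<in> (\<Union>T\<in>increasing_trees n. set (grow (Suc n) T))"
    using g d by (auto simp: increasing_trees_def)
qed

text \<open>
  In the notation of the growth process this is \<open>c1 * (\<alpha> - (\<alpha> - 1) * k)\<close> for a node \<open>u\<close> of
  out-degree \<open>k\<close>.
\<close>

definition attach_weight :: "real \<Rightarrow> real \<Rightarrow> (nat \<times> nat) set \<Rightarrow> nat \<Rightarrow> real" where
  "attach_weight c1 c2 E u = c1 + c2 - c2 * real (card (E `` {u}))"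

text \<open>
  A node with \<open>k\<close> children offers \<open>k + 1\<close> places for a new one. The choice of \<open>\<phi>\<close> makes their
  total relative weight linear in \<open>k\<close>, which is why the random tree can be grown node by node. The
  recurrence is stated without division because for \<open>d\<close>-ary trees the coefficients beyond \<open>d\<close> vanish.
\<close>

lemma phi_coeff_Suc:
  "real (Suc k) * phi_coeff c1 c2 (Suc k) = (c1 + c2 - c2 * real k) * phi_coeff c1 c2 k"
  by (simp add: phi_coeff_eq divide_simps)

lemma edges_subset: "edges T \<subseteq> set (nodes T) \<times> set (nodes T)"
proof (induction T)
  case (Node v ts)
  then show ?case using root_in_nodes by fastforce
qed

lemma forest_edges_subset: "forest_edges ts \<subseteq> set (forest_nodes ts) \<times> set (forest_nodes ts)"
  using edges_subset by fastforce

text \<open>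
  Inserting a leaf below \<open>u\<close> multiplies the weight, summed over all positions, by
  \<open>attach_weight c1 c2 E u\<close>. The weights are tested against an arbitrary function of the edge set,
  since distances and subtree sizes only depend on it. In the forest version the function also sees
  the number and the set of roots: these determine the weight and the edges of the node above.
\<close>

lemma sum_grow:
  "distinct (nodes T) \<Longrightarrow>
     (\<Sum>T'\<leftarrow>grow x T. weight c1 c2 T' * G (edges T')) =
     weight c1 c2 T * (\<Sum>u\<leftarrow>nodes T. attach_weight c1 c2 (edges T) u * G (insert (u, x) (edges T)))"
  "distinct (forest_nodes ts) \<Longrightarrow>
     (\<Sum>ts'\<leftarrow>grow_forest x ts. forest_weight c1 c2 ts' * H (length ts') (root ` set ts') (forest_edges ts')) =
     forest_weight c1 c2 ts *
       (real (Suc (length ts)) * H (Suc (length ts)) (insert x (root ` set ts)) (forest_edges ts) +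
        (\<Sum>u\<leftarrow>forest_nodes ts. attach_weight c1 c2 (forest_edges ts) u *
           H (length ts) (root ` set ts) (insert (u, x) (forest_edges ts))))"
proof (induction x T and x ts arbitrary: G and H rule: grow_grow_forest.induct)
  case (1 x v ts)
  define H where "H l R X = phi_coeff c1 c2 l * G ((\<lambda>r. (v, r)) ` R \<union> X)" for l R X
  have d: "distinct (forest_nodes ts)" "v \<notin> set (forest_nodes ts)" using 1 by auto
  have ed: "edges (Node v us) = (\<lambda>r. (v, r)) ` root ` set us \<union> forest_edges us" for us
    by (simp add: image_image)
  have "distinct (map root us)" if "distinct (forest_nodes us)" for us
    using that
  proof (induction us)
    case (Cons u us)
    have "root u \<noteq> root u'" if "u' \<in> set us" for u'
      using Cons.prems that root_in_nodes[of u] root_in_nodes[of u'] by auto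
    then show ?case using Cons by auto
  qed simp
  from distinct_card[OF this[OF d(1)]] have len: "card (root ` set ts) = length ts" by simp
  have "edges (Node v ts) `` {v} = root ` set ts"
    unfolding ed using d(2) forest_edges_subset[of ts] by auto
  then have av: "attach_weight c1 c2 (edges (Node v ts)) v = c1 + c2 - c2 * real (length ts)"
    by (simp add: attach_weight_def len)
  have au: "attach_weight c1 c2 (edges (Node v ts)) u = attach_weight c1 c2 (forest_edges ts) u"
    if "u \<in> set (forest_nodes ts)" for u
  proof -
    have "edges (Node v ts) `` {u} = forest_edges ts `` {u}"
      unfolding ed using d(2) that by auto
    then show ?thesis by (simp add: attach_weight_def)
  qed
  have "(\<Sum>T'\<leftarrow>grow x (Node v ts). weight c1 c2 T' * G (edges T')) =
      (\<Sum>us\<leftarrow>grow_forest x ts. forest_weight c1 c2 us * H (length us) (root ` set us) (forest_edges us))"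
    by (simp add: o_def H_def image_image mult_ac)
  also have "\<dots> = forest_weight c1 c2 ts *
       (real (Suc (length ts)) * H (Suc (length ts)) (insert x (root ` set ts)) (forest_edges ts) +
        (\<Sum>u\<leftarrow>forest_nodes ts. attach_weight c1 c2 (forest_edges ts) u *
           H (length ts) (root ` set ts) (insert (u, x) (forest_edges ts))))"
    by (rule 1(1)[OF d(1)])
  also have "real (Suc (length ts)) * H (Suc (length ts)) (insert x (root ` set ts)) (forest_edges ts) =
     phi_coeff c1 c2 (length ts) * (attach_weight c1 c2 (edges (Node v ts)) v * G (insert (v, x) (edges (Node v ts))))"
  proof -
    have "real (Suc (length ts)) * (phi_coeff c1 c2 (Suc (length ts)) * g) =
        phi_coeff c1 c2 (length ts) * ((c1 + c2 - c2 * real (length ts)) * g)" for g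
      unfolding mult.assoc[symmetric] phi_coeff_Suc by (simp add: mult_ac)
    moreover have "(\<lambda>r. (v, r)) ` insert x (root ` set ts) \<union> forest_edges ts = insert (v, x) (edges (Node v ts))"
      unfolding ed by simp
    ultimately show ?thesis unfolding H_def av by simp
  qed
  also have "(\<Sum>u\<leftarrow>forest_nodes ts. attach_weight c1 c2 (forest_edges ts) u *
           H (length ts) (root ` set ts) (insert (u, x) (forest_edges ts))) =
     phi_coeff c1 c2 (length ts) * (\<Sum>u\<leftarrow>forest_nodes ts. attach_weight c1 c2 (edges (Node v ts)) u *
           G (insert (u, x) (edges (Node v ts))))"
    unfolding sum_list_const_mult[symmetric]
  proof (intro arg_cong[of _ _ sum_list] map_cong refl)
    fix u assume u: "u \<in> set (forest_nodes ts)"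
    have "H (length ts) (root ` set ts) (insert (u, x) (forest_edges ts)) =
        phi_coeff c1 c2 (length ts) * G (insert (u, x) (edges (Node v ts)))"
      unfolding H_def ed by simp
    then show "attach_weight c1 c2 (forest_edges ts) u * H (length ts) (root ` set ts) (insert (u, x) (forest_edges ts)) =
        phi_coeff c1 c2 (length ts) * (attach_weight c1 c2 (edges (Node v ts)) u * G (insert (u, x) (edges (Node v ts))))"
      unfolding au[OF u] by (simp only: mult_ac)
  qed
  finally show ?case by (simp add: algebra_simps del: edges.simps)
next
  case (2 x)
  then show ?case by (simp add: phi_coeff_eq)
next
  case (3 x t ts)
  have d: "distinct (nodes t)" "distinct (forest_nodes ts)" "set (nodes t) \<inter> set (forest_nodes ts) = {}"
    using 3 by auto
  let ?l = "length ts" and ?R = "root ` set ts" and ?X = "forest_edges ts"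
  let ?w = "weight c1 c2 t" and ?W = "forest_weight c1 c2 ts" and ?q = "attach_weight c1 c2"
  \<comment> \<open>The out-degree of a node of the first tree is not affected by the others, and conversely.\<close>
  have q1: "?q (edges t) u = ?q (edges t \<union> ?X) u" if "u \<in> set (nodes t)" for u
  proof -
    have "(edges t \<union> ?X) `` {u} = edges t `` {u}"
      using that d(3) forest_edges_subset[of ts] by blast
    then show ?thesis by (simp add: attach_weight_def)
  qed
  have q2: "?q ?X u = ?q (edges t \<union> ?X) u" if "u \<in> set (forest_nodes ts)" for u
  proof -
    have "(edges t \<union> ?X) `` {u} = ?X `` {u}"
      using that d(3) edges_subset[of t] by blast
    then show ?thesis by (simp add: attach_weight_def)
  qed
  have w0: "weight c1 c2 (Node x []) = 1" by (simp add: phi_coeff_eq)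
  have A: "(\<Sum>t'\<leftarrow>grow x t. forest_weight c1 c2 (t' # ts) * H (Suc ?l) (root ` set (t' # ts)) (forest_edges (t' # ts))) =
     ?w * ?W * (\<Sum>u\<leftarrow>nodes t. ?q (edges t \<union> ?X) u * H (Suc ?l) (insert (root t) ?R) (insert (u, x) (edges t \<union> ?X)))"
  proof -
    have "(\<Sum>t'\<leftarrow>grow x t. forest_weight c1 c2 (t' # ts) * H (Suc ?l) (root ` set (t' # ts)) (forest_edges (t' # ts))) =
       ?W * (\<Sum>t'\<leftarrow>grow x t. weight c1 c2 t' * H (Suc ?l) (insert (root t) ?R) (edges t' \<union> ?X))"
      unfolding sum_list_const_mult[symmetric]
      by (intro arg_cong[of _ _ sum_list] map_cong refl) (simp add: root_grow mult_ac)
    also have "\<dots> = ?W * (?w * (\<Sum>u\<leftarrow>nodes t. ?q (edges t) u * H (Suc ?l) (insert (root t) ?R) (insert (u, x) (edges t) \<union> ?X)))"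
      by (subst 3(1)[OF d(1)]) simp
    also have "(\<Sum>u\<leftarrow>nodes t. ?q (edges t) u * H (Suc ?l) (insert (root t) ?R) (insert (u, x) (edges t) \<union> ?X)) =
       (\<Sum>u\<leftarrow>nodes t. ?q (edges t \<union> ?X) u * H (Suc ?l) (insert (root t) ?R) (insert (u, x) (edges t \<union> ?X)))"
      by (intro arg_cong[of _ _ sum_list] map_cong refl) (simp only: q1 Un_insert_left)
    finally show ?thesis by simp
  qed
  have B: "(\<Sum>us\<leftarrow>grow_forest x ts. forest_weight c1 c2 (t # us) * H (Suc (length us)) (root ` set (t # us)) (forest_edges (t # us))) =
     ?w * (?W * (real (Suc ?l) * H (Suc (Suc ?l)) (insert x (insert (root t) ?R)) (edges t \<union> ?X) +
        (\<Sum>u\<leftarrow>forest_nodes ts. ?q (edges t \<union> ?X) u * H (Suc ?l) (insert (root t) ?R) (insert (u, x) (edges t \<union> ?X)))))"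
  proof -
    have "(\<Sum>us\<leftarrow>grow_forest x ts. forest_weight c1 c2 (t # us) * H (Suc (length us)) (root ` set (t # us)) (forest_edges (t # us))) =
       ?w * (\<Sum>us\<leftarrow>grow_forest x ts. forest_weight c1 c2 us * H (Suc (length us)) (insert (root t) (root ` set us)) (edges t \<union> forest_edges us))"
      unfolding sum_list_const_mult[symmetric] by (simp add: mult_ac)
    also have "\<dots> = ?w * (?W * (real (Suc ?l) * H (Suc (Suc ?l)) (insert (root t) (insert x ?R)) (edges t \<union> ?X) +
        (\<Sum>u\<leftarrow>forest_nodes ts. ?q ?X u * H (Suc ?l) (insert (root t) ?R) (edges t \<union> insert (u, x) ?X))))"
      by (subst 3(2)[OF d(2), of "\<lambda>l R X. H (Suc l) (insert (root t) R) (edges t \<union> X)"]) simp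
    also have "(\<Sum>u\<leftarrow>forest_nodes ts. ?q ?X u * H (Suc ?l) (insert (root t) ?R) (edges t \<union> insert (u, x) ?X)) =
      (\<Sum>u\<leftarrow>forest_nodes ts. ?q (edges t \<union> ?X) u * H (Suc ?l) (insert (root t) ?R) (insert (u, x) (edges t \<union> ?X)))"
      by (intro arg_cong[of _ _ sum_list] map_cong refl) (simp only: q2 Un_insert_right)
    finally show ?thesis by (simp add: insert_commute)
  qed
  have "(\<Sum>ts'\<leftarrow>grow_forest x (t # ts). forest_weight c1 c2 ts' * H (length ts') (root ` set ts') (forest_edges ts')) =
     ?w * ?W * H (Suc (Suc ?l)) (insert x (insert (root t) ?R)) (edges t \<union> ?X) +
     (\<Sum>t'\<leftarrow>grow x t. forest_weight c1 c2 (t' # ts) * H (Suc ?l) (root ` set (t' # ts)) (forest_edges (t' # ts))) +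
     (\<Sum>us\<leftarrow>grow_forest x ts. forest_weight c1 c2 (t # us) * H (Suc (length us)) (root ` set (t # us)) (forest_edges (t # us)))"
    using w0 by (simp add: o_def)
  also have "\<dots> = ?w * ?W * (real (Suc (Suc ?l)) * H (Suc (Suc ?l)) (insert x (insert (root t) ?R)) (edges t \<union> ?X) +
      (\<Sum>u\<leftarrow>nodes t @ forest_nodes ts. ?q (edges t \<union> ?X) u * H (Suc ?l) (insert (root t) ?R) (insert (u, x) (edges t \<union> ?X))))"
    unfolding A B by (simp add: algebra_simps)
  finally show ?case by simp
qed

lemma edges_grow:
  "T' \<in> set (grow x T) \<Longrightarrow> \<exists>u\<in>set (nodes T). edges T' = insert (u, x) (edges T)"
  "ts' \<in> set (grow_forest x ts) \<Longrightarrow>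
     root ` set ts' = insert x (root ` set ts) \<and> forest_edges ts' = forest_edges ts \<or>
     (\<exists>u\<in>set (forest_nodes ts). root ` set ts' = root ` set ts \<and>
        forest_edges ts' = insert (u, x) (forest_edges ts))"
proof (induction x T and x ts arbitrary: T' and ts' rule: grow_grow_forest.induct)
  case (1 x v ts)
  have ed: "edges (Node v us) = (\<lambda>r. (v, r)) ` root ` set us \<union> forest_edges us" for us
    by (simp add: image_image)
  obtain ts' where ts': "T' = Node v ts'" "ts' \<in> set (grow_forest x ts)" using 1 by auto
  from 1(1)[OF ts'(2)] show ?case
  proof (elim disjE bexE conjE)
    assume "root ` set ts' = insert x (root ` set ts)" "forest_edges ts' = forest_edges ts"
    then have "edges T' = insert (v, x) (edges (Node v ts))"
      unfolding ts'(1) ed by simp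
    then show ?thesis by auto
  next
    fix u assume u: "u \<in> set (forest_nodes ts)" "root ` set ts' = root ` set ts"
      "forest_edges ts' = insert (u, x) (forest_edges ts)"
    then have "edges T' = insert (u, x) (edges (Node v ts))"
      unfolding ts'(1) ed by (simp only: Un_insert_right)
    then show ?thesis using u(1) by auto
  qed
next
  case (3 x t ts)
  then consider "ts' = Node x [] # t # ts" | t' where "ts' = t' # ts" "t' \<in> set (grow x t)"
    | us where "ts' = t # us" "us \<in> set (grow_forest x ts)" by auto
  then show ?case
  proof cases
    case 2
    from 3(1)[OF 2(2)] obtain u where u: "u \<in> set (nodes t)" "edges t' = insert (u, x) (edges t)" by blast
    have "root ` set ts' = root ` set (t # ts)" using 2 by (simp add: root_grow)
    moreover have "forest_edges ts' = insert (u, x) (forest_edges (t # ts))" using 2 u by simp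
    ultimately show ?thesis using u(1) by auto
  next
    case 3
    from "3.IH"(2)[OF 3(2)] show ?thesis
    proof (elim disjE bexE conjE)
      assume "root ` set us = insert x (root ` set ts)" "forest_edges us = forest_edges ts"
      then show ?thesis unfolding 3(1) by (simp add: insert_commute)
    next
      fix u assume u: "u \<in> set (forest_nodes ts)" "root ` set us = root ` set ts"
        "forest_edges us = insert (u, x) (forest_edges ts)"
      have "root ` set ts' = root ` set (t # ts)" using 3 u by simp
      moreover have "forest_edges ts' = insert (u, x) (forest_edges (t # ts))" using 3 u by simp
      ultimately show ?thesis using u(1) by auto
    qed
  qed auto
qed auto

text \<open>
  Every tree of size \<open>n + 1\<close> arises from exactly one tree of size \<open>n\<close>. So the random tree, seen as a set
  of edges, evolves by attaching \<open>n + 1\<close> to \<open>u\<close> with probability proportional to \<open>attach_weight c1 c2 E u\<close>.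
\<close>

lemma sum_increasing_trees_Suc:
  assumes "n \<ge> 1"
  shows "(\<Sum>T\<in>increasing_trees (Suc n). weight c1 c2 T * G (edges T)) =
    (\<Sum>T\<in>increasing_trees n. weight c1 c2 T *
       (\<Sum>u=1..n. attach_weight c1 c2 (edges T) u * G (insert (u, Suc n) (edges T))))"
proof -
  have fresh: "Suc n \<notin> set (nodes T)" "distinct (nodes T)" "set (nodes T) = {1..n}"
    if "T \<in> increasing_trees n" for T
    using that by (auto simp: increasing_trees_def)
  have "(\<Sum>T\<in>increasing_trees (Suc n). weight c1 c2 T * G (edges T)) =
     (\<Sum>T\<in>increasing_trees n. \<Sum>T'\<in>set (grow (Suc n) T). weight c1 c2 T' * G (edges T'))"
    unfolding increasing_trees_Suc[OF assms]
  proof (rule sum.UNION_disjoint[OF finite_increasing_trees], simp, intro ballI impI)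
    fix T1 T2 assume "T1 \<in> increasing_trees n" "T2 \<in> increasing_trees n" "T1 \<noteq> T2"
    then show "set (grow (Suc n) T1) \<inter> set (grow (Suc n) T2) = {}"
      using prune_grow(1) fresh(1) by blast
  qed
  also have "\<dots> = (\<Sum>T\<in>increasing_trees n. weight c1 c2 T *
       (\<Sum>u=1..n. attach_weight c1 c2 (edges T) u * G (insert (u, Suc n) (edges T))))"
  proof (rule sum.cong[OF refl])
    fix T assume T: "T \<in> increasing_trees n"
    have "(\<Sum>T'\<in>set (grow (Suc n) T). weight c1 c2 T' * G (edges T')) =
       (\<Sum>T'\<leftarrow>grow (Suc n) T. weight c1 c2 T' * G (edges T'))"
      by (rule sum.distinct_set_conv_list[OF distinct_grow(1)[OF fresh(1)[OF T]]])
    also have "\<dots> = weight c1 c2 T * (\<Sum>u\<leftarrow>nodes T. attach_weight c1 c2 (edges T) u * G (insert (u, Suc n) (edges T)))"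
      by (rule sum_grow(1)[OF fresh(2)[OF T]])
    also have "(\<Sum>u\<leftarrow>nodes T. attach_weight c1 c2 (edges T) u * G (insert (u, Suc n) (edges T))) =
      (\<Sum>u=1..n. attach_weight c1 c2 (edges T) u * G (insert (u, Suc n) (edges T)))"
      unfolding fresh(3)[OF T, symmetric]
      by (rule sum.distinct_set_conv_list[OF fresh(2)[OF T], symmetric])
    finally show "(\<Sum>T'\<in>set (grow (Suc n) T). weight c1 c2 T' * G (edges T')) = weight c1 c2 T *
      (\<Sum>u=1..n. attach_weight c1 c2 (edges T) u * G (insert (u, Suc n) (edges T)))" .
  qed
  finally show ?thesis .
qed

section \<open>Increasing trees as edge sets\<close>

text \<open>
  The trees that remain when the order of children is forgotten. Since labels increase along edges
  and every node except \<open>1\<close> has exactly one parent, such a relation is automatically acyclic and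
  connected.
\<close>

definition recursive_tree :: "nat \<Rightarrow> (nat \<times> nat) set \<Rightarrow> bool" where
  "recursive_tree n E \<longleftrightarrow> E \<subseteq> {1..n} \<times> {1..n} \<and> (\<forall>(v, w)\<in>E. v < w) \<and> (\<forall>w\<in>{2..n}. \<exists>!v. (v, w) \<in> E)"

definition subtree :: "(nat \<times> nat) set \<Rightarrow> nat \<Rightarrow> nat set" where
  "subtree E v = E\<^sup>* `` {v}"

definition subsize :: "(nat \<times> nat) set \<Rightarrow> nat \<Rightarrow> nat" where
  "subsize E v = card (subtree E v)"

lemma self_in_subtree [simp]: "v \<in> subtree E v"
  by (simp add: subtree_def)

context
  fixes n E
  assumes rt: "recursive_tree n E"
begin

lemma recursive_tree_edge:
  assumes "(v, w) \<in> E"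
  shows "v \<in> {1..n}" "w \<in> {2..n}" "v < w"
  using assms rt by (fastforce simp: recursive_tree_def)+

lemma recursive_tree_finite: "finite E"
  using rt by (auto simp: recursive_tree_def dest: finite_subset)

lemma recursive_tree_parent_unique: "(v, w) \<in> E \<Longrightarrow> (v', w) \<in> E \<Longrightarrow> v = v'"
  using rt recursive_tree_edge(2)[of v w] unfolding recursive_tree_def by blast

lemma recursive_tree_parent_exists: "w \<in> {2..n} \<Longrightarrow> \<exists>v. (v, w) \<in> E"
  using rt unfolding recursive_tree_def by blast

lemma subtree_ge: "w \<in> subtree E v \<Longrightarrow> v \<le> w"
  unfolding subtree_def Image_singleton_iff
  by (induction rule: rtrancl_induct) (auto dest: recursive_tree_edge)

lemma subtree_subset: "v \<in> {1..n} \<Longrightarrow> subtree E v \<subseteq> {1..n}"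
proof
  fix w assume v: "v \<in> {1..n}" and "w \<in> subtree E v"
  then have "(v, w) \<in> E\<^sup>*" by (simp add: subtree_def)
  then show "w \<in> {1..n}" using v
    by (induction rule: rtrancl_induct) (auto dest: recursive_tree_edge)
qed

lemma finite_subtree: "v \<in> {1..n} \<Longrightarrow> finite (subtree E v)"
  using subtree_subset finite_subset by blast

lemma subsize_pos: "v \<in> {1..n} \<Longrightarrow> subsize E v \<ge> 1"
  using finite_subtree self_in_subtree[of v E] unfolding subsize_def
  by (metis One_nat_def Suc_leI card_gt_0_iff empty_iff)

lemma subsize_le: "v \<in> {1..n} \<Longrightarrow> subsize E v \<le> n"
  using card_mono[OF _ subtree_subset, of v] unfolding subsize_def by simp

lemma subtree_parent:
  assumes "w \<in> subtree E v" "w \<noteq> v"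
  shows "\<exists>p. (p, w) \<in> E \<and> p \<in> subtree E v"
  using assms unfolding subtree_def by (auto elim: rtranclE)

lemma subtree_child_subset: "(v, w) \<in> E \<Longrightarrow> subtree E w \<subseteq> subtree E v - {v}"
proof
  fix x assume e: "(v, w) \<in> E" and x: "x \<in> subtree E w"
  then have "(v, x) \<in> E\<^sup>*" by (auto simp: subtree_def intro: converse_rtrancl_into_rtrancl)
  moreover have "x > v" using subtree_ge[OF x] recursive_tree_edge(3)[OF e] by simp
  ultimately show "x \<in> subtree E v - {v}" by (auto simp: subtree_def)
qed

lemma subsize_child: "(v, w) \<in> E \<Longrightarrow> subsize E w < subsize E v"
  unfolding subsize_def using subtree_child_subset[of v w] finite_subtree[OF recursive_tree_edge(1)] self_in_subtree[of v E]
  by (intro psubset_card_mono) blast+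

text \<open>
  Going from a node to its parent decreases the label, so this ends at the root \<open>1\<close>.
\<close>

lemma subtree_root: "n \<ge> 1 \<Longrightarrow> subtree E 1 = {1..n}"
proof (rule antisym)
  show "n \<ge> 1 \<Longrightarrow> subtree E 1 \<subseteq> {1..n}" by (rule subtree_subset) simp
  show "{1..n} \<subseteq> subtree E 1"
  proof
    fix w assume "w \<in> {1..n}"
    then show "w \<in> subtree E 1"
    proof (induction w rule: less_induct)
      case (less w)
      show ?case
      proof (cases "w = 1")
        case False
        then obtain v where v: "(v, w) \<in> E" using recursive_tree_parent_exists[of w] less.prems by force
        then have "v \<in> subtree E 1" using less.IH recursive_tree_edge by blast
        then show ?thesis using v by (auto simp: subtree_def)
      qed simp
    qed
  qed
qed

lemma subsize_root: "n \<ge> 1 \<Longrightarrow> subsize E 1 = n"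
  unfolding subsize_def by (subst subtree_root) simp_all

text \<open>
  Every node of the subtree other than \<open>v\<close> is a child of exactly one node of the subtree.
\<close>

lemma sum_outdegree_subtree:
  assumes v: "v \<in> {1..n}"
  shows "(\<Sum>u\<in>subtree E v. card (E `` {u})) = subsize E v - 1"
proof -
  have "(\<Sum>u\<in>subtree E v. card (E `` {u})) = card (\<Union>u\<in>subtree E v. E `` {u})"
    by (rule card_UN_disjoint[symmetric])
       (use finite_subtree[OF v] recursive_tree_finite recursive_tree_parent_unique in \<open>auto simp: finite_Image\<close>)
  also have "(\<Union>u\<in>subtree E v. E `` {u}) = subtree E v - {v}"
  proof (intro equalityI subsetI)
    fix w assume "w \<in> (\<Union>u\<in>subtree E v. E `` {u})"
    then obtain u where u: "u \<in> subtree E v" "(u, w) \<in> E" by auto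
    then have "w \<in> subtree E v" by (auto simp: subtree_def)
    moreover have "w > v" using subtree_ge[OF u(1)] recursive_tree_edge(3)[OF u(2)] by simp
    ultimately show "w \<in> subtree E v - {v}" by simp
  next
    fix w assume "w \<in> subtree E v - {v}"
    then show "w \<in> (\<Union>u\<in>subtree E v. E `` {u})" using subtree_parent[of w v] by auto
  qed
  finally show ?thesis by (simp add: subsize_def)
qed

text \<open>
  The weight with which the next node falls into a subtree depends on the size of the subtree only.
  Subtree sizes therefore evolve autonomously, like the contents of a Polya urn.
\<close>

lemma attach_weight_subtree:
  assumes v: "v \<in> {1..n}"
  shows "(\<Sum>u\<in>subtree E v. attach_weight c1 c2 E u) = c1 * real (subsize E v) + c2"
proof -
  have "(\<Sum>u\<in>subtree E v. attach_weight c1 c2 E u) =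
      (c1 + c2) * real (subsize E v) - c2 * real (\<Sum>u\<in>subtree E v. card (E `` {u}))"
    by (simp add: attach_weight_def sum_subtractf sum_distrib_left subsize_def)
  then show ?thesis
    unfolding sum_outdegree_subtree[OF v] using subsize_pos[OF v] by (simp add: of_nat_diff algebra_simps)
qed

lemma attach_weight_total:
  assumes "n \<ge> 1"
  shows "(\<Sum>u=1..n. attach_weight c1 c2 E u) = c1 * real n + c2"
  using attach_weight_subtree[of 1 c1 c2] subtree_root subsize_root assms by simp

lemma recursive_tree_insert:
  assumes u: "u \<in> {1..n}"
  shows "recursive_tree (Suc n) (insert (u, Suc n) E)"
proof -
  have "\<exists>!v. (v, w) \<in> insert (u, Suc n) E" if w: "w \<in> {2..Suc n}" for w
  proof (cases "w = Suc n")
    case True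
    then show ?thesis using recursive_tree_edge(2)[of _ "Suc n"] by auto
  next
    case False
    then have "w \<in> {2..n}" using w by auto
    then show ?thesis using rt False unfolding recursive_tree_def by simp
  qed
  then show ?thesis using u recursive_tree_edge by (force simp: recursive_tree_def)
qed

lemma subtree_insert_old:
  assumes u: "u \<in> {1..n}" and v: "v \<in> {1..n}"
  shows "subtree (insert (u, Suc n) E) v = (if u \<in> subtree E v then insert (Suc n) (subtree E v) else subtree E v)"
proof -
  have "y = Suc n" if "(Suc n, y) \<in> E\<^sup>*" for y
    using that
  proof (cases rule: converse_rtranclE)
    case (step z)
    then show ?thesis using recursive_tree_edge(1)[of "Suc n" z] by simp
  qed simp
  then have leaf: "(Suc n, y) \<in> E\<^sup>* \<longleftrightarrow> y = Suc n" for y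
    by auto
  show ?thesis
    unfolding subtree_def Image_singleton rtrancl_insert by (auto simp: leaf)
qed

lemma subtree_insert_new:
  assumes u: "u \<in> {1..n}"
  shows "subtree (insert (u, Suc n) E) (Suc n) = {Suc n}"
proof -
  have "y = Suc n" if "(Suc n, y) \<in> (insert (u, Suc n) E)\<^sup>*" for y
    using that
  proof (cases rule: converse_rtranclE)
    case (step z)
    then show ?thesis using recursive_tree_edge(1)[of "Suc n" z] u by auto
  qed simp
  then show ?thesis by (auto simp: subtree_def)
qed

lemma subsize_insert_old:
  assumes u: "u \<in> {1..n}" and v: "v \<in> {1..n}"
  shows "subsize (insert (u, Suc n) E) v = subsize E v + of_bool (u \<in> subtree E v)"
  using subtree_insert_old[OF u v] finite_subtree[OF v] subtree_subset[OF v]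
  by (auto simp: subsize_def card_insert_if)

lemma subsize_insert_new:
  assumes u: "u \<in> {1..n}"
  shows "subsize (insert (u, Suc n) E) (Suc n) = 1"
  using subtree_insert_new[OF u] by (simp add: subsize_def)

text \<open>
  The form needed for the pair of subtrees of a node and its child: a new leaf lies in both, in the
  outer one only, or in none.
\<close>

lemma sum_over_nested_sets:
  assumes S: "S \<subseteq> {1..n}" "R \<subseteq> S"
  shows "(\<Sum>u=1..n. q u * g (u \<in> S) (u \<in> R)) =
     (\<Sum>u\<in>R. q u) * g True True + ((\<Sum>u\<in>S. q u) - (\<Sum>u\<in>R. q u)) * g True False
       + ((\<Sum>u=1..n. q u) - (\<Sum>u\<in>S. q u)) * (g False False :: real)"
proof -
  have fin: "finite S" "finite R" using S by (auto dest: finite_subset)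
  have out: "u \<notin> R" if "u \<notin> S" for u using S that by auto
  have "(\<Sum>u=1..n. q u * g (u \<in> S) (u \<in> R)) =
     (\<Sum>u\<in>{1..n} - S. q u * g (u \<in> S) (u \<in> R)) + (\<Sum>u\<in>S. q u * g (u \<in> S) (u \<in> R))"
    by (rule sum.subset_diff) (use S in auto)
  also have "(\<Sum>u\<in>S. q u * g (u \<in> S) (u \<in> R)) =
     (\<Sum>u\<in>S - R. q u * g (u \<in> S) (u \<in> R)) + (\<Sum>u\<in>R. q u * g (u \<in> S) (u \<in> R))"
    by (rule sum.subset_diff) (use S fin in auto)
  also have "(\<Sum>u\<in>R. q u * g (u \<in> S) (u \<in> R)) = (\<Sum>u\<in>R. q u) * g True True"
    unfolding sum_distrib_right using S by (intro sum.cong) auto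
  also have "(\<Sum>u\<in>S - R. q u * g (u \<in> S) (u \<in> R)) = (\<Sum>u\<in>S - R. q u) * g True False"
    unfolding sum_distrib_right using S by (intro sum.cong) auto
  also have "(\<Sum>u\<in>{1..n} - S. q u * g (u \<in> S) (u \<in> R)) = (\<Sum>u\<in>{1..n} - S. q u) * g False False"
    unfolding sum_distrib_right by (intro sum.cong) (auto simp: out)
  finally show ?thesis using S fin by (simp add: sum_diff)
qed

text \<open>
  The effect of one growth step on a sum of a function of the subtree sizes: a subtree of size \<open>s\<close>
  grows with weight \<open>c1 * s + c2\<close> and is unchanged with the remaining weight \<open>c1 * (n - s)\<close>, and the
  new leaf is a subtree of size \<open>1\<close>.
\<close>

lemma sum_nodes_insert:
  assumes n: "n \<ge> 1"
  shows "(\<Sum>u=1..n. attach_weight c1 c2 E u * (\<Sum>v=1..Suc n. f (subsize (insert (u, Suc n) E) v))) =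
    (\<Sum>v=1..n. (c1 * real (subsize E v) + c2) * f (Suc (subsize E v)) + c1 * (real n - real (subsize E v)) * f (subsize E v))
      + (c1 * real n + c2) * (f 1 :: real)"
proof -
  have "(\<Sum>u=1..n. attach_weight c1 c2 E u * (\<Sum>v=1..Suc n. f (subsize (insert (u, Suc n) E) v))) =
      (\<Sum>u=1..n. (\<Sum>v=1..n. attach_weight c1 c2 E u * f (subsize E v + of_bool (u \<in> subtree E v))) +
          attach_weight c1 c2 E u * f 1)"
    by (intro sum.cong refl) (simp add: subsize_insert_old subsize_insert_new distrib_left sum_distrib_left)
  also have "\<dots> = (\<Sum>v=1..n. \<Sum>u=1..n. attach_weight c1 c2 E u * f (subsize E v + of_bool (u \<in> subtree E v)))
     + (c1 * real n + c2) * f 1"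
    unfolding sum.distrib sum_distrib_right[symmetric] attach_weight_total[OF n]
    by (subst sum.swap) simp
  also have "(\<Sum>v=1..n. \<Sum>u=1..n. attach_weight c1 c2 E u * f (subsize E v + of_bool (u \<in> subtree E v))) =
    (\<Sum>v=1..n. (c1 * real (subsize E v) + c2) * f (Suc (subsize E v)) + c1 * (real n - real (subsize E v)) * f (subsize E v))"
  proof (intro sum.cong refl)
    fix v assume v: "v \<in> {1..n}"
    show "(\<Sum>u=1..n. attach_weight c1 c2 E u * f (subsize E v + of_bool (u \<in> subtree E v))) =
      (c1 * real (subsize E v) + c2) * f (Suc (subsize E v)) + c1 * (real n - real (subsize E v)) * f (subsize E v)"
      using sum_over_nested_sets[OF subtree_subset[OF v] order_refl, of "attach_weight c1 c2 E" "\<lambda>b _. f (subsize E v + of_bool b)"]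
      unfolding attach_weight_subtree[OF v] attach_weight_total[OF n] by (simp add: algebra_simps)
  qed
  finally show ?thesis .
qed

lemma sum_outdegree_by_size:
  "(\<Sum>v=1..n. real (card (E `` {v})) * f v) = (\<Sum>(v, w)\<in>E. f v)"
proof -
  have "E = Sigma {1..n} (\<lambda>v. E `` {v})" using recursive_tree_edge by auto
  then have "(\<Sum>(v, w)\<in>E. f v) = (\<Sum>(v, w)\<in>Sigma {1..n} (\<lambda>v. E `` {v}). f v)" by simp
  also have "\<dots> = (\<Sum>v=1..n. \<Sum>w\<in>E `` {v}. f v)"
    by (rule sum.Sigma[symmetric]) (use recursive_tree_finite in \<open>auto simp: finite_Image\<close>)
  finally show ?thesis by simp
qed

text \<open>
  The analogue for pairs of a parent and a child. The new edge \<open>(u, n + 1)\<close> has weight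
  \<open>c1 + c2 - c2 * k\<close> where \<open>k\<close> is the out-degree of \<open>u\<close>; the out-degrees turn into a sum over the
  old edges, so that the recurrence only involves sums of the same two kinds.
\<close>

lemma sum_edges_insert:
  assumes n: "n \<ge> 1"
  shows "(\<Sum>u=1..n. attach_weight c1 c2 E u * (\<Sum>(v, w)\<in>insert (u, Suc n) E.
            f (subsize (insert (u, Suc n) E) v) (subsize (insert (u, Suc n) E) w))) =
    (\<Sum>(v, w)\<in>E. (c1 * real (subsize E w) + c2) * f (Suc (subsize E v)) (Suc (subsize E w))
       + c1 * (real (subsize E v) - real (subsize E w)) * f (Suc (subsize E v)) (subsize E w)
       + c1 * (real n - real (subsize E v)) * f (subsize E v) (subsize E w))
    + (c1 + c2) * (\<Sum>v=1..n. f (Suc (subsize E v)) 1) - c2 * (\<Sum>(v, w)\<in>E. f (Suc (subsize E v)) (1::nat) :: real)"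
proof -
  let ?q = "attach_weight c1 c2 E" and ?s = "subsize E"
  have new: "(\<Sum>(v, w)\<in>insert (u, Suc n) E. f (subsize (insert (u, Suc n) E) v) (subsize (insert (u, Suc n) E) w)) =
     (\<Sum>(v, w)\<in>E. f (?s v + of_bool (u \<in> subtree E v)) (?s w + of_bool (u \<in> subtree E w))) + f (Suc (?s u)) 1"
    if u: "u \<in> {1..n}" for u
  proof -
    have "(u, Suc n) \<notin> E" using recursive_tree_edge(2)[of u "Suc n"] by auto
    moreover have "(\<Sum>(v, w)\<in>E. f (subsize (insert (u, Suc n) E) v) (subsize (insert (u, Suc n) E) w)) =
       (\<Sum>(v, w)\<in>E. f (?s v + of_bool (u \<in> subtree E v)) (?s w + of_bool (u \<in> subtree E w)))"
    proof (intro sum.cong refl, clarify)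
      fix v w assume e: "(v, w) \<in> E"
      have "v \<in> {1..n}" "w \<in> {1..n}" using recursive_tree_edge[OF e] by auto
      then show "f (subsize (insert (u, Suc n) E) v) (subsize (insert (u, Suc n) E) w) =
          f (?s v + of_bool (u \<in> subtree E v)) (?s w + of_bool (u \<in> subtree E w))"
        by (simp only: subsize_insert_old[OF u])
    qed
    ultimately show ?thesis
      using u recursive_tree_finite by (simp add: subsize_insert_old subsize_insert_new)
  qed
  have old: "(\<Sum>u=1..n. ?q u * f (?s v + of_bool (u \<in> subtree E v)) (?s w + of_bool (u \<in> subtree E w))) =
     (c1 * real (?s w) + c2) * f (Suc (?s v)) (Suc (?s w))
       + c1 * (real (?s v) - real (?s w)) * f (Suc (?s v)) (?s w)
       + c1 * (real n - real (?s v)) * f (?s v) (?s w)" if e: "(v, w) \<in> E" for v w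
  proof -
    have v: "v \<in> {1..n}" and w: "w \<in> {1..n}" using recursive_tree_edge[OF e] by auto
    have "subtree E w \<subseteq> subtree E v" using subtree_child_subset[OF e] by auto
    from sum_over_nested_sets[OF subtree_subset[OF v] this, of ?q "\<lambda>b b'. f (?s v + of_bool b) (?s w + of_bool b')"]
    show ?thesis
      unfolding attach_weight_subtree[OF v] attach_weight_subtree[OF w] attach_weight_total[OF n]
      by (simp add: algebra_simps)
  qed
  have "(\<Sum>u=1..n. ?q u * (\<Sum>(v, w)\<in>insert (u, Suc n) E.
            f (subsize (insert (u, Suc n) E) v) (subsize (insert (u, Suc n) E) w))) =
     (\<Sum>u=1..n. (\<Sum>(v, w)\<in>E. ?q u * f (?s v + of_bool (u \<in> subtree E v)) (?s w + of_bool (u \<in> subtree E w)))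
        + ?q u * f (Suc (?s u)) 1)"
  proof (rule sum.cong[OF refl])
    fix u assume u: "u \<in> {1..n}"
    show "?q u * (\<Sum>(v, w)\<in>insert (u, Suc n) E.
            f (subsize (insert (u, Suc n) E) v) (subsize (insert (u, Suc n) E) w)) =
        (\<Sum>(v, w)\<in>E. ?q u * f (?s v + of_bool (u \<in> subtree E v)) (?s w + of_bool (u \<in> subtree E w)))
        + ?q u * f (Suc (?s u)) 1"
      unfolding new[OF u] by (simp add: distrib_left sum_distrib_left case_prod_unfold)
  qed
  also have "\<dots> = (\<Sum>(v, w)\<in>E. \<Sum>u=1..n. ?q u * f (?s v + of_bool (u \<in> subtree E v)) (?s w + of_bool (u \<in> subtree E w)))
     + (\<Sum>u=1..n. ?q u * f (Suc (?s u)) 1)"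
    unfolding sum.distrib by (subst sum.swap) (simp add: case_prod_unfold)
  also have "(\<Sum>(v, w)\<in>E. \<Sum>u=1..n. ?q u * f (?s v + of_bool (u \<in> subtree E v)) (?s w + of_bool (u \<in> subtree E w))) =
     (\<Sum>(v, w)\<in>E. (c1 * real (?s w) + c2) * f (Suc (?s v)) (Suc (?s w))
       + c1 * (real (?s v) - real (?s w)) * f (Suc (?s v)) (?s w)
       + c1 * (real n - real (?s v)) * f (?s v) (?s w))"
    using old by (intro sum.cong refl) auto
  also have "(\<Sum>u=1..n. ?q u * f (Suc (?s u)) 1) =
     (c1 + c2) * (\<Sum>v=1..n. f (Suc (?s v)) 1) - c2 * (\<Sum>v=1..n. real (card (E `` {v})) * f (Suc (?s v)) 1)"
    by (simp add: attach_weight_def algebra_simps sum_subtractf sum.distrib sum_distrib_left)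
  also have "(\<Sum>v=1..n. real (card (E `` {v})) * f (Suc (?s v)) 1) = (\<Sum>(v, w)\<in>E. f (Suc (?s v)) 1)"
    by (rule sum_outdegree_by_size)
  finally show ?thesis by simp
qed

end

text \<open>
  Attaching a new largest label as a leaf preserves the defining conditions.
\<close>

lemma recursive_tree_edges:
  assumes "n \<ge> 1" "T \<in> increasing_trees n"
  shows "recursive_tree n (edges T)"
  using assms
proof (induction n arbitrary: T rule: nat_induct_at_least)
  case base
  obtain v ts where T: "T = Node v ts" by (cases T)
  have "ts = []"
  proof (cases ts)
    case (Cons u us)
    then show ?thesis using base T root_in_nodes[of u] by (auto simp: increasing_trees_def)
  qed
  then show ?case by (simp add: T recursive_tree_def)
next
  case (Suc n)
  then obtain T0 where T0: "T0 \<in> increasing_trees n" "T \<in> set (grow (Suc n) T0)"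
    using increasing_trees_Suc[of n] by auto
  then obtain u where u: "u \<in> set (nodes T0)" "edges T = insert (u, Suc n) (edges T0)"
    using edges_grow(1) by blast
  then show ?case using recursive_tree_insert[OF Suc.IH[OF T0(1)], of u] T0(1)
    by (auto simp: increasing_trees_def)
qed

section \<open>Expected numbers of subtrees of given sizes\<close>

text \<open>
  The parameters in terms of \<open>c1\<close> and \<open>a\<close>: as \<open>c2 = c1 * (a - 1)\<close>, the constant \<open>c1\<close> only scales the
  weights.
\<close>

lemma admissible:
  assumes "very_simple_increasing c1 c2"
  defines "a \<equiv> vsit_alpha c1 c2"
  shows "c1 > 0" "a > 0" "c2 = c1 * (a - 1)" "a < 1 \<or> a = 1 \<or> (\<exists>d::nat. d \<ge> 2 \<and> a = real d / (real d - 1))"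
proof -
  show c1: "c1 > 0" using assms(1) by (simp add: very_simple_increasing_def)
  then show "c2 = c1 * (a - 1)" by (simp add: a_def vsit_alpha_def)
  consider "c2 = 0" | "c2 < 0" "a > 0" | "c2 > 0" "\<exists>d::nat. d \<ge> 2 \<and> a = real d / (real d - 1)"
    using assms(1) unfolding very_simple_increasing_def a_def by blast
  then have "a > 0 \<and> (a < 1 \<or> a = 1 \<or> (\<exists>d::nat. d \<ge> 2 \<and> a = real d / (real d - 1)))"
  proof cases
    case 1
    then show ?thesis by (simp add: a_def vsit_alpha_def)
  next
    case 2
    then have "a < 1" using c1 by (simp add: a_def vsit_alpha_def divide_neg_pos)
    then show ?thesis using 2 by simp
  next
    case 3
    then have "a > 0" using c1 by (simp add: a_def vsit_alpha_def add_pos_pos)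
    then show ?thesis using 3 by simp
  qed
  then show "a > 0" "a < 1 \<or> a = 1 \<or> (\<exists>d::nat. d \<ge> 2 \<and> a = real d / (real d - 1))" by auto
qed

definition tree_mean :: "real \<Rightarrow> real \<Rightarrow> nat \<Rightarrow> ((nat \<times> nat) set \<Rightarrow> real) \<Rightarrow> real" where
  "tree_mean c1 c2 n F = (\<Sum>T\<in>increasing_trees n. weight c1 c2 T * F (edges T)) /
     (\<Sum>T\<in>increasing_trees n. weight c1 c2 T)"

lemma tree_mean_add: "tree_mean c1 c2 n (\<lambda>E. F E + G E) = tree_mean c1 c2 n F + tree_mean c1 c2 n G"
  by (simp add: tree_mean_def distrib_left sum.distrib add_divide_distrib)

lemma tree_mean_cmult: "tree_mean c1 c2 n (\<lambda>E. c * F E) = c * tree_mean c1 c2 n F"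
  by (simp add: tree_mean_def sum_distrib_left mult_ac)

lemma tree_mean_diff: "tree_mean c1 c2 n (\<lambda>E. F E - G E) = tree_mean c1 c2 n F - tree_mean c1 c2 n G"
  using tree_mean_add[of c1 c2 n F "\<lambda>E. (- 1) * G E"] by (simp only: tree_mean_cmult) simp

lemma tree_mean_sum: "tree_mean c1 c2 n (\<lambda>E. \<Sum>i\<in>I. F i E) = (\<Sum>i\<in>I. tree_mean c1 c2 n (F i))"
  unfolding tree_mean_def sum_distrib_left sum_divide_distrib[symmetric] by (subst sum.swap) simp

lemma tree_mean_const:
  assumes "very_simple_increasing c1 c2" "n \<ge> 1"
  shows "tree_mean c1 c2 n (\<lambda>E. c) = c"
  using sum_weight_pos[OF assms] by (simp add: tree_mean_def sum_distrib_right[symmetric])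

lemma tree_mean_cong:
  assumes "n \<ge> 1" "\<And>E. recursive_tree n E \<Longrightarrow> F E = G E"
  shows "tree_mean c1 c2 n F = tree_mean c1 c2 n G"
  unfolding tree_mean_def using assms recursive_tree_edges by (intro arg_cong2[of _ _ _ _ "(/)"] sum.cong) auto

lemma tree_mean_Suc:
  assumes n: "n \<ge> 1"
  shows "tree_mean c1 c2 (Suc n) F =
    tree_mean c1 c2 n (\<lambda>E. \<Sum>u=1..n. attach_weight c1 c2 E u * F (insert (u, Suc n) E)) / (c1 * real n + c2)"
proof -
  have "(\<Sum>T\<in>increasing_trees (Suc n). weight c1 c2 T) =
      (\<Sum>T\<in>increasing_trees n. weight c1 c2 T * (c1 * real n + c2))"
    using sum_increasing_trees_Suc[OF n, of c1 c2 "\<lambda>_. 1"] attach_weight_total[OF recursive_tree_edges[OF n] n]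
    by (simp cong: sum.cong)
  then show ?thesis
    unfolding tree_mean_def sum_increasing_trees_Suc[OF n] by (simp add: sum_distrib_right[symmetric])
qed

definition node_count :: "nat \<Rightarrow> (nat \<times> nat) set \<Rightarrow> nat \<Rightarrow> real" where
  "node_count n E k = (\<Sum>v=1..n. of_bool (subsize E v = k))"

definition pair_count :: "(nat \<times> nat) set \<Rightarrow> nat \<Rightarrow> nat \<Rightarrow> real" where
  "pair_count E k j = (\<Sum>(v, w)\<in>E. of_bool (subsize E v = k \<and> subsize E w = j))"

text \<open>
  The mean number of subtrees of size \<open>k\<close> in a random tree of size \<open>n\<close> (see \<open>mean_node_count\<close>). The
  whole tree counts as a subtree, which is the exceptional case \<open>k = n\<close>.
\<close>

definition expected_nodes :: "real \<Rightarrow> nat \<Rightarrow> nat \<Rightarrow> real" where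
  "expected_nodes a n k = (if k = n then 1 else if 1 \<le> k \<and> k < n
     then a * (real n + a - 1) / ((real k + a - 1) * (real k + a)) else 0)"

text \<open>
  The total weight of all increasing trees of size \<open>k\<close>, divided by \<open>c1 ^ (k - 1) * fact (k - 1)\<close>.
\<close>

definition size_weight :: "real \<Rightarrow> nat \<Rightarrow> real" where
  "size_weight a k = pochhammer a (k - 1) / fact (k - 1)"

text \<open>
  The mean number of edges that join a subtree of size \<open>k\<close> to one of size \<open>j\<close>; see
  \<open>mean_pair_count\<close>. Given its size \<open>k\<close>, a subtree is itself distributed like a random tree, in which
  the root has on average \<open>(a * size_weight a j / j) / size_weight a k\<close> children whose subtrees have
  size \<open>j\<close>.
\<close>

definition expected_pairs :: "real \<Rightarrow> nat \<Rightarrow> nat \<Rightarrow> nat \<Rightarrow> real" where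
  "expected_pairs a n k j = (if 1 \<le> j \<and> j < k
     then expected_nodes a n k * (a * size_weight a j / real j) / size_weight a k else 0)"

lemma size_weight_Suc: "k \<ge> 1 \<Longrightarrow> size_weight a (Suc k) = size_weight a k * (real k + a - 1) / real k"
  by (cases k) (simp_all add: size_weight_def pochhammer_Suc algebra_simps)

lemma size_weight_1 [simp]: "size_weight a 1 = 1" "size_weight a (Suc 0) = 1"
  by (simp_all add: size_weight_def)

lemma size_weight_pos: "a > 0 \<Longrightarrow> size_weight a k > 0"
  by (simp add: size_weight_def pochhammer_pos)

text \<open>
  The sum telescopes, as \<open>size_weight a (j + 1) - size_weight a j = (a - 1) * size_weight a j / j\<close>.
\<close>

lemma sum_size_weight:
  assumes "1 \<le> m" "m \<le> k"
  shows "(a - 1) * (\<Sum>j=m..<k. a * size_weight a j / real j) = a * (size_weight a k - size_weight a m)"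
  using assms(2)
proof (induction k rule: dec_induct)
  case (step k)
  have k: "k \<ge> 1" using assms(1) step.hyps by simp
  have "(a - 1) * (\<Sum>j=m..<Suc k. a * size_weight a j / real j) =
      a * (size_weight a k - size_weight a m) + (a - 1) * (a * size_weight a k / real k)"
    using step by (simp add: distrib_left)
  also have "\<dots> = a * (size_weight a (Suc k) - size_weight a m)"
    using k by (simp add: size_weight_Suc field_simps)
  finally show ?case .
qed simp

text \<open>
  The closed form satisfies the recurrence of \<open>sum_nodes_insert\<close>, specialised to the indicator
  function of a single size.
\<close>

lemma expected_nodes_Suc:
  assumes a: "a > 0" and n: "n \<ge> 1"
  shows "(real n + a - 1) * expected_nodes a (Suc n) (Suc m) =
     (real m + a - 1) * expected_nodes a n m + (real n - real (Suc m)) * expected_nodes a n (Suc m)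
     + (real n + a - 1) * of_bool (m = 0)"
proof -
  have pos: "real n + a - 1 > 0" using a n by simp
  consider "m = 0" "n = 1" | "m = 0" "n > 1" | "1 \<le> m" "Suc m < n" | "1 \<le> m" "Suc m = n" | "m = n" | "m > n"
    using n by linarith
  then show ?thesis
  proof cases
    case 3
    define x N where "x = real m + a" and "N = real n + a - 1"
    have x: "x \<noteq> 0" "x - 1 \<noteq> 0" "x + 1 \<noteq> 0" using a 3 by (auto simp: x_def)
    have "N * (a * (N + 1) / (x * (x + 1))) = a * N * ((x + 1) + (N - x)) / (x * (x + 1))" by simp
    also have "\<dots> = a * N / x + (N - x) * (a * N / (x * (x + 1)))"
    proof -
      have "a * N * (x + 1) / (x * (x + 1)) = a * N / x" using x by (simp del: distrib_left_numeral)
      then show ?thesis by (simp only: distrib_left[of "a * N"] add_divide_distrib) (simp add: mult_ac)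
    qed
    also have "a * N / x = (x - 1) * (a * N / ((x - 1) * x))" using x by simp
    finally have "N * (a * (N + 1) / (x * (x + 1))) = (x - 1) * (a * N / ((x - 1) * x)) + (N - x) * (a * N / (x * (x + 1)))" .
    then show ?thesis using 3 unfolding expected_nodes_def x_def N_def by (simp add: algebra_simps)
  next
    case 4
    then have "real m + a - 1 > 0" "real m + a > 0" "real m + 1 + a > 0" "real n = real m + 1" using a by auto
    then show ?thesis using 4 unfolding expected_nodes_def
      by (simp add: divide_simps)
  next
    case 2
    have "real n + a - 1 \<noteq> 0" "a * (a + 1) \<noteq> 0" using a pos by auto
    then have "(real n + a - 1) * (a * (real n + a) / (a * (a + 1))) =
        (real n - 1) * (a * (real n + a - 1) / (a * (a + 1))) + (real n + a - 1)"
      by (simp add: field_simps)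
    then show ?thesis using 2 unfolding expected_nodes_def by (simp add: algebra_simps)
  qed (use a n in \<open>auto simp: expected_nodes_def divide_simps\<close>)
qed

text \<open>
  Likewise for the recurrence of \<open>sum_edges_insert\<close>. Since \<open>expected_pairs\<close> is a product whose
  second factor does not depend on \<open>n\<close>, the recurrence of the first factor carries most of it over,
  and only the evolution inside the subtree of size \<open>m\<close> has to be checked.
\<close>

lemma expected_pairs_Suc:
  assumes a: "a > 0" and n: "n \<ge> 1"
  shows "(real n + a - 1) * expected_pairs a (Suc n) (Suc m) (Suc l) =
     (real l + a - 1) * expected_pairs a n m l + (real m - real (Suc l)) * expected_pairs a n m (Suc l)
     + (real n - real (Suc m)) * expected_pairs a n (Suc m) (Suc l)
     + of_bool (l = 0) * (a * expected_nodes a n m - (a - 1) * (\<Sum>j=1..<m. expected_pairs a n m j))"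
proof (cases "l < m")
  case False
  show ?thesis
  proof (cases "l = 0")
    case True
    then have "m = 0" using False by simp
    then show ?thesis using True n by (simp add: expected_pairs_def expected_nodes_def)
  qed (use False in \<open>simp add: expected_pairs_def\<close>)
next
  case True
  let ?u = "\<lambda>j. a * size_weight a j / real j" and ?w = "size_weight a"
  have w: "?w m > 0" "?w (Suc m) > 0" using size_weight_pos[OF a] by auto
  have m: "m \<ge> 1" using True by simp
  have ma: "real m + a - 1 > 0" using a m by simp
  \<comment> \<open>The ratio of consecutive size weights cancels the growth rate of a subtree of size m.\<close>
  have eu: "?u (Suc l) / ?w (Suc m) * (real m + a - 1) = real m * (?u (Suc l) / ?w m)"
    using w m ma by (simp add: size_weight_Suc[OF m])
  \<comment> \<open>The mean weight with which the next node becomes a child of the root of a subtree of size m.\<close>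
  have birth: "a * expected_nodes a n m - (a - 1) * (\<Sum>j=1..<m. expected_pairs a n m j) = expected_nodes a n m * (?u 1 / ?w m)"
  proof -
    have "(\<Sum>j=1..<m. expected_pairs a n m j) = expected_nodes a n m / ?w m * (\<Sum>j=1..<m. ?u j)"
      unfolding sum_distrib_left by (intro sum.cong) (auto simp: expected_pairs_def)
    then have "(a - 1) * (\<Sum>j=1..<m. expected_pairs a n m j) = expected_nodes a n m / ?w m * (a * (?w m - 1))"
      using sum_size_weight[of 1 m a] m by (simp add: mult_ac)
    then show ?thesis using w by (simp add: field_simps)
  qed
  have "(real n + a - 1) * expected_pairs a (Suc n) (Suc m) (Suc l) =
     ((real n + a - 1) * expected_nodes a (Suc n) (Suc m)) * (?u (Suc l) / ?w (Suc m))"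
    using True by (simp add: expected_pairs_def)
  also have "\<dots> = expected_nodes a n m * (?u (Suc l) / ?w (Suc m) * (real m + a - 1)) +
     (real n - real (Suc m)) * expected_pairs a n (Suc m) (Suc l)"
  proof -
    define U where "U = ?u (Suc l) / ?w (Suc m)"
    have "expected_pairs a n (Suc m) (Suc l) = expected_nodes a n (Suc m) * U"
      using True by (simp add: expected_pairs_def U_def)
    moreover have "m \<noteq> 0" using m by simp
    ultimately show ?thesis
      unfolding expected_nodes_Suc[OF a n] U_def[symmetric] by (simp add: algebra_simps)
  qed
  also have "expected_nodes a n m * (?u (Suc l) / ?w (Suc m) * (real m + a - 1)) =
     real (Suc l) * ?u (Suc l) * expected_nodes a n m / ?w m + (real m - real (Suc l)) * expected_pairs a n m (Suc l)"
  proof -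
    define V where "V = expected_nodes a n m * ?u (Suc l) / ?w m"
    have "(real m - real (Suc l)) * expected_pairs a n m (Suc l) = (real m - real (Suc l)) * V"
      using True by (cases "m = Suc l") (auto simp: expected_pairs_def V_def)
    moreover have "expected_nodes a n m * (real m * (?u (Suc l) / ?w m)) = real m * V"
      "real (Suc l) * ?u (Suc l) * expected_nodes a n m / ?w m = real (Suc l) * V"
      by (simp_all add: V_def)
    ultimately show ?thesis unfolding eu by (simp only: left_diff_distrib)
  qed
  also have "real (Suc l) * ?u (Suc l) * expected_nodes a n m / ?w m = (real l + a - 1) * expected_pairs a n m l
     + of_bool (l = 0) * (expected_nodes a n m * (?u 1 / ?w m))"
  proof (cases "l = 0")
    case False
    then have "real (Suc l) * ?u (Suc l) = (real l + a - 1) * ?u l"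
      by (simp add: size_weight_Suc)
    then show ?thesis using True False by (simp add: expected_pairs_def)
  qed (use True in \<open>simp add: expected_pairs_def\<close>)
  finally show ?thesis unfolding birth by simp
qed

lemma tree_mean_1:
  assumes "very_simple_increasing c1 c2"
  shows "tree_mean c1 c2 1 F = F {}"
proof -
  have "tree_mean c1 c2 1 F = tree_mean c1 c2 1 (\<lambda>_. F {})"
  proof (rule tree_mean_cong)
    fix E assume "recursive_tree 1 E"
    then have "E = {}" by (auto simp: recursive_tree_def)
    then show "F E = F {}" by simp
  qed simp
  then show ?thesis using tree_mean_const[OF assms, of 1] by simp
qed

lemma mean_node_count:
  assumes adm: "very_simple_increasing c1 c2" and "a = vsit_alpha c1 c2" and "n \<ge> 1"
  shows "tree_mean c1 c2 n (\<lambda>E. node_count n E k) = expected_nodes a n k"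
  using assms(3)
proof (induction n arbitrary: k rule: nat_induct_at_least)
  case base
  show ?case
    unfolding tree_mean_1[OF adm] by (simp add: node_count_def expected_nodes_def subsize_def subtree_def)
next
  case (Suc n)
  note a = admissible[OF adm, folded assms(2)]
  show ?case
  proof (cases k)
    case 0
    have "tree_mean c1 c2 (Suc n) (\<lambda>E. node_count (Suc n) E 0) = tree_mean c1 c2 (Suc n) (\<lambda>_. 0)"
    proof (rule tree_mean_cong)
      fix E assume "recursive_tree (Suc n) E"
      then have "subsize E v \<noteq> 0" if "v \<in> {1..Suc n}" for v using subsize_pos[of "Suc n" E v] that by auto
      then show "node_count (Suc n) E 0 = 0" unfolding node_count_def by (intro sum.neutral) simp
    qed simp
    then show ?thesis using 0 tree_mean_const[OF adm, of "Suc n"] by (simp add: expected_nodes_def)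
  next
    case k: (Suc m)
    have "(\<Sum>u=1..n. attach_weight c1 c2 E u * node_count (Suc n) (insert (u, Suc n) E) k) =
       c1 * ((real m + a - 1) * node_count n E m + (real n - real (Suc m)) * node_count n E (Suc m)
          + (real n + a - 1) * of_bool (m = 0))" if E: "recursive_tree n E" for E
    proof -
      have old: "(c1 * real s + c2) * of_bool (Suc s = k) + c1 * (real n - real s) * of_bool (s = k) =
         c1 * (real m + a - 1) * of_bool (s = m) + c1 * (real n - real (Suc m)) * of_bool (s = Suc m)" for s
        by (auto simp: k a(3) algebra_simps)
      show ?thesis
        unfolding node_count_def sum_nodes_insert[OF E Suc.hyps, where f = "\<lambda>s. of_bool (s = k)"] old
          sum.distrib sum_distrib_left[symmetric]
        by (simp add: k a(3) algebra_simps)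
    qed
    then have "tree_mean c1 c2 (Suc n) (\<lambda>E. node_count (Suc n) E k) =
      tree_mean c1 c2 n (\<lambda>E. c1 * ((real m + a - 1) * node_count n E m + (real n - real (Suc m)) * node_count n E (Suc m)
          + (real n + a - 1) * of_bool (m = 0))) / (c1 * real n + c2)"
      unfolding tree_mean_Suc[OF Suc.hyps] using Suc.hyps
      by (intro arg_cong2[of _ _ _ _ "(/)"] tree_mean_cong refl) assumption+
    also have "\<dots> = c1 * ((real n + a - 1) * expected_nodes a (Suc n) (Suc m)) / (c1 * real n + c2)"
      unfolding tree_mean_add tree_mean_cmult Suc.IH tree_mean_const[OF adm Suc.hyps]
        expected_nodes_Suc[OF a(2) Suc.hyps] ..
    also have "c1 * real n + c2 = c1 * (real n + a - 1)" by (simp add: a(3) algebra_simps)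
    also have "c1 * ((real n + a - 1) * expected_nodes a (Suc n) (Suc m)) / \<dots> = expected_nodes a (Suc n) (Suc m)"
      using a(1,2) Suc.hyps by simp
    finally show ?thesis using k by simp
  qed
qed

lemma pair_count_zero:
  assumes "recursive_tree n E" "\<not> (1 \<le> j \<and> j < k)"
  shows "pair_count E k j = 0"
  unfolding pair_count_def
proof (intro sum.neutral ballI, clarify)
  fix v w assume e: "(v, w) \<in> E"
  have "w \<in> {1..n}" using recursive_tree_edge[OF assms(1) e] by auto
  then show "of_bool (subsize E v = k \<and> subsize E w = j) = (0::real)"
    using subsize_child[OF assms(1) e] subsize_pos[OF assms(1), of w] assms(2) by auto
qed

lemma mean_pair_count:
  assumes adm: "very_simple_increasing c1 c2" and "a = vsit_alpha c1 c2" and "n \<ge> 1"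
  shows "tree_mean c1 c2 n (\<lambda>E. pair_count E k j) = expected_pairs a n k j"
  using assms(3)
proof (induction n arbitrary: k j rule: nat_induct_at_least)
  case base
  show ?case
    unfolding tree_mean_1[OF adm] by (simp add: pair_count_def expected_pairs_def expected_nodes_def)
next
  case (Suc n)
  note a = admissible[OF adm, folded assms(2)]
  show ?case
  proof (cases "1 \<le> j \<and> j < k")
    case False
    have "tree_mean c1 c2 (Suc n) (\<lambda>E. pair_count E k j) = tree_mean c1 c2 (Suc n) (\<lambda>_. 0)"
      by (rule tree_mean_cong) (use False pair_count_zero in auto)
    then show ?thesis using False tree_mean_const[OF adm, of "Suc n"] by (auto simp: expected_pairs_def)
  next
    case True
    then obtain m l where k: "k = Suc m" and j: "j = Suc l" by (metis less_nat_zero_code not0_implies_Suc not_one_le_zero)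
    have "(\<Sum>u=1..n. attach_weight c1 c2 E u * pair_count (insert (u, Suc n) E) k j) =
       c1 * ((real l + a - 1) * pair_count E m l + (real m - real (Suc l)) * pair_count E m (Suc l)
         + (real n - real (Suc m)) * pair_count E (Suc m) (Suc l)
         + of_bool (l = 0) * (a * node_count n E m - (a - 1) * (\<Sum>i=1..<m. pair_count E m i)))" (is "?L = ?R")
      if E: "recursive_tree n E" for E
    proof -
      let ?s = "subsize E"
      have old: "(c1 * real t + c2) * of_bool (Suc s = k \<and> Suc t = j) + c1 * (real s - real t) * of_bool (Suc s = k \<and> t = j)
          + c1 * (real n - real s) * of_bool (s = k \<and> t = j) =
         c1 * (real l + a - 1) * of_bool (s = m \<and> t = l) + c1 * (real m - real (Suc l)) * of_bool (s = m \<and> t = Suc l)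
          + c1 * (real n - real (Suc m)) * of_bool (s = Suc m \<and> t = Suc l)" for s t
        by (auto simp: k j a(3) algebra_simps)
      have out: "(\<Sum>(v, w)\<in>E. of_bool (?s v = m)) = (\<Sum>i=1..<m. pair_count E m i)"
      proof -
        have "(\<Sum>i=1..<m. pair_count E m i) = (\<Sum>(v, w)\<in>E. \<Sum>i=1..<m. of_bool (?s v = m \<and> ?s w = i))"
          unfolding pair_count_def by (subst sum.swap) (simp add: case_prod_unfold)
        also have "\<dots> = (\<Sum>(v, w)\<in>E. of_bool (?s v = m))"
        proof (intro sum.cong refl, clarify)
          fix v w assume e: "(v, w) \<in> E"
          have "w \<in> {1..n}" using recursive_tree_edge[OF E e] by auto
          then have "?s w \<in> {1..<?s v}" using subsize_child[OF E e] subsize_pos[OF E, of w] by auto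
          then show "(\<Sum>i=1..<m. of_bool (?s v = m \<and> ?s w = i)) = (of_bool (?s v = m) :: real)"
            by (auto simp: of_bool_def)
        qed
        finally show ?thesis by simp
      qed
      have "?L = (\<Sum>(v, w)\<in>E. c1 * (real l + a - 1) * of_bool (?s v = m \<and> ?s w = l)
          + c1 * (real m - real (Suc l)) * of_bool (?s v = m \<and> ?s w = Suc l)
          + c1 * (real n - real (Suc m)) * of_bool (?s v = Suc m \<and> ?s w = Suc l))
        + (c1 + c2) * (\<Sum>v=1..n. of_bool (Suc (?s v) = k \<and> 1 = j)) - c2 * (\<Sum>(v, w)\<in>E. of_bool (Suc (?s v) = k \<and> 1 = j))"
        unfolding pair_count_def sum_edges_insert[OF E Suc.hyps, where f = "\<lambda>s t. of_bool (s = k \<and> t = j)"] old ..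
      also have "(\<Sum>v=1..n. of_bool (Suc (?s v) = k \<and> 1 = j)) = of_bool (l = 0) * node_count n E m"
        by (simp add: k j node_count_def)
      also have "(\<Sum>(v, w)\<in>E. of_bool (Suc (?s v) = k \<and> 1 = j)) = of_bool (l = 0) * (\<Sum>i=1..<m. pair_count E m i)"
        using out by (simp add: k j del: One_nat_def)
      finally show ?thesis
        unfolding a(3) pair_count_def case_prod_unfold sum.distrib sum_distrib_left[symmetric] by (simp add: algebra_simps)
    qed
    then have "tree_mean c1 c2 (Suc n) (\<lambda>E. pair_count E k j) =
      tree_mean c1 c2 n (\<lambda>E. c1 * ((real l + a - 1) * pair_count E m l + (real m - real (Suc l)) * pair_count E m (Suc l)
         + (real n - real (Suc m)) * pair_count E (Suc m) (Suc l)
         + of_bool (l = 0) * (a * node_count n E m - (a - 1) * (\<Sum>i=1..<m. pair_count E m i)))) / (c1 * real n + c2)"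
      unfolding tree_mean_Suc[OF Suc.hyps] using Suc.hyps
      by (intro arg_cong2[of _ _ _ _ "(/)"] tree_mean_cong refl) assumption+
    also have "\<dots> = c1 * ((real n + a - 1) * expected_pairs a (Suc n) (Suc m) (Suc l)) / (c1 * real n + c2)"
      unfolding tree_mean_add tree_mean_diff tree_mean_cmult tree_mean_sum Suc.IH mean_node_count[OF adm assms(2) Suc.hyps]
        expected_pairs_Suc[OF a(2) Suc.hyps] ..
    also have "c1 * real n + c2 = c1 * (real n + a - 1)" by (simp add: a(3) algebra_simps)
    also have "c1 * ((real n + a - 1) * expected_pairs a (Suc n) (Suc m) (Suc l)) / \<dots> = expected_pairs a (Suc n) (Suc m) (Suc l)"
      using a(1,2) Suc.hyps by simp
    finally show ?thesis using k j by simp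
  qed
qed

section \<open>Distances and the centroid\<close>

text \<open>
  The function \<open>tree_dist\<close> in terms of the edge set alone.
\<close>

definition graph_dist :: "(nat \<times> nat) set \<Rightarrow> nat \<Rightarrow> nat \<Rightarrow> nat" where
  "graph_dist E u v = (LEAST k. (u, v) \<in> (E \<union> E\<inverse>) ^^ k)"

lemma graph_dist_sym: "graph_dist E u v = graph_dist E v u"
proof -
  have "(v, u) \<in> (E \<union> E\<inverse>) ^^ k" if "(u, v) \<in> (E \<union> E\<inverse>) ^^ k" for k u v
    using that
  proof (induction k arbitrary: v)
    case (Suc k)
    then obtain y where "(u, y) \<in> (E \<union> E\<inverse>) ^^ k" "(v, y) \<in> E \<union> E\<inverse>" by auto
    then show ?case using Suc.IH relpow_Suc_I2 by metis
  qed simp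
  then have "(u, v) \<in> (E \<union> E\<inverse>) ^^ k \<longleftrightarrow> (v, u) \<in> (E \<union> E\<inverse>) ^^ k" for k by blast
  then show ?thesis by (simp add: graph_dist_def)
qed

text \<open>
  If \<open>C\<close> can only be entered at \<open>q\<close>, then the part of a path into \<open>C\<close> after its first entry is a
  shorter path that starts at \<open>q\<close>.
\<close>

lemma relpow_through_cut:
  assumes cut: "\<And>x y. (x, y) \<in> R \<Longrightarrow> x \<notin> C \<Longrightarrow> y \<in> C \<Longrightarrow> y = q"
  shows "(z, u) \<in> R ^^ k \<Longrightarrow> z \<notin> C \<Longrightarrow> u \<in> C \<Longrightarrow> \<exists>k'<k. (q, u) \<in> R ^^ k'"
proof (induction k arbitrary: z)
  case (Suc k)
  then obtain y where y: "(z, y) \<in> R" "(y, u) \<in> R ^^ k" by (meson relpow_Suc_E2)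
  show ?case
  proof (cases "y \<in> C")
    case True
    then have "y = q" using cut y(1) Suc.prems by blast
    then show ?thesis using y(2) by auto
  next
    case False
    then show ?thesis using Suc.IH[OF y(2)] Suc.prems less_SucI by blast
  qed
qed auto

lemma graph_dist_through_cut:
  assumes "\<And>x y. (x, y) \<in> E \<union> E\<inverse> \<Longrightarrow> x \<notin> C \<Longrightarrow> y \<in> C \<Longrightarrow> y = q"
    and pq: "(p, q) \<in> E \<union> E\<inverse>" "p \<notin> C" "u \<in> C" and conn: "(q, u) \<in> (E \<union> E\<inverse>)\<^sup>*"
  shows "graph_dist E p u = Suc (graph_dist E q u)"
proof -
  let ?R = "E \<union> E\<inverse>"
  have q: "(q, u) \<in> ?R ^^ graph_dist E q u"
    using conn unfolding graph_dist_def by (meson LeastI_ex rtrancl_imp_relpow)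
  then have "(p, u) \<in> ?R ^^ Suc (graph_dist E q u)" using pq(1) relpow_Suc_I2 by metis
  then have le: "graph_dist E p u \<le> Suc (graph_dist E q u)" and p: "(p, u) \<in> ?R ^^ graph_dist E p u"
    unfolding graph_dist_def by (rule Least_le, rule LeastI)
  have "\<exists>k<graph_dist E p u. (q, u) \<in> ?R ^^ k"
    by (rule relpow_through_cut[where C = C]) (use assms(1) p pq in blast)+
  then have "graph_dist E q u < graph_dist E p u"
    unfolding graph_dist_def[of E q u] by (meson Least_le le_less_trans)
  then show ?thesis using le by simp
qed

text \<open>
  For natural numbers \<open>n div 2 < s\<close> is equivalent to \<open>n < 2 * s\<close>.
\<close>

definition heavy :: "nat \<Rightarrow> (nat \<times> nat) set \<Rightarrow> nat set" where
  "heavy n E = {v\<in>{1..n}. n div 2 < subsize E v}"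

definition lowest_heavy :: "nat \<Rightarrow> (nat \<times> nat) set \<Rightarrow> nat" where
  "lowest_heavy n E = arg_min_on (subsize E) (heavy n E)"

context
  fixes n E
  assumes rt: "recursive_tree n E"
begin

lemma recursive_tree_connected:
  assumes "u \<in> {1..n}" "v \<in> {1..n}"
  shows "(u, v) \<in> (E \<union> E\<inverse>)\<^sup>*"
proof -
  have "(1, w) \<in> E\<^sup>*" if "w \<in> {1..n}" for w
    using that subtree_root[OF rt] by (force simp: subtree_def)
  then have "(1, w) \<in> (E \<union> E\<inverse>)\<^sup>*" "(w, 1) \<in> (E \<union> E\<inverse>)\<^sup>*" if "w \<in> {1..n}" for w
    using that rtrancl_mono[of E "E \<union> E\<inverse>"] rtrancl_mono[of "E\<inverse>" "E \<union> E\<inverse>"] rtrancl_converse[of E] by blast+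
  then show ?thesis using assms by (meson rtrancl_trans)
qed

text \<open>
  The edge from \<open>v\<close> to \<open>w\<close> is the only one between the subtree of \<open>w\<close> and its complement.
\<close>

lemma graph_dist_child:
  assumes e: "(v, w) \<in> E" and u: "u \<in> {1..n}"
  shows "u \<in> subtree E w \<Longrightarrow> graph_dist E v u = Suc (graph_dist E w u)"
    and "u \<notin> subtree E w \<Longrightarrow> graph_dist E w u = Suc (graph_dist E v u)"
proof -
  have vw: "v \<in> {1..n}" "w \<in> {1..n}" using recursive_tree_edge[OF rt e] by auto
  have v: "v \<notin> subtree E w" using subtree_ge[OF rt] recursive_tree_edge(3)[OF rt e] by force
  have cut: "x = v \<and> y = w" if "(x, y) \<in> E \<union> E\<inverse>" "x \<notin> subtree E w" "y \<in> subtree E w" for x y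
    using that(1)
  proof
    assume xy: "(x, y) \<in> E"
    have "y = w"
      using subtree_parent[OF rt that(3)] recursive_tree_parent_unique[OF rt xy] that(2) by blast
    then show ?thesis using recursive_tree_parent_unique[OF rt xy] e by blast
  next
    assume "(x, y) \<in> E\<inverse>"
    then have "x \<in> subtree E w" using that(3) by (auto simp: subtree_def)
    then show ?thesis using that(2) by blast
  qed
  show "graph_dist E v u = Suc (graph_dist E w u)" if "u \<in> subtree E w"
    by (rule graph_dist_through_cut[where C = "subtree E w"])
       (use cut e v that recursive_tree_connected[OF vw(2) u] in blast)+
  show "graph_dist E w u = Suc (graph_dist E v u)" if "u \<notin> subtree E w"
  proof (rule graph_dist_through_cut[where C = "- subtree E w"])
    show "y = v" if "(x, y) \<in> E \<union> E\<inverse>" "x \<notin> - subtree E w" "y \<in> - subtree E w" for x y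
      using cut[of y x] that by blast
  qed (use e that recursive_tree_connected[OF vw(1) u] in auto)
qed

text \<open>
  A step from \<open>v\<close> to its child \<open>w\<close> shortens the distance to the nodes in the subtree of \<open>w\<close> by one
  and lengthens it by one to all others. So it pays exactly if this subtree has more than half of
  the nodes.
\<close>

lemma sum_dist_child:
  assumes e: "(v, w) \<in> E"
  shows "(\<Sum>u=1..n. graph_dist E w u) + subsize E w = (\<Sum>u=1..n. graph_dist E v u) + (n - subsize E w)"
proof -
  let ?S = "subtree E w"
  have w: "w \<in> {1..n}" using recursive_tree_edge[OF rt e] by auto
  note S = subtree_subset[OF rt w]
  have split: "(\<Sum>u=1..n. g u) = (\<Sum>u\<in>{1..n} - ?S. g u) + (\<Sum>u\<in>?S. g u)" for g :: "nat \<Rightarrow> nat"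
    by (rule sum.subset_diff[OF S]) simp
  have "(\<Sum>u\<in>?S. graph_dist E v u) = (\<Sum>u\<in>?S. Suc (graph_dist E w u))"
    using graph_dist_child(1)[OF e] S by (intro sum.cong) auto
  moreover have "(\<Sum>u\<in>{1..n} - ?S. graph_dist E w u) = (\<Sum>u\<in>{1..n} - ?S. Suc (graph_dist E v u))"
    using graph_dist_child(2)[OF e] by (intro sum.cong) auto
  moreover have "card ({1..n} - ?S) = n - subsize E w"
    using S by (simp add: subsize_def card_Diff_subset finite_subset)
  ultimately show ?thesis
    unfolding split by (simp only: sum_Suc) (simp add: subsize_def)
qed

lemma depth_child:
  assumes e: "(v, w) \<in> E"
  shows "graph_dist E 1 w = Suc (graph_dist E 1 v)"
proof -
  have "1 \<notin> subtree E w" using subtree_ge[OF rt] recursive_tree_edge(2)[OF rt e] by force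
  then show ?thesis
    using graph_dist_child(2)[OF e, of 1] recursive_tree_edge(1)[OF rt e] graph_dist_sym by auto
qed

lemma subtree_mono: "w \<in> subtree E v \<Longrightarrow> subtree E w \<subseteq> subtree E v"
  by (auto simp: subtree_def)

lemma subsize_mono: "v \<in> {1..n} \<Longrightarrow> w \<in> subtree E v \<Longrightarrow> subsize E w \<le> subsize E v"
  unfolding subsize_def by (intro card_mono finite_subtree[OF rt] subtree_mono)

lemma subtree_comparable:
  assumes "x \<in> subtree E u" "x \<in> subtree E v"
  shows "u \<in> subtree E v \<or> v \<in> subtree E u"
  using assms(1)[unfolded subtree_def Image_singleton_iff] assms(2)
proof (induction rule: rtrancl_induct)
  case (step y x)
  show ?case
  proof (cases "x = v")
    case True
    then show ?thesis using rtrancl_into_rtrancl[OF step.hyps] by (simp add: subtree_def)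
  next
    case False
    then have "y \<in> subtree E v"
      using subtree_parent[OF rt step.prems] recursive_tree_parent_unique[OF rt step.hyps(2)] by blast
    then show ?thesis by (rule step.IH)
  qed
qed simp

context
  assumes n: "n \<ge> 1"
begin

lemma lowest_heavy: "lowest_heavy n E \<in> heavy n E" "v \<in> heavy n E \<Longrightarrow> subsize E (lowest_heavy n E) \<le> subsize E v"
proof -
  have "1 \<in> heavy n E" using n subsize_root[OF rt n] by (simp add: heavy_def)
  moreover have "finite (heavy n E)" by (simp add: heavy_def)
  ultimately show "lowest_heavy n E \<in> heavy n E" "v \<in> heavy n E \<Longrightarrow> subsize E (lowest_heavy n E) \<le> subsize E v"
    unfolding lowest_heavy_def
    using arg_min_if_finite(1)[of "heavy n E" "subsize E"] arg_min_least[of "heavy n E" v "subsize E"] by auto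
qed

text \<open>
  Two subtrees with more than half of the nodes intersect, hence are nested.
\<close>

lemma lowest_heavy_below:
  assumes v: "v \<in> heavy n E"
  shows "lowest_heavy n E \<in> subtree E v"
proof -
  let ?c = "lowest_heavy n E"
  have V: "v \<in> {1..n}" "?c \<in> {1..n}" and s: "n div 2 < subsize E v" "n div 2 < subsize E ?c"
    using v lowest_heavy(1) by (auto simp: heavy_def)
  \<comment> \<open>Their sizes add up to more than n.\<close>
  have "subtree E v \<inter> subtree E ?c \<noteq> {}"
  proof
    assume "subtree E v \<inter> subtree E ?c = {}"
    then have "card (subtree E v \<union> subtree E ?c) = subsize E v + subsize E ?c"
      using finite_subtree[OF rt] V by (simp add: card_Un_disjoint subsize_def)
    moreover have "card (subtree E v \<union> subtree E ?c) \<le> card {1..n}"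
      using subtree_subset[OF rt] V by (intro card_mono) auto
    ultimately show False using s by simp
  qed
  then have "v \<in> subtree E ?c \<or> ?c \<in> subtree E v" using subtree_comparable by blast
  moreover have "v = ?c" if "v \<in> subtree E ?c"
  proof (rule ccontr)
    assume "v \<noteq> ?c"
    then have "subtree E v \<subset> subtree E ?c"
      using subtree_mono[OF that] subtree_ge[OF rt that] subtree_ge[OF rt, of ?c v] self_in_subtree[of ?c E] by force
    then have "subsize E v < subsize E ?c"
      unfolding subsize_def using finite_subtree[OF rt V(2)] by (rule psubset_card_mono[rotated])
    then show False using lowest_heavy(2)[OF v] by simp
  qed
  ultimately show ?thesis by auto
qed

lemma heavy_if_above:
  assumes "v \<in> {1..n}" "lowest_heavy n E \<in> subtree E v"
  shows "v \<in> heavy n E"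
proof -
  have "n div 2 < subsize E (lowest_heavy n E)" using lowest_heavy(1) by (simp add: heavy_def)
  then show ?thesis using subsize_mono[OF assms] assms(1) by (simp add: heavy_def)
qed

text \<open>
  From a heavy node the path down to the lowest one visits heavy nodes only, and the sum of distances
  strictly decreases along it. From any other node the sum of distances does not increase on the way
  up while the depth decreases. So the lowest heavy node minimises the sum of distances, and all
  other minimisers are further from the root.
\<close>

lemma sum_dist_minimal:
  assumes "u \<in> {1..n}" "u \<noteq> lowest_heavy n E"
  shows "(\<Sum>x=1..n. graph_dist E (lowest_heavy n E) x) < (\<Sum>x=1..n. graph_dist E u x) \<or>
     (\<Sum>x=1..n. graph_dist E (lowest_heavy n E) x) \<le> (\<Sum>x=1..n. graph_dist E u x) \<and>
     graph_dist E 1 (lowest_heavy n E) < graph_dist E 1 u"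
  using assms
proof (induction u rule: less_induct)
  case (less u)
  let ?D = "\<lambda>v. \<Sum>x=1..n. graph_dist E v x" and ?c = "lowest_heavy n E"
  show ?case
  proof (cases "u \<in> heavy n E")
    case True
    have "u \<in> {1..n} \<Longrightarrow> ?D ?c \<le> ?D u \<and> (u \<noteq> ?c \<longrightarrow> ?D ?c < ?D u)" if "(u, ?c) \<in> E\<^sup>*" for u
      using that
    proof (induction rule: converse_rtrancl_induct)
      case (step u w)
      have w: "w \<in> {1..n}" using recursive_tree_edge[OF rt step.hyps(1)] by auto
      then have "w \<in> heavy n E" using step.hyps(2) heavy_if_above by (simp add: subtree_def)
      then have "n < subsize E w * 2" by (simp add: heavy_def div_less_iff_less_mult)
      then have "?D w < ?D u" using sum_dist_child[OF step.hyps(1)] by linarith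
      then show ?case using step.IH[OF w] by simp
    qed simp
    then show ?thesis using lowest_heavy_below[OF True] less.prems by (simp add: subtree_def)
  next
    case False
    have "u \<noteq> 1" using False n subsize_root[OF rt n] by (auto simp: heavy_def)
    then obtain p where p: "(p, u) \<in> E" using recursive_tree_parent_exists[OF rt, of u] less.prems(1) by force
    have pV: "p < u" "p \<in> {1..n}" using recursive_tree_edge[OF rt p] by auto
    have "subsize E u \<le> n div 2" using False less.prems(1) by (auto simp: heavy_def)
    then have "?D p \<le> ?D u" using sum_dist_child[OF p] by linarith
    moreover have "graph_dist E 1 u = Suc (graph_dist E 1 p)" by (rule depth_child[OF p])
    ultimately show ?thesis using less.IH[OF pV] by (cases "p = ?c") auto
  qed
qed

text \<open>
  The heavy nodes form a path from the root to the lowest of them, since each heavy node lies above the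
  lowest one.
\<close>

lemma bij_betw_heavy_edges:
  "bij_betw fst {(v, w)\<in>E. w \<in> heavy n E} (heavy n E - {lowest_heavy n E})"
  unfolding bij_betw_def
proof
  let ?c = "lowest_heavy n E"
  show "inj_on fst {(v, w)\<in>E. w \<in> heavy n E}"
  proof (rule inj_onI, clarsimp)
    fix v w w' assume e: "(v, w) \<in> E" "(v, w') \<in> E" and h: "w \<in> heavy n E" "w' \<in> heavy n E"
    have *: "x = y" if "(v, x) \<in> E" "(v, y) \<in> E" "x \<in> subtree E y" for x y
    proof (rule ccontr)
      assume "x \<noteq> y"
      then have "v \<in> subtree E y"
        using subtree_parent[OF rt that(3)] recursive_tree_parent_unique[OF rt that(1)] by blast
      from subtree_ge[OF rt this] show False using recursive_tree_edge(3)[OF rt that(2)] by simp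
    qed
    show "w = w'"
      using subtree_comparable[OF lowest_heavy_below[OF h(1)] lowest_heavy_below[OF h(2)]]
        *[OF e] *[OF e(2,1)] by blast
  qed
  show "fst ` {(v, w)\<in>E. w \<in> heavy n E} = heavy n E - {?c}"
  proof (intro equalityI subsetI)
    fix v assume "v \<in> fst ` {(v, w)\<in>E. w \<in> heavy n E}"
    then obtain w where e: "(v, w) \<in> E" and w: "w \<in> heavy n E" by auto
    have "v \<in> heavy n E" using subsize_child[OF rt e] recursive_tree_edge(1)[OF rt e] w by (simp add: heavy_def)
    moreover have "v \<noteq> ?c"
      using subtree_ge[OF rt lowest_heavy_below[OF w]] recursive_tree_edge(3)[OF rt e] by simp
    ultimately show "v \<in> heavy n E - {?c}" by simp
  next
    fix v assume v: "v \<in> heavy n E - {?c}"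
    then obtain w where w: "(v, w) \<in> E" "?c \<in> subtree E w"
      using lowest_heavy_below[of v] unfolding subtree_def by (auto elim: converse_rtranclE)
    moreover have "w \<in> heavy n E" using heavy_if_above w(2) recursive_tree_edge(2)[OF rt w(1)] by simp
    ultimately show "v \<in> fst ` {(v, w)\<in>E. w \<in> heavy n E}" by force
  qed
qed

text \<open>
  On a path, the sum over the nodes exceeds the sum over the upper ends of the edges by the value at
  the lowest node. Both sums are sorted by subtree sizes to make them linear in the two counts.
\<close>

lemma lowest_heavy_telescope:
  fixes f :: "nat \<Rightarrow> real"
  shows "f (subsize E (lowest_heavy n E)) =
    (\<Sum>k\<in>{n div 2<..n}. f k * (node_count n E k - (\<Sum>j\<in>{n div 2<..<k}. pair_count E k j)))"
proof -
  let ?s = "subsize E" and ?h = "n div 2"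
  have fin: "finite (heavy n E)" by (simp add: heavy_def)
  have nodes: "(\<Sum>v\<in>heavy n E. f (?s v)) = (\<Sum>k\<in>{?h<..n}. f k * node_count n E k)"
  proof -
    have "(\<Sum>k\<in>{?h<..n}. f k * node_count n E k) = (\<Sum>v=1..n. \<Sum>k\<in>{?h<..n}. if ?s v = k then f k else 0)"
      unfolding node_count_def sum_distrib_left
      by (rule trans[OF sum.swap]) (intro sum.cong refl, simp)
    also have "\<dots> = (\<Sum>v=1..n. if ?h < ?s v then f (?s v) else 0)"
      using subsize_le[OF rt] by (intro sum.cong refl) simp
    also have "\<dots> = (\<Sum>v\<in>heavy n E. f (?s v))"
      unfolding heavy_def by (rule sum.inter_filter[symmetric]) simp
    finally show ?thesis by simp
  qed
  have edges: "(\<Sum>(v, w)\<in>{(v, w)\<in>E. w \<in> heavy n E}. f (?s v)) =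
     (\<Sum>k\<in>{?h<..n}. f k * (\<Sum>j\<in>{?h<..<k}. pair_count E k j))"
  proof -
    have "(\<Sum>k\<in>{?h<..n}. f k * (\<Sum>j\<in>{?h<..<k}. pair_count E k j)) =
       (\<Sum>k\<in>{?h<..n}. \<Sum>j\<in>{?h<..<k}. \<Sum>e\<in>E. f k * of_bool (?s (fst e) = k \<and> ?s (snd e) = j))"
      by (simp add: pair_count_def sum_distrib_left case_prod_unfold)
    also have "\<dots> = (\<Sum>k\<in>{?h<..n}. \<Sum>e\<in>E. \<Sum>j\<in>{?h<..<k}. f k * of_bool (?s (fst e) = k \<and> ?s (snd e) = j))"
      by (intro sum.cong refl sum.swap)
    also have "\<dots> = (\<Sum>e\<in>E. \<Sum>k\<in>{?h<..n}. \<Sum>j\<in>{?h<..<k}. f k * of_bool (?s (fst e) = k \<and> ?s (snd e) = j))"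
      by (rule sum.swap)
    also have "\<dots> = (\<Sum>e\<in>E. if snd e \<in> heavy n E then f (?s (fst e)) else 0)"
    proof (intro sum.cong refl)
      fix e assume "e \<in> E"
      then have e: "(fst e, snd e) \<in> E" by simp
      have V: "fst e \<in> {1..n}" "snd e \<in> {1..n}" using recursive_tree_edge[OF rt e] by auto
      have "(\<Sum>j\<in>{?h<..<k}. f k * of_bool (?s (fst e) = k \<and> ?s (snd e) = j)) =
          (if ?s (fst e) = k then (if ?h < ?s (snd e) \<and> ?s (snd e) < k then f k else 0) else 0)" for k
      proof -
        have "(\<Sum>j\<in>{?h<..<k}. f k * of_bool (?s (fst e) = k \<and> ?s (snd e) = j)) =
           (\<Sum>j\<in>{?h<..<k}. if ?s (snd e) = j then (if ?s (fst e) = k then f k else 0) else 0)"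
          by (intro sum.cong) auto
        then show ?thesis by simp
      qed
      then show "(\<Sum>k\<in>{?h<..n}. \<Sum>j\<in>{?h<..<k}. f k * of_bool (?s (fst e) = k \<and> ?s (snd e) = j)) =
          (if snd e \<in> heavy n E then f (?s (fst e)) else 0)"
        using subsize_child[OF rt e] subsize_le[OF rt V(1)] V(2) by (simp add: heavy_def)
    qed
    also have "\<dots> = (\<Sum>e\<in>{e\<in>E. snd e \<in> heavy n E}. f (?s (fst e)))"
      by (rule sum.inter_filter[OF recursive_tree_finite[OF rt], symmetric])
    also have "{e\<in>E. snd e \<in> heavy n E} = {(v, w)\<in>E. w \<in> heavy n E}" by auto
    finally show ?thesis by (simp add: case_prod_unfold)
  qed
  have "(\<Sum>(v, w)\<in>{(v, w)\<in>E. w \<in> heavy n E}. f (?s v)) = (\<Sum>v\<in>heavy n E - {lowest_heavy n E}. f (?s v))"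
    using sum.reindex_bij_betw[OF bij_betw_heavy_edges, of "\<lambda>v. f (?s v)"] by (simp add: case_prod_unfold)
  then have "f (?s (lowest_heavy n E)) = (\<Sum>v\<in>heavy n E. f (?s v)) - (\<Sum>(v, w)\<in>{(v, w)\<in>E. w \<in> heavy n E}. f (?s v))"
    using sum.remove[OF fin lowest_heavy(1), of "\<lambda>v. f (?s v)"] by simp
  then show ?thesis
    unfolding nodes edges by (simp add: right_diff_distrib sum_subtractf)
qed

end

end

lemma root_increasing_tree:
  assumes "n \<ge> 1" "T \<in> increasing_trees n"
  shows "root T = 1"
  using assms
proof (induction n arbitrary: T rule: nat_induct_at_least)
  case base
  then show ?case using root_in_nodes[of T] by (auto simp: increasing_trees_def)
next
  case (Suc n)
  then show ?case using increasing_trees_Suc[of n] root_grow by auto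
qed

lemma centroid_subtree_size_eq:
  assumes n: "n \<ge> 1" and T: "T \<in> increasing_trees n"
  shows "centroid_subtree_size T = subsize (edges T) (lowest_heavy n (edges T))"
proof -
  let ?c = "lowest_heavy n (edges T)"
  have rt: "recursive_tree n (edges T)" by (rule recursive_tree_edges[OF n T])
  have nodes: "set (nodes T) = {1..n}" using T by (simp add: increasing_trees_def)
  have c: "?c \<in> {1..n}" using lowest_heavy(1)[OF rt n] by (simp add: heavy_def)
  have d: "tree_dist T = graph_dist (edges T)" by (intro ext) (simp add: tree_dist_def graph_dist_def)
  have D: "total_dist T = (\<lambda>v. \<Sum>x=1..n. graph_dist (edges T) v x)"
    by (intro ext) (simp add: total_dist_def d nodes)
  note min = sum_dist_minimal[OF rt n]
  have "total_dist T ?c \<le> total_dist T u" if "u \<in> {1..n}" for u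
    using min[OF that] unfolding D by (cases "u = ?c") auto
  then have cc: "is_centroid T ?c"
    unfolding is_centroid_def is_arg_min_def nodes using c by (auto simp: not_less)
  have cu: "graph_dist (edges T) 1 ?c < graph_dist (edges T) 1 u" if "is_centroid T u" "u \<noteq> ?c" for u
  proof -
    have "u \<in> {1..n}" "\<not> total_dist T ?c < total_dist T u"
      using that(1) c unfolding is_centroid_def is_arg_min_def nodes by auto
    then show ?thesis using min[OF _ that(2)] unfolding D by blast
  qed
  have "centroid T = ?c"
    unfolding centroid_def arg_min_def d root_increasing_tree[OF n T]
  proof (rule some_equality)
    show "is_arg_min (graph_dist (edges T) 1) (is_centroid T) ?c"
      unfolding is_arg_min_def using cc cu order_less_asym by blast
    show "u = ?c" if "is_arg_min (graph_dist (edges T) 1) (is_centroid T) u" for u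
      using that cc cu unfolding is_arg_min_def by blast
  qed
  then show ?thesis by (simp add: centroid_subtree_size_def subsize_def subtree_def Image_def)
qed

text \<open>
  The means of both sides of \<open>lowest_heavy_telescope\<close>, whose right-hand side is linear in the counts.
\<close>

lemma expectation_centroid_subtree_size:
  fixes f :: "nat \<Rightarrow> real"
  assumes adm: "very_simple_increasing c1 c2" and a: "a = vsit_alpha c1 c2" and n: "n \<ge> 1"
  shows "measure_pmf.expectation (random_tree c1 c2 n) (\<lambda>T. f (centroid_subtree_size T)) =
    (\<Sum>k\<in>{n div 2<..n}. f k * (expected_nodes a n k - (\<Sum>j\<in>{n div 2<..<k}. expected_pairs a n k j)))"
proof -
  let ?Z = "\<Sum>T\<in>increasing_trees n. weight c1 c2 T"
  have "measure_pmf.expectation (random_tree c1 c2 n) (\<lambda>T. f (centroid_subtree_size T)) =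
     (\<Sum>T\<in>increasing_trees n. pmf (random_tree c1 c2 n) T * f (centroid_subtree_size T))"
    by (subst integral_measure_pmf[OF finite_increasing_trees[of n]])
       (auto simp: set_pmf_iff pmf_random_tree[OF adm n] split: if_splits)
  also have "\<dots> = (\<Sum>T\<in>increasing_trees n. weight c1 c2 T * f (subsize (edges T) (lowest_heavy n (edges T))) / ?Z)"
    by (intro sum.cong refl) (simp add: pmf_random_tree[OF adm n] centroid_subtree_size_eq[OF n])
  also have "\<dots> = tree_mean c1 c2 n (\<lambda>E. f (subsize E (lowest_heavy n E)))"
    unfolding tree_mean_def by (rule sum_divide_distrib[symmetric])
  also have "\<dots> = tree_mean c1 c2 n (\<lambda>E. \<Sum>k\<in>{n div 2<..n}. f k * (node_count n E k - (\<Sum>j\<in>{n div 2<..<k}. pair_count E k j)))"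
    by (rule tree_mean_cong[OF n lowest_heavy_telescope[OF _ n]])
  also have "\<dots> = (\<Sum>k\<in>{n div 2<..n}. f k * (expected_nodes a n k - (\<Sum>j\<in>{n div 2<..<k}. expected_pairs a n k j)))"
    unfolding tree_mean_sum tree_mean_cmult tree_mean_diff mean_node_count[OF adm a n] mean_pair_count[OF adm a n] ..
  finally show ?thesis .
qed

section \<open>Asymptotics of the mean\<close>

text \<open>
  For \<open>2 * h + 1 \<ge> k\<close> this is the probability that in a random tree of size \<open>k\<close> some child of the
  root has a subtree with more than \<open>h\<close> nodes: its expected number of such children, of which there
  is at most one.
\<close>

definition heavy_child_prob :: "real \<Rightarrow> nat \<Rightarrow> nat \<Rightarrow> real" where
  "heavy_child_prob a h k = (\<Sum>j\<in>{h<..<k}. a * size_weight a j / real j) / size_weight a k"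

text \<open>
  The limit of \<open>heavy_child_prob a h k\<close> as \<open>h\<close> and \<open>k\<close> tend to infinity with \<open>k / h\<close> tending to \<open>t\<close>.
\<close>

definition limit_child_prob :: "real \<Rightarrow> real \<Rightarrow> real" where
  "limit_child_prob a t = (if a = 1 then ln t else a / (a - 1) * (1 - t powr (- (a - 1))))"

lemma heavy_child_prob_closed:
  assumes "a > 0" "a \<noteq> 1" "h < k"
  shows "heavy_child_prob a h k = a / (a - 1) * (1 - size_weight a (Suc h) / size_weight a k)"
proof -
  have "{h<..<k} = {Suc h..<k}" by auto
  then have "(a - 1) * (\<Sum>j\<in>{h<..<k}. a * size_weight a j / real j) = a * (size_weight a k - size_weight a (Suc h))"
    using sum_size_weight[of "Suc h" k a] assms(3) by simp
  then have "(\<Sum>j\<in>{h<..<k}. a * size_weight a j / real j) = a * (size_weight a k - size_weight a (Suc h)) / (a - 1)"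
    using assms(2) by (simp add: field_simps)
  moreover have "a * (y - x) / (a - 1) / y = a / (a - 1) * (1 - x / y)" if "y > 0" for x y
    using that assms(2) by (simp add: divide_simps)
  ultimately show ?thesis
    using size_weight_pos[OF assms(1), of k] by (simp add: heavy_child_prob_def)
qed

lemma sum_size_weight_total:
  assumes "k \<ge> 1"
  shows "(\<Sum>j=1..<k. a * size_weight a j) = real (k - 1) * size_weight a k"
  using assms
proof (induction k rule: nat_induct_at_least)
  case (Suc k)
  have "(\<Sum>j=1..<Suc k. a * size_weight a j) = real (k - 1) * size_weight a k + a * size_weight a k"
    using Suc by simp
  also have "\<dots> = real k * size_weight a (Suc k)"
    using Suc.hyps by (simp add: size_weight_Suc of_nat_diff field_simps)
  finally show ?case by simp
qed simp

text \<open>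
  The upper bound comes from replacing \<open>j\<close> by \<open>h + 1\<close> in the denominators, since
  \<open>sum_size_weight_total\<close> evaluates the sum without denominators. For \<open>h = n div 2\<close> and \<open>k \<le> n\<close> it is at
  most \<open>2\<close>, whatever \<open>n\<close> is, and this dominates the Riemann sums later on.
\<close>

lemma heavy_child_prob_bounds:
  assumes a: "a > 0" and k: "k \<ge> 1"
  shows "0 \<le> heavy_child_prob a h k" "heavy_child_prob a h k \<le> real (k - 1) / real (Suc h)"
proof -
  note w = size_weight_pos[OF a]
  show "0 \<le> heavy_child_prob a h k"
    unfolding heavy_child_prob_def using a w by (intro divide_nonneg_pos sum_nonneg) (auto simp: less_imp_le)
  have "(\<Sum>j\<in>{h<..<k}. a * size_weight a j / real j) \<le> (\<Sum>j\<in>{h<..<k}. a * size_weight a j / real (Suc h))"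
    using a w by (intro sum_mono divide_left_mono) (auto simp: less_imp_le)
  also have "\<dots> \<le> (\<Sum>j=1..<k. a * size_weight a j / real (Suc h))"
    using a w by (intro sum_mono2) (auto simp: less_imp_le)
  also have "\<dots> = real (k - 1) * size_weight a k / real (Suc h)"
    unfolding sum_divide_distrib[symmetric] sum_size_weight_total[OF k] ..
  finally show "heavy_child_prob a h k \<le> real (k - 1) / real (Suc h)"
    using w[of k] by (simp add: heavy_child_prob_def divide_simps mult_ac)
qed

lemma size_weight_asymp:
  assumes "a > 0"
  shows "(\<lambda>m. size_weight a (Suc m) / real m powr (a - 1)) \<longlonglongrightarrow> inverse (Gamma a)"
proof (rule Lim_transform_eventually)
  have "Gamma a \<noteq> 0" using Gamma_real_pos[OF assms] by simp
  then show "(\<lambda>m. inverse (Gamma_series' a m)) \<longlonglongrightarrow> inverse (Gamma a)"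
    by (intro tendsto_inverse Gamma_series'_LIMSEQ)
  show "eventually (\<lambda>m. inverse (Gamma_series' a m) = size_weight a (Suc m) / real m powr (a - 1)) sequentially"
    using eventually_gt_at_top[of 0]
  proof eventually_elim
    case (elim m)
    have "exp (a * ln (real m)) = real m powr (a - 1) * real m"
      using elim powr_add[of "real m" "a - 1" 1] by (simp add: powr_def mult.commute)
    moreover have "fact m = real m * fact (m - 1)" using elim by (simp add: fact_reduce)
    ultimately show ?case
      by (simp add: Gamma_series'_def size_weight_def divide_simps)
  qed
qed

text \<open>
  For \<open>a \<noteq> 1\<close> the constant \<open>Gamma a\<close> cancels in the quotient of two size weights, and for \<open>a = 1\<close>
  the Euler--Mascheroni constant cancels in the difference of two harmonic numbers.
\<close>

lemma heavy_child_prob_limit: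
  fixes h m :: "nat \<Rightarrow> nat"
  assumes a: "a > 0" and t: "t > 0"
    and h: "filterlim h at_top sequentially" and m: "filterlim m at_top sequentially"
    and le: "eventually (\<lambda>n. h n \<le> m n) sequentially"
    and ratio: "(\<lambda>n. real (m n) / real (h n)) \<longlonglongrightarrow> t"
  shows "(\<lambda>n. heavy_child_prob a (h n) (Suc (m n))) \<longlonglongrightarrow> limit_child_prob a t"
proof -
  have pos: "eventually (\<lambda>n. h n > 0 \<and> m n > 0) sequentially"
    using eventually_compose_filterlim[OF eventually_gt_at_top h] eventually_compose_filterlim[OF eventually_gt_at_top m]
    by (rule eventually_conj)
  show ?thesis
  proof (cases "a = 1")
    case True
    let ?d = "\<lambda>n. harm n - ln (real n)"
    have "(\<lambda>n. ?d (m n) - ?d (h n) + ln (real (m n) / real (h n))) \<longlonglongrightarrow> euler_mascheroni - euler_mascheroni + ln t"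
      by (intro tendsto_intros filterlim_compose[OF euler_mascheroni_LIMSEQ h]
            filterlim_compose[OF euler_mascheroni_LIMSEQ m] tendsto_ln ratio) (use t in auto)
    then have lim: "(\<lambda>n. ?d (m n) - ?d (h n) + ln (real (m n) / real (h n))) \<longlonglongrightarrow> limit_child_prob a t"
      using True by (simp add: limit_child_prob_def)
    show ?thesis
    proof (rule Lim_transform_eventually[OF lim])
      show "eventually (\<lambda>n. ?d (m n) - ?d (h n) + ln (real (m n) / real (h n)) =
          heavy_child_prob a (h n) (Suc (m n))) sequentially"
        using pos le
      proof eventually_elim
        case (elim n)
        have "size_weight 1 j = 1" for j by (simp add: size_weight_def pochhammer_fact[symmetric])
        then have "heavy_child_prob a (h n) (Suc (m n)) = (\<Sum>j\<in>{h n<..m n}. 1 / real j)"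
          unfolding True heavy_child_prob_def by (simp add: lessThan_Suc_atMost greaterThanLessThan_eq greaterThanAtMost_def)
        also have "\<dots> = harm (m n) - harm (h n)"
        proof -
          have "{1..m n} = {1..h n} \<union> {h n<..m n}" using elim by auto
          then have "harm (m n) = harm (h n) + (\<Sum>j\<in>{h n<..m n}. inverse (real j))"
            unfolding harm_def by (simp only:) (rule sum.union_disjoint, auto)
          then show ?thesis by (simp add: divide_inverse)
        qed
        finally show ?case using elim by (simp add: ln_div)
      qed
    qed
  next
    case False
    define p where "p m = size_weight a (Suc m) / real m powr (a - 1)" for m
    have p: "p \<longlonglongrightarrow> inverse (Gamma a)" unfolding p_def by (rule size_weight_asymp[OF a])
    have "Gamma a \<noteq> 0" using Gamma_real_pos[OF a] by simp
    then have "(\<lambda>n. a / (a - 1) * (1 - p (h n) / p (m n) * (real (m n) / real (h n)) powr (- (a - 1))))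
        \<longlonglongrightarrow> a / (a - 1) * (1 - inverse (Gamma a) / inverse (Gamma a) * t powr (- (a - 1)))"
      by (intro tendsto_intros filterlim_compose[OF p h] filterlim_compose[OF p m] ratio) (use t in auto)
    then have lim: "(\<lambda>n. a / (a - 1) * (1 - p (h n) / p (m n) * (real (m n) / real (h n)) powr (- (a - 1))))
        \<longlonglongrightarrow> limit_child_prob a t"
      using False \<open>Gamma a \<noteq> 0\<close> by (simp add: limit_child_prob_def)
    show ?thesis
    proof (rule Lim_transform_eventually[OF lim])
      show "eventually (\<lambda>n. a / (a - 1) * (1 - p (h n) / p (m n) * (real (m n) / real (h n)) powr (- (a - 1))) =
          heavy_child_prob a (h n) (Suc (m n))) sequentially"
        using pos le
      proof eventually_elim
        case (elim n)
        define H M where "H = real (h n) powr (a - 1)" and "M = real (m n) powr (a - 1)"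
        have HM: "H > 0" "M > 0" "size_weight a (Suc (m n)) > 0"
          using elim size_weight_pos[OF a] by (auto simp: H_def M_def)
        have "(real (m n) / real (h n)) powr (- (a - 1)) = H / M"
          unfolding H_def M_def powr_minus using elim by (simp add: powr_divide)
        then have "p (h n) / p (m n) * (real (m n) / real (h n)) powr (- (a - 1)) =
            size_weight a (Suc (h n)) / size_weight a (Suc (m n))"
          using HM unfolding p_def H_def[symmetric] M_def[symmetric] by (simp add: field_simps)
        then show ?case using heavy_child_prob_closed[OF a False, of "h n" "Suc (m n)"] elim by simp
      qed
    qed
  qed
qed

text \<open>
  The sum is the integral of the step function which takes the value \<open>n * g n k\<close> on the interval
  from \<open>k / n\<close> to \<open>(k + 1) / n\<close>, that is, where \<open>\<lfloor>n * \<theta>\<rfloor> = k\<close>.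
\<close>

lemma riemann_dominated:
  fixes g :: "nat \<Rightarrow> nat \<Rightarrow> real" and f :: "real \<Rightarrow> real"
  assumes f [measurable]: "f \<in> borel_measurable borel"
    and bound: "\<And>n k. n div 2 < k \<Longrightarrow> k < n \<Longrightarrow> \<bar>real n * g n k\<bar> \<le> C"
    and lim: "\<And>\<theta>. 1/2 < \<theta> \<Longrightarrow> \<theta> < 1 \<Longrightarrow> (\<lambda>n. real n * g n (nat \<lfloor>real n * \<theta>\<rfloor>)) \<longlonglongrightarrow> f \<theta>"
  shows "(\<lambda>n. \<Sum>k\<in>{n div 2<..<n}. g n k) \<longlonglongrightarrow> (\<integral>\<theta>. f \<theta> * indicator {1/2..1} \<theta> \<partial>lborel)"
proof -
  \<comment> \<open>The intervals are disjoint, so at most one summand is nonzero.\<close>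
  define s where "s n \<theta> = (\<Sum>k\<in>{n div 2<..<n}. real n * g n k * indicator {real k / real n..<(real k + 1) / real n} \<theta>)"
    for n \<theta>
  have s_eq: "s n \<theta> = (if int (n div 2) < \<lfloor>real n * \<theta>\<rfloor> \<and> \<lfloor>real n * \<theta>\<rfloor> < int n then real n * g n (nat \<lfloor>real n * \<theta>\<rfloor>) else 0)" for n \<theta>
  proof (cases "n = 0")
    case False
    have "indicator {real k / real n..<(real k + 1) / real n} \<theta> = (of_bool (\<lfloor>real n * \<theta>\<rfloor> = int k) :: real)" for k
      using False by (auto simp: indicator_def floor_eq_iff field_simps)
    then have "s n \<theta> = (\<Sum>k\<in>{n div 2<..<n}. real n * g n k * of_bool (\<lfloor>real n * \<theta>\<rfloor> = int k))"
      by (simp add: s_def)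
    also have "\<dots> = (\<Sum>k\<in>{n div 2<..<n}. if nat \<lfloor>real n * \<theta>\<rfloor> = k then real n * g n k else 0)"
    proof (intro sum.cong refl)
      fix k assume "k \<in> {n div 2<..<n}"
      then have "\<lfloor>real n * \<theta>\<rfloor> = int k \<longleftrightarrow> nat \<lfloor>real n * \<theta>\<rfloor> = k" by (simp add: nat_eq_iff2) linarith
      then show "real n * g n k * of_bool (\<lfloor>real n * \<theta>\<rfloor> = int k) = (if nat \<lfloor>real n * \<theta>\<rfloor> = k then real n * g n k else 0)"
        by simp
    qed
    also have "\<dots> = (if nat \<lfloor>real n * \<theta>\<rfloor> \<in> {n div 2<..<n} then real n * g n (nat \<lfloor>real n * \<theta>\<rfloor>) else 0)"
      by simp
    also have "nat \<lfloor>real n * \<theta>\<rfloor> \<in> {n div 2<..<n} \<longleftrightarrow> int (n div 2) < \<lfloor>real n * \<theta>\<rfloor> \<and> \<lfloor>real n * \<theta>\<rfloor> < int n"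
      by (auto simp del: of_nat_div)
    finally show ?thesis .
  qed (simp add: s_def)
  have s_zero: "s n \<theta> = 0" if "\<theta> < 0 \<or> \<theta> > 1" for n \<theta>
  proof (cases "n = 0")
    case False
    have "\<not> (int (n div 2) < \<lfloor>real n * \<theta>\<rfloor> \<and> \<lfloor>real n * \<theta>\<rfloor> < int n)"
    proof
      assume b: "int (n div 2) < \<lfloor>real n * \<theta>\<rfloor> \<and> \<lfloor>real n * \<theta>\<rfloor> < int n"
      then have "0 < real n * \<theta>" "real n * \<theta> < real n" by linarith+
      then show False using that False by (auto simp: zero_less_mult_iff)
    qed
    then show ?thesis by (simp only: s_eq if_False)
  qed (simp add: s_def)
  have C: "0 \<le> C" using bound[of 3 2] abs_ge_zero[of "real 3 * g 3 2"] by simp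
  have "(\<lambda>n. integral\<^sup>L lborel (s n)) \<longlonglongrightarrow> (\<integral>\<theta>. f \<theta> * indicator {1/2..1} \<theta> \<partial>lborel)"
  proof (rule integral_dominated_convergence[where w = "\<lambda>\<theta>. C * indicator {0..1} \<theta>"])
    show "(\<lambda>\<theta>. f \<theta> * indicator {1/2..1} \<theta>) \<in> borel_measurable lborel" by measurable
    show "s n \<in> borel_measurable lborel" for n unfolding s_def by measurable
    show "integrable lborel (\<lambda>\<theta>::real. C * indicator {0..1} \<theta> :: real)"
      by (intro integrable_mult_right integrable_real_indicator) simp_all
    show "AE \<theta> in lborel. norm (s n \<theta>) \<le> C * indicator {0..1} \<theta>" for n
    proof (rule AE_I2)
      fix \<theta> :: real
      have "\<bar>s n \<theta>\<bar> \<le> C"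
        unfolding s_eq using bound[of n "nat \<lfloor>real n * \<theta>\<rfloor>"] C by (auto simp del: of_nat_div)
      then show "norm (s n \<theta>) \<le> C * indicator {0..1} \<theta>"
        using s_zero[of \<theta> n] by (cases "\<theta> \<in> {0..1}") auto
    qed
    have "AE \<theta> in lborel. \<theta> \<noteq> (1/2 :: real)" "AE \<theta> in lborel. \<theta> \<noteq> (1 :: real)"
      by (rule AE_lborel_singleton)+
    then show "AE \<theta> in lborel. (\<lambda>n. s n \<theta>) \<longlonglongrightarrow> f \<theta> * indicator {1/2..1} \<theta>"
    proof eventually_elim
      case (elim \<theta>)
      consider "\<theta> < 1/2" | "\<theta> > 1" | "1/2 < \<theta>" "\<theta> < 1" using elim by linarith
      then show ?case
      proof cases
        case 1
        have "s n \<theta> = 0" for n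
        proof -
          have "real n * \<theta> \<le> real n / 2" using 1 mult_left_mono[of \<theta> "1/2" "real n"] by simp
          moreover have "real n / 2 < real (n div 2) + 1" by linarith
          ultimately have "\<not> int (n div 2) < \<lfloor>real n * \<theta>\<rfloor>" by linarith
          then show ?thesis by (simp add: s_eq)
        qed
        then show ?thesis using 1 by simp
      next
        case 2
        then show ?thesis using s_zero by simp
      next
        case 3
        have "filterlim (\<lambda>n. real n * (\<theta> - 1/2)) at_top sequentially"
          using 3 by (intro filterlim_at_top_mult_tendsto_pos[OF tendsto_const _ filterlim_real_sequentially]) simp
        then have "eventually (\<lambda>n. real n * (\<theta> - 1/2) > 1) sequentially" "eventually (\<lambda>n. n > 0) sequentially"
          by (simp_all add: filterlim_at_top_dense eventually_gt_at_top)
        then have "eventually (\<lambda>n. real n * g n (nat \<lfloor>real n * \<theta>\<rfloor>) = s n \<theta>) sequentially"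
        proof eventually_elim
          case (elim n)
          have "real n * \<theta> > real (n div 2) + 1"
          proof -
            have "real (n div 2) \<le> real n / 2" by linarith
            then show ?thesis using elim by (simp add: algebra_simps)
          qed
          moreover have "real n * \<theta> < real n" using elim 3 by simp
          ultimately have "int (n div 2) < \<lfloor>real n * \<theta>\<rfloor> \<and> \<lfloor>real n * \<theta>\<rfloor> < int n" by linarith
          then show ?case by (simp only: s_eq simp_thms if_True)
        qed
        with lim[OF 3] have "(\<lambda>n. s n \<theta>) \<longlonglongrightarrow> f \<theta>" by (rule Lim_transform_eventually)
        then show ?thesis using 3 by simp
      qed
    qed
  qed
  moreover have "integral\<^sup>L lborel (s n) = (\<Sum>k\<in>{n div 2<..<n}. g n k)" if "n > 0" for n
  proof -
    have "measure lborel {real k / real n..<(real k + 1) / real n} = 1 / real n" for k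
      using that by (subst measure_lborel_Ico) (auto simp: field_simps)
    moreover have "integral\<^sup>L lborel (s n) =
        (\<Sum>k\<in>{n div 2<..<n}. \<integral>\<theta>. real n * g n k * indicator {real k / real n..<(real k + 1) / real n} \<theta> \<partial>lborel)"
      unfolding s_def
      by (rule Bochner_Integration.integral_sum) (intro integrable_mult_right integrable_real_indicator, auto simp: emeasure_bounded_finite[unfolded infinity_ennreal_def])
    ultimately show ?thesis using that by simp
  qed
  ultimately show ?thesis
    by (elim Lim_transform_eventually) (auto intro: eventually_mono[OF eventually_gt_at_top[of 0]])
qed

text \<open>
  The probabilistic meaning of the density: \<open>a / \<theta>\<^sup>2\<close> is the limiting density of subtrees of size
  \<open>\<theta> * n\<close>, and the other factor is the probability that none of the children of the root of such a
  subtree is heavy.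
\<close>

lemma limit_density_eq:
  assumes "\<theta> > 0"
  shows "limit_density a \<theta> = a / \<theta>\<^sup>2 * (1 - limit_child_prob a (2 * \<theta>))"
proof (cases "a = 1")
  case False
  define t where "t = 2 * \<theta>"
  have t: "t > 0" using assms by (simp add: t_def)
  have p: "t powr (- (a + 1)) = t powr (- (a - 1)) / t\<^sup>2" "t powr (- 2) = 1 / t\<^sup>2"
  proof -
    show p2: "t powr (- 2) = 1 / t\<^sup>2"
      using t by (simp add: powr_minus powr_numeral divide_inverse)
    have "t powr (- (a + 1)) = t powr (- (a - 1) + - 2)" by (rule arg_cong[of _ _ "(powr) t"]) simp
    also have "\<dots> = t powr (- (a - 1)) * t powr (- 2)" by (rule powr_add)
    finally show "t powr (- (a + 1)) = t powr (- (a - 1)) / t\<^sup>2" by (simp add: p2)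
  qed
  have "limit_density a \<theta> = 4 * (a / (a - 1)) * (a * (t powr (- (a - 1)) / t\<^sup>2) - 1 / t\<^sup>2)"
    unfolding limit_density_def t_def[symmetric] p using False by simp
  also have "\<dots> = a / (t / 2)\<^sup>2 * ((a * t powr (- (a - 1)) - 1) / (a - 1))"
    using t False by (simp add: field_simps)
  also have "(a * t powr (- (a - 1)) - 1) / (a - 1) = 1 - limit_child_prob a t"
    using False by (simp add: limit_child_prob_def field_simps)
  finally show ?thesis by (simp add: t_def)
qed (simp add: limit_density_def limit_child_prob_def)

lemma limit_atom_eq: "limit_atom a = 1 - limit_child_prob a 2"
  by (simp add: limit_atom_def limit_child_prob_def)

lemma expectation_centroid_size_power:
  assumes adm: "very_simple_increasing c1 c2" and a: "a = vsit_alpha c1 c2" and n: "n \<ge> 1"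
  shows "measure_pmf.expectation (random_tree c1 c2 n) (\<lambda>T. (real (centroid_subtree_size T) / real n) ^ r) =
    (1 - heavy_child_prob a (n div 2) n) +
    (\<Sum>k\<in>{n div 2<..<n}. (real k / real n) ^ r * expected_nodes a n k * (1 - heavy_child_prob a (n div 2) k))"
proof -
  have inner: "expected_nodes a n k - (\<Sum>j\<in>{n div 2<..<k}. expected_pairs a n k j) =
      expected_nodes a n k * (1 - heavy_child_prob a (n div 2) k)" for k
  proof -
    have "(\<Sum>j\<in>{n div 2<..<k}. expected_pairs a n k j) =
        (\<Sum>j\<in>{n div 2<..<k}. expected_nodes a n k / size_weight a k * (a * size_weight a j / real j))"
      by (intro sum.cong refl) (auto simp: expected_pairs_def)
    then show ?thesis
      unfolding sum_distrib_left[symmetric] by (simp add: heavy_child_prob_def right_diff_distrib)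
  qed
  have "{n div 2<..n} = insert n {n div 2<..<n}" using n by auto
  then have "measure_pmf.expectation (random_tree c1 c2 n) (\<lambda>T. (real (centroid_subtree_size T) / real n) ^ r) =
     (\<Sum>k\<in>insert n {n div 2<..<n}. (real k / real n) ^ r * (expected_nodes a n k * (1 - heavy_child_prob a (n div 2) k)))"
    by (simp only: expectation_centroid_subtree_size[OF adm a n, of "\<lambda>k. (real k / real n) ^ r"] inner)
  then show ?thesis using n by (simp add: expected_nodes_def mult_ac)
qed

text \<open>
  The summand for \<open>k = n\<close> is treated separately because \<open>expected_nodes a n n = 1\<close> is not of order
  \<open>1 / n\<close>; it produces the atom at \<open>1\<close>.
\<close>

lemma expectation_limit:
  assumes adm: "very_simple_increasing c1 c2" and a: "a = vsit_alpha c1 c2"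
  shows "(\<lambda>n. measure_pmf.expectation (random_tree c1 c2 n) (\<lambda>T. (real (centroid_subtree_size T) / real n) ^ r))
    \<longlonglongrightarrow> limit_atom a + (\<integral>\<theta>. \<theta> ^ r * limit_density a \<theta> * indicator {1/2..1} \<theta> \<partial>lborel)"
proof -
  have a0: "a > 0" using admissible(2)[OF adm] a by simp
  let ?q = "\<lambda>n k. heavy_child_prob a (n div 2) k"
  let ?g = "\<lambda>n k. (real k / real n) ^ r * expected_nodes a n k * (1 - ?q n k)"
  have half: "filterlim (\<lambda>n::nat. n div 2) at_top sequentially"
    unfolding filterlim_at_top
  proof
    fix Z :: nat
    show "eventually (\<lambda>n. Z \<le> n div 2) sequentially"
      using eventually_ge_at_top[of "2 * Z"] by eventually_elim linarith
  qed
  have half_ratio: "(\<lambda>n. real (n div 2) / real n) \<longlonglongrightarrow> 1/2"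
  proof (rule tendsto_sandwich)
    show "eventually (\<lambda>n. 1/2 - 1 / real n \<le> real (n div 2) / real n) sequentially"
      using eventually_gt_at_top[of 0]
    proof eventually_elim
      case (elim n)
      have "real n / 2 - 1 \<le> real (n div 2)" by linarith
      then have "(real n / 2 - 1) / real n \<le> real (n div 2) / real n" by (intro divide_right_mono) auto
      then show ?case using elim by (simp add: diff_divide_distrib)
    qed
    show "eventually (\<lambda>n. real (n div 2) / real n \<le> 1/2) sequentially"
      using eventually_gt_at_top[of 0]
    proof eventually_elim
      case (elim n)
      have "real (n div 2) \<le> real n / 2" by linarith
      then show ?case using elim by (simp add: divide_le_eq)
    qed
    show "(\<lambda>n. 1/2 - 1 / real n) \<longlonglongrightarrow> 1/2" by real_asymp
  qed simp
  have q_lim: "(\<lambda>n. ?q n (k n)) \<longlonglongrightarrow> limit_child_prob a (2 * \<theta>)"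
    if \<theta>: "\<theta> > 1/2" and k: "(\<lambda>n. real (k n) / real n) \<longlonglongrightarrow> \<theta>" for \<theta> and k :: "nat \<Rightarrow> nat"
  proof -
    have ev: "eventually (\<lambda>n. real (k n) / real n > 1/2) sequentially"
      using order_tendstoD(1)[OF k \<theta>] .
    have k1: "eventually (\<lambda>n. n > 0 \<and> n div 2 < k n) sequentially"
      using ev eventually_gt_at_top[of 0]
    proof eventually_elim
      case (elim n)
      have "real n < 2 * real (k n)" using elim by (simp add: field_simps)
      then show ?case using elim by linarith
    qed
    \<comment> \<open>The asymptotics are stated for sizes of the form Suc (m n), hence the shift by one.\<close>
    have klim: "filterlim (\<lambda>n. k n - 1) at_top sequentially"
      using half by (rule filterlim_at_top_mono) (use k1 in eventually_elim, auto)
    have "(\<lambda>n. (real (k n) / real n - 1 / real n) / (real (n div 2) / real n)) \<longlonglongrightarrow> (\<theta> - 0) / (1/2)"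
      by (intro tendsto_intros k half_ratio lim_const_over_n[of 1, simplified]) auto
    then have "(\<lambda>n. (real (k n) / real n - 1 / real n) / (real (n div 2) / real n)) \<longlonglongrightarrow> 2 * \<theta>" by (simp add: mult.commute)
    moreover have "eventually (\<lambda>n. (real (k n) / real n - 1 / real n) / (real (n div 2) / real n) = real (k n - 1) / real (n div 2)) sequentially"
      using k1 by eventually_elim (simp add: diff_divide_distrib[symmetric] of_nat_diff)
    ultimately have "(\<lambda>n. real (k n - 1) / real (n div 2)) \<longlonglongrightarrow> 2 * \<theta>" by (rule Lim_transform_eventually)
    moreover have "eventually (\<lambda>n. n div 2 \<le> k n - 1) sequentially" using k1 by eventually_elim auto
    ultimately have "(\<lambda>n. heavy_child_prob a (n div 2) (Suc (k n - 1))) \<longlonglongrightarrow> limit_child_prob a (2 * \<theta>)"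
      using \<theta> by (intro heavy_child_prob_limit[OF a0 _ half klim]) auto
    moreover have "eventually (\<lambda>n. heavy_child_prob a (n div 2) (Suc (k n - 1)) = ?q n (k n)) sequentially"
      using k1 by eventually_elim auto
    ultimately show ?thesis by (rule Lim_transform_eventually)
  qed
  have atom: "(\<lambda>n. 1 - ?q n n) \<longlonglongrightarrow> limit_atom a"
  proof -
    have "(\<lambda>n. real n / real n) \<longlonglongrightarrow> 1" by real_asymp
    from q_lim[OF _ this] show ?thesis unfolding limit_atom_eq by (intro tendsto_intros) simp
  qed
  have cont: "(\<lambda>n. \<Sum>k\<in>{n div 2<..<n}. ?g n k) \<longlonglongrightarrow> (\<integral>\<theta>. \<theta> ^ r * limit_density a \<theta> * indicator {1/2..1} \<theta> \<partial>lborel)"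
  proof (rule riemann_dominated[where C = "4 * a * (1 + a) / min a 1 * 3"])
    show "(\<lambda>\<theta>. \<theta> ^ r * limit_density a \<theta>) \<in> borel_measurable borel" by measurable
  next
    fix n k :: nat assume k: "n div 2 < k" "k < n"
    \<comment> \<open>As k < n, the bound on the probability is at most (n - 2) / (n div 2 + 1) \<le> 2.\<close>
    have q: "\<bar>1 - ?q n k\<bar> \<le> 3"
    proof -
      have "k \<ge> 1" using k by simp
      note b = heavy_child_prob_bounds[OF a0 this, of "n div 2"]
      have "real (k - 1) / real (Suc (n div 2)) \<le> 2"
      proof -
        have "k - 1 \<le> 2 * Suc d" if "n \<le> 2 * d + 1" for d using that k(2) by simp
        then have "k - 1 \<le> 2 * Suc (n div 2)" by simp
        then have "real (k - 1) \<le> 2 * real (Suc (n div 2))" by (metis of_nat_le_iff of_nat_mult of_nat_numeral)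
        then show ?thesis by (simp add: divide_le_eq)
      qed
      then show ?thesis using b by linarith
    qed
    have pw: "0 \<le> (real k / real n) ^ r" "(real k / real n) ^ r \<le> 1"
      using k by (auto intro!: power_le_one simp: divide_le_eq)
    have e: "\<bar>real n * expected_nodes a n k\<bar> \<le> 4 * a * (1 + a) / min a 1"
    proof -
      \<comment> \<open>For all k \<ge> 1 the factor k + a - 1 is at least m * k, and n \<le> 2 * k.\<close>
      define m where "m = min a 1"
      have m: "m > 0" "m \<le> a" "m \<le> 1" using a0 by (auto simp: m_def)
      have k1: "real k \<ge> 1" using k by simp
      have k2: "real n \<le> 2 * real k" using k by linarith
      have "m * real k \<le> real k + a - 1"
      proof -
        have "(1 - m) * (real k - 1) \<ge> 0" using m k1 by simp
        then show ?thesis using m by (simp add: algebra_simps)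
      qed
      moreover have "0 < m * real k" using m k1 by simp
      ultimately have "(m * real k) * real k \<le> (real k + a - 1) * (real k + a)"
        using a0 k1 by (intro mult_mono) auto
      moreover have "0 < (m * real k) * real k" using m k1 by simp
      moreover have "real n * (a * (real n + a - 1)) \<le> (2 * real k) * (a * ((1 + a) * (2 * real k)))"
      proof -
        have "a * 1 \<le> a * real n" using a0 k k1 by (intro mult_left_mono) auto
        then have "real n + a - 1 \<le> (1 + a) * real n" unfolding distrib_right by linarith
        also have "\<dots> \<le> (1 + a) * (2 * real k)" using a0 k2 by simp
        finally have "real n + a - 1 \<le> (1 + a) * (2 * real k)" .
        moreover have "0 \<le> real n + a - 1" using a0 k k1 by linarith
        ultimately show ?thesis using a0 k2 by (intro mult_mono mult_nonneg_nonneg) auto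
      qed
      moreover have "0 \<le> real n * (a * (real n + a - 1))" using a0 k k1 by simp
      ultimately have "real n * (a * (real n + a - 1)) / ((real k + a - 1) * (real k + a)) \<le>
          (2 * real k) * (a * ((1 + a) * (2 * real k))) / ((m * real k) * real k)"
        by (intro frac_le) auto
      also have "\<dots> = 4 * a * (1 + a) / m" using k1 m by (simp add: field_simps)
      finally have "real n * expected_nodes a n k \<le> 4 * a * (1 + a) / m"
        using k by (simp add: expected_nodes_def)
      moreover have "0 \<le> real n * expected_nodes a n k"
        using k k1 a0 by (simp add: expected_nodes_def)
      ultimately show ?thesis by (simp add: m_def)
    qed
    have "\<bar>real n * ?g n k\<bar> = (real k / real n) ^ r * (\<bar>real n * expected_nodes a n k\<bar> * \<bar>1 - ?q n k\<bar>)"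
      using pw by (simp add: abs_mult mult_ac)
    also have "\<dots> \<le> 1 * (4 * a * (1 + a) / min a 1 * 3)"
      using pw e q a0 by (intro mult_mono) auto
    finally show "\<bar>real n * ?g n k\<bar> \<le> 4 * a * (1 + a) / min a 1 * 3" by simp
  next
    fix \<theta> :: real assume \<theta>: "1/2 < \<theta>" "\<theta> < 1"
    let ?k = "\<lambda>n. nat \<lfloor>real n * \<theta>\<rfloor>"
    have kr: "(\<lambda>n. real (?k n) / real n) \<longlonglongrightarrow> \<theta>"
    proof (rule tendsto_sandwich)
      show "eventually (\<lambda>n. \<theta> - 1 / real n \<le> real (?k n) / real n) sequentially"
        using eventually_gt_at_top[of 0]
      proof eventually_elim
        case (elim n)
        have "real n * \<theta> - 1 \<le> real (?k n)" by linarith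
        then have "(real n * \<theta> - 1) / real n \<le> real (?k n) / real n" by (intro divide_right_mono) auto
        then show ?case using elim by (simp add: diff_divide_distrib)
      qed
      show "eventually (\<lambda>n. real (?k n) / real n \<le> \<theta>) sequentially"
        using eventually_gt_at_top[of 0]
      proof eventually_elim
        case (elim n)
        have "0 \<le> real n * \<theta>" using \<theta> by simp
        then have "real (?k n) \<le> real n * \<theta>" by linarith
        then show ?case using elim by (simp add: divide_le_eq mult.commute)
      qed
      show "(\<lambda>n. \<theta> - 1 / real n) \<longlonglongrightarrow> \<theta>" by real_asymp
    qed simp
    have "(\<lambda>n. (real (?k n) / real n) ^ r * (a * (1 + (a - 1) / real n) /
        ((real (?k n) / real n + (a - 1) / real n) * (real (?k n) / real n + a / real n))) * (1 - ?q n (?k n)))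
      \<longlonglongrightarrow> \<theta> ^ r * (a * (1 + 0) / ((\<theta> + 0) * (\<theta> + 0))) * (1 - limit_child_prob a (2 * \<theta>))"
      using \<theta> by (intro tendsto_intros kr q_lim lim_const_over_n) auto
    also have "\<theta> ^ r * (a * (1 + 0) / ((\<theta> + 0) * (\<theta> + 0))) * (1 - limit_child_prob a (2 * \<theta>)) = \<theta> ^ r * limit_density a \<theta>"
      using \<theta> by (simp add: limit_density_eq power2_eq_square)
    finally have lim: "(\<lambda>n. (real (?k n) / real n) ^ r * (a * (1 + (a - 1) / real n) /
        ((real (?k n) / real n + (a - 1) / real n) * (real (?k n) / real n + a / real n))) * (1 - ?q n (?k n)))
      \<longlonglongrightarrow> \<theta> ^ r * limit_density a \<theta>" .
    have ev: "eventually (\<lambda>n. 1/2 < real (?k n) / real n) sequentially" "eventually (\<lambda>n. real (?k n) / real n < 1) sequentially"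
      by (rule order_tendstoD[OF kr]; use \<theta> in simp)+
    show "(\<lambda>n. real n * ?g n (?k n)) \<longlonglongrightarrow> \<theta> ^ r * limit_density a \<theta>"
    proof (rule Lim_transform_eventually[OF lim])
      show "eventually (\<lambda>n. (real (?k n) / real n) ^ r * (a * (1 + (a - 1) / real n) /
        ((real (?k n) / real n + (a - 1) / real n) * (real (?k n) / real n + a / real n))) * (1 - ?q n (?k n)) =
          real n * ?g n (?k n)) sequentially"
        using ev eventually_gt_at_top[of 0]
      proof eventually_elim
        case (elim n)
        define K N where "K = real (?k n)" and "N = real n"
        have N: "N > 0" using elim by (simp add: N_def)
        have K: "1 \<le> ?k n" "?k n < n"
          using elim by (auto simp: field_simps intro: Suc_leI gr0I)
        have "a * (1 + (a - 1) / N) / ((K / N + (a - 1) / N) * (K / N + a / N)) =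
            N * (a * (N + a - 1) / ((K + a - 1) * (K + a)))"
        proof -
          have "a * (1 + (a - 1) / N) = a * (N + a - 1) / N" using N by (simp add: field_simps)
          moreover have "(K / N + (a - 1) / N) * (K / N + a / N) = (K + a - 1) * (K + a) / N\<^sup>2"
            by (simp add: add_divide_distrib[symmetric] power2_eq_square add_diff_eq)
          ultimately show ?thesis using N by (simp add: power2_eq_square)
        qed
        then show ?case using K by (simp add: expected_nodes_def K_def N_def mult_ac)
      qed
    qed
  qed
  show ?thesis
  proof (rule Lim_transform_eventually[OF tendsto_add[OF atom cont]])
    show "eventually (\<lambda>n. (1 - ?q n n) + (\<Sum>k\<in>{n div 2<..<n}. ?g n k) =
        measure_pmf.expectation (random_tree c1 c2 n) (\<lambda>T. (real (centroid_subtree_size T) / real n) ^ r)) sequentially"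
      using eventually_ge_at_top[of 1] by eventually_elim (simp add: expectation_centroid_size_power[OF adm a])
  qed
qed

section \<open>The limit law and its moments\<close>

text \<open>
  Convexity, with equality at \<open>0\<close> and \<open>1\<close>.
\<close>

lemma two_powr_le:
  assumes "0 \<le> p" "p \<le> (1::real)"
  shows "2 powr p \<le> 1 + p"
proof -
  have "exp (ln 2 * ((1 - p) *\<^sub>R 0 + p *\<^sub>R 1)) \<le> (1 - p) * exp (ln 2 * 0) + p * exp (ln 2 * 1)"
    by (rule convex_onD[OF convex_on_exp]) (use assms in auto)
  then show ?thesis by (simp add: powr_def mult.commute)
qed

text \<open>
  The left-hand side increases with \<open>t\<close>, so for \<open>a \<noteq> 1\<close> a bound on a power of \<open>2\<close> is enough. For
  \<open>a > 2\<close> the claim fails at \<open>t = 2\<close>, and the limit law would have a negative atom.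
\<close>

lemma limit_child_prob_le_1:
  assumes a: "0 < a" "a \<le> 2" and t: "1 \<le> t" "t \<le> 2"
  shows "limit_child_prob a t \<le> 1"
proof -
  consider "a = 1" | "a < 1" | "a > 1" by linarith
  then show ?thesis
  proof cases
    case 1
    have "ln t \<le> t - 1" using t by (intro ln_le_minus_one) simp
    then show ?thesis using 1 t by (simp add: limit_child_prob_def)
  next
    case 2
    have "t powr (1 - a) \<le> 2 powr (1 - a)" using t 2 by (intro powr_mono2) auto
    also have "\<dots> \<le> 1 + (1 - a)" using a 2 by (intro two_powr_le) auto
    finally have "a * t powr (1 - a) \<le> a * (2 - a)" using a by simp
    also have "\<dots> \<le> 1" using zero_le_square[of "a - 1"] by (simp add: algebra_simps)
    finally have "a * (t powr (1 - a) - 1) \<le> 1 - a" by (simp add: algebra_simps)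
    then have "a * (t powr (1 - a) - 1) / (1 - a) \<le> 1" using 2 by (simp add: divide_le_eq)
    moreover have "a / (a - 1) * (1 - t powr (1 - a)) = a * (t powr (1 - a) - 1) / (1 - a)"
      using 2 by (simp add: divide_simps) (simp add: algebra_simps)
    ultimately show ?thesis using 2 by (simp add: limit_child_prob_def)
  next
    case 3
    have "t powr (a - 1) \<le> 2 powr (a - 1)" using t 3 by (intro powr_mono2) auto
    also have "\<dots> \<le> a" using two_powr_le[of "a - 1"] a 3 by simp
    finally have "1 / a \<le> t powr (- (a - 1))"
      unfolding powr_minus_divide using t 3 by (intro frac_le) auto
    then have "a * (1 - t powr (- (a - 1))) \<le> a - 1" using a by (simp add: field_simps)
    then show ?thesis using 3 by (simp add: limit_child_prob_def divide_le_eq)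
  qed
qed

lemma limit_density_nonneg:
  assumes "0 < a" "a \<le> 2" "1/2 \<le> \<theta>" "\<theta> \<le> 1"
  shows "limit_density a \<theta> \<ge> 0"
  using limit_child_prob_le_1[of a "2 * \<theta>"] assms by (simp add: limit_density_eq)

lemma limit_atom_nonneg: "0 < a \<Longrightarrow> a \<le> 2 \<Longrightarrow> limit_atom a \<ge> 0"
  using limit_child_prob_le_1[of a 2] by (simp add: limit_atom_eq)

lemma isCont_limit_density: "\<theta> > 0 \<Longrightarrow> isCont (limit_density a) \<theta>"
  unfolding limit_density_def by (cases "a = 1") (auto intro!: continuous_intros)

text \<open>
  The usual extension from indicator functions, for which this is \<open>emeasure_limit_law\<close>.
\<close>

lemma nn_integral_limit_law:
  assumes "f \<in> borel_measurable borel"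
  shows "(\<integral>\<^sup>+x. f x \<partial>limit_law a) =
    (\<integral>\<^sup>+\<theta>. f \<theta> * (ennreal (limit_density a \<theta>) * indicator {1/2..<1} \<theta>) \<partial>lborel) + f 1 * ennreal (limit_atom a)"
  using assms
proof (induction rule: borel_measurable_induct)
  case (cong f g)
  then show ?case by simp
next
  case (set A)
  then show ?case
    by (simp add: emeasure_limit_law indicator_inter_arith mult_ac)
next
  case (mult u c)
  then show ?case
    by (simp add: nn_integral_cmult distrib_left mult.assoc measurable_cong_sets[OF sets_limit_law refl])
next
  case (add u v)
  then show ?case
    by (simp add: nn_integral_add distrib_right measurable_cong_sets[OF sets_limit_law refl] add_ac)
next
  case (seq U)
  let ?h = "\<lambda>\<theta>. ennreal (limit_density a \<theta>) * indicator {1/2..<1} \<theta>"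
  have [measurable]: "U i \<in> borel_measurable borel" for i by (rule seq.hyps)
  have [measurable]: "U i \<in> borel_measurable (limit_law a)" for i
    by (simp add: measurable_cong_sets[OF sets_limit_law refl])
  have "(\<integral>\<^sup>+x. (SUP i. U i) x \<partial>limit_law a) = (SUP i. \<integral>\<^sup>+x. U i x \<partial>limit_law a)"
    using seq.hyps(3) by (simp add: nn_integral_monotone_convergence_SUP image_comp)
  also have "\<dots> = (SUP i. (\<integral>\<^sup>+\<theta>. U i \<theta> * ?h \<theta> \<partial>lborel) + U i 1 * ennreal (limit_atom a))"
    by (simp add: seq.IH)
  also have "\<dots> = (SUP i. \<integral>\<^sup>+\<theta>. U i \<theta> * ?h \<theta> \<partial>lborel) + (SUP i. U i 1 * ennreal (limit_atom a))"
    using seq.hyps(3)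
    by (intro ennreal_SUP_add) (auto simp: incseq_def le_fun_def intro!: nn_integral_mono mult_right_mono)
  also have "(SUP i. \<integral>\<^sup>+\<theta>. U i \<theta> * ?h \<theta> \<partial>lborel) = (\<integral>\<^sup>+\<theta>. (SUP i. U i \<theta> * ?h \<theta>) \<partial>lborel)"
    using seq.hyps(3)
    by (intro nn_integral_monotone_convergence_SUP[symmetric]) (auto simp: incseq_def le_fun_def intro!: mult_right_mono)
  also have "(\<lambda>\<theta>. SUP i. U i \<theta> * ?h \<theta>) = (\<lambda>\<theta>. (SUP i. U i) \<theta> * ?h \<theta>)"
    by (simp add: SUP_mult_right_ennreal image_comp)
  also have "(SUP i. U i 1 * ennreal (limit_atom a)) = (SUP i. U i) 1 * ennreal (limit_atom a)"
    by (simp add: SUP_mult_right_ennreal image_comp)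
  finally show ?case .
qed

lemma integrable_limit_density:
  "integrable lborel (\<lambda>\<theta>. \<theta> ^ r * limit_density a \<theta> * indicator {1/2..1} \<theta>)"
proof -
  have "continuous_on {1/2..1} (\<lambda>\<theta>. \<theta> ^ r * limit_density a \<theta>)"
    by (intro continuous_at_imp_continuous_on ballI continuous_intros isCont_limit_density) auto
  from borel_integrable_compact[OF compact_Icc this] show ?thesis
    by (simp add: mult.commute)
qed

lemma limit_moment_eq:
  assumes a: "0 < a" "a \<le> 2"
  shows "limit_moment a r = limit_atom a + (\<integral>\<theta>. \<theta> ^ r * limit_density a \<theta> * indicator {1/2..1} \<theta> \<partial>lborel)"
proof -
  let ?I = "\<integral>\<theta>. \<theta> ^ r * limit_density a \<theta> * indicator {1/2..1} \<theta> \<partial>lborel"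
  have nonneg: "0 \<le> \<theta> ^ r * limit_density a \<theta> * indicator {1/2..1} \<theta>" for \<theta>
    using limit_density_nonneg[OF a, of \<theta>] by (auto simp: indicator_def)
  have "AE x in limit_law a. 0 \<le> x"
  proof (rule AE_I)
    show "{x \<in> space (limit_law a). \<not> 0 \<le> x} \<subseteq> {..<0}" by auto
    have "{..<0} \<inter> {1/2..<1} = ({} :: real set)" by auto
    then show "emeasure (limit_law a) {..<0} = 0" by (simp add: emeasure_limit_law)
  qed simp
  then have "AE x in limit_law a. 0 \<le> x ^ r" by eventually_elim simp
  then have "limit_moment a r = enn2real (\<integral>\<^sup>+x. ennreal (x ^ r) \<partial>limit_law a)"
    unfolding limit_moment_def
    by (intro integral_eq_nn_integral) (simp_all add: measurable_cong_sets[OF sets_limit_law refl])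
  also have "(\<integral>\<^sup>+x. ennreal (x ^ r) \<partial>limit_law a) =
      (\<integral>\<^sup>+\<theta>. ennreal (\<theta> ^ r) * (ennreal (limit_density a \<theta>) * indicator {1/2..<1} \<theta>) \<partial>lborel) + ennreal (limit_atom a)"
    by (subst nn_integral_limit_law) auto
  also have "(\<integral>\<^sup>+\<theta>. ennreal (\<theta> ^ r) * (ennreal (limit_density a \<theta>) * indicator {1/2..<1} \<theta>) \<partial>lborel) =
      (\<integral>\<^sup>+\<theta>. ennreal (\<theta> ^ r * limit_density a \<theta> * indicator {1/2..1} \<theta>) \<partial>lborel)"
  \<comment> \<open>Closing the interval at 1 does not change the integral.\<close>
  proof (rule nn_integral_cong_AE)
    have "AE \<theta> in lborel. \<theta> \<noteq> (1 :: real)" by (rule AE_lborel_singleton)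
    then show "AE \<theta> in lborel. ennreal (\<theta> ^ r) * (ennreal (limit_density a \<theta>) * indicator {1/2..<1} \<theta>) =
        ennreal (\<theta> ^ r * limit_density a \<theta> * indicator {1/2..1} \<theta>)"
      by eventually_elim (auto simp: indicator_def ennreal_mult' limit_density_nonneg[OF a])
  qed
  also have "\<dots> = ennreal ?I"
    by (intro nn_integral_eq_integral integrable_limit_density AE_I2 nonneg)
  finally have "limit_moment a r = enn2real (ennreal ?I + ennreal (limit_atom a))" .
  moreover have "0 \<le> ?I" by (rule Bochner_Integration.integral_nonneg[OF nonneg])
  ultimately show ?thesis using limit_atom_nonneg[OF a] by (simp flip: ennreal_plus)
qed

lemma limit_density_FTC:
  assumes "\<And>\<theta>. 1/2 \<le> \<theta> \<Longrightarrow> \<theta> \<le> 1 \<Longrightarrow> (F has_field_derivative \<theta> ^ r * limit_density a \<theta>) (at \<theta>)"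
  shows "(\<integral>\<theta>. \<theta> ^ r * limit_density a \<theta> * indicator {1/2..1} \<theta> \<partial>lborel) = F 1 - F (1/2)"
  by (rule integral_FTC_Icc_real) (use assms in \<open>auto intro!: continuous_intros isCont_limit_density\<close>)

text \<open>
  The antiderivative \<open>F\<close> below is valid unless one of the two powers of \<open>\<theta>\<close> is \<open>1 / \<theta>\<close>: for \<open>r = 1\<close>
  the second one integrates to a logarithm, and the first one is excluded by \<open>a \<noteq> r\<close>.
\<close>

lemma limit_integral_generic:
  assumes r: "r \<ge> 1" and a: "a > 0" "a \<noteq> 1" "a \<noteq> real r"
  shows "limit_atom a + (\<integral>\<theta>. \<theta> ^ r * limit_density a \<theta> * indicator {1/2..1} \<theta> \<partial>lborel) = moment_formula r a"
proof -
  define L where "L \<theta> = (if r = 1 then ln \<theta> else \<theta> powr (real r - 1) / (real r - 1))" for \<theta> :: real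
  define F where "F \<theta> = 4 * (a / (a - 1)) * (a * 2 powr (- (a + 1)) * (\<theta> powr (real r - a) / (real r - a)) - L \<theta> / 4)" for \<theta>
  have L: "(L has_field_derivative \<theta> powr (real r - 2)) (at \<theta>)" if "\<theta> > 0" for \<theta>
  proof (cases "r = 1")
    case True
    have "\<theta> powr - 1 = 1 / \<theta>" using that by (simp add: powr_minus_divide)
    then show ?thesis unfolding L_def using that True by (auto intro!: derivative_eq_intros)
  next
    case False
    then have "real r - 1 \<noteq> 0" by simp
    then have "((\<lambda>\<theta>. \<theta> powr (real r - 1) / (real r - 1)) has_field_derivative \<theta> powr (real r - 2)) (at \<theta>)"
      using DERIV_cdivide[OF has_real_derivative_powr[OF that, of "real r - 1"], of "real r - 1"]
      by simp
    then show ?thesis unfolding L_def using False by simp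
  qed
  have "(\<integral>\<theta>. \<theta> ^ r * limit_density a \<theta> * indicator {1/2..1} \<theta> \<partial>lborel) = F 1 - F (1/2)"
  proof (rule limit_density_FTC)
    fix \<theta> :: real assume "1/2 \<le> \<theta>" "\<theta> \<le> 1"
    then have \<theta>: "\<theta> > 0" by simp
    have "(F has_field_derivative 4 * (a / (a - 1)) * (a * 2 powr (- (a + 1)) * \<theta> powr (real r - a - 1) - \<theta> powr (real r - 2) / 4)) (at \<theta>)"
      unfolding F_def using \<theta> a(2,3) by (auto intro!: derivative_eq_intros L)
    moreover have e1: "\<theta> ^ r * (2 * \<theta>) powr (- (a + 1)) = 2 powr (- (a + 1)) * \<theta> powr (real r - a - 1)"
    proof -
      have "\<theta> powr (real r) * \<theta> powr (- (a + 1)) = \<theta> powr (real r - a - 1)"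
        unfolding powr_add[symmetric] by (simp add: algebra_simps)
      then show ?thesis using \<theta> by (simp add: powr_mult powr_realpow mult_ac)
    qed
    moreover have e2: "\<theta> ^ r * (2 * \<theta>) powr (- 2) = \<theta> powr (real r - 2) / 4"
    proof -
      have "\<theta> powr (real r) * \<theta> powr (- 2) = \<theta> powr (real r - 2)"
        unfolding powr_add[symmetric] by simp
      moreover have "(2 * \<theta>) powr (- 2) = 1 / 4 * \<theta> powr (- 2)"
        using \<theta> by (simp add: powr_mult powr_minus_divide)
      moreover have "\<theta> powr (real r) = \<theta> ^ r" using \<theta> by (rule powr_realpow)
      ultimately show ?thesis by (metis mult.left_commute mult.commute times_divide_eq_right mult_1_right)
    qed
    moreover have "\<theta> ^ r * limit_density a \<theta> =
        4 * (a / (a - 1)) * (a * (\<theta> ^ r * (2 * \<theta>) powr (- (a + 1))) - \<theta> ^ r * (2 * \<theta>) powr (- 2))"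
      using a(2) by (simp add: limit_density_def right_diff_distrib mult_ac)
    ultimately show "(F has_field_derivative \<theta> ^ r * limit_density a \<theta>) (at \<theta>)"
      by (simp only: e1 e2 mult.assoc)
  qed
  also have "F 1 - F (1/2) = a / (a - 1) * (a / (a - real r) * (2 powr (- (real r - 1)) - 2 powr (- (a - 1))) - (L 1 - L (1/2)))"
  proof -
    define A B C where "A = 2 powr (- (a + 1))" and "B = (1/2) powr (real r - a)" and "C = real r - a"
    have "C \<noteq> 0" using a(3) by (simp add: C_def)
    have B': "B = 2 powr (- (real r - a))"
      unfolding B_def powr_minus_divide by (simp add: powr_divide)
    have AB: "2 powr (- (real r - 1)) = 4 * A * B"
    proof -
      have "4 * A * B = 2 powr 2 * 2 powr (- (a + 1)) * 2 powr (- (real r - a))"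
        unfolding A_def B' by simp
      also have "\<dots> = 2 powr (2 + - (a + 1) + - (real r - a))" unfolding powr_add ..
      finally show ?thesis by simp
    qed
    have A4: "2 powr (- (a - 1)) = 4 * A"
    proof -
      have "4 * A = 2 powr 2 * 2 powr (- (a + 1))" by (simp add: A_def)
      also have "\<dots> = 2 powr (2 + - (a + 1))" unfolding powr_add ..
      finally show ?thesis by simp
    qed
    have "F 1 - F (1/2) = a / (a - 1) * (4 * (a * A * (1 / C)) - 4 * (a * A * (B / C)) - (L 1 - L (1/2)))"
    proof -
      have "4 * K * (X - l / 4) - 4 * K * (Y - l' / 4) = K * (4 * X - 4 * Y - (l - l'))" for K X Y l l' :: real
        by (simp add: algebra_simps)
      moreover have "F 1 = 4 * (a / (a - 1)) * (a * A * (1 / C) - L 1 / 4)"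
        "F (1/2) = 4 * (a / (a - 1)) * (a * A * (B / C) - L (1/2) / 4)"
        unfolding F_def A_def B_def C_def by simp_all
      ultimately show ?thesis by (simp only:)
    qed
    also have "4 * (a * A * (1 / C)) - 4 * (a * A * (B / C)) = a / (a - real r) * (4 * A * B - 4 * A)"
    proof -
      have "a - real r = - C" by (simp add: C_def)
      show ?thesis unfolding \<open>a - real r = - C\<close> using \<open>C \<noteq> 0\<close> by (simp add: field_simps)
    qed
    finally show ?thesis unfolding AB A4 .
  qed
  also have "L 1 - L (1/2) = (if r = 1 then ln 2 else 1 / (real r - 1) * (1 - 2 powr (- (real r - 1))))"
    unfolding powr_minus_divide by (simp add: L_def ln_div powr_divide diff_divide_distrib)
  finally show ?thesis by (simp add: moment_formula_def)
qed

text \<open>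
  The singular quotient in the formula is the difference quotient of \<open>2 powr (- (a - 1))\<close> at \<open>a = 2\<close>.
\<close>

lemma moment_formula_limit_2:
  "(moment_formula 2 \<longlongrightarrow> limit_atom 2 + (\<integral>\<theta>. \<theta> ^ 2 * limit_density 2 \<theta> * indicator {1/2..1} \<theta> \<partial>lborel)) (at 2)"
proof -
  have "(\<integral>\<theta>. \<theta> ^ 2 * limit_density 2 \<theta> * indicator {1/2..1} \<theta> \<partial>lborel) =
      (2 * ln 1 - 2 * 1) - (2 * ln (1/2) - 2 * (1/2))"
  proof (rule limit_density_FTC)
    fix \<theta> :: real assume "1/2 \<le> \<theta>" "\<theta> \<le> 1"
    then have \<theta>: "\<theta> > 0" by simp
    have "\<theta>\<^sup>2 * limit_density 2 \<theta> = 2 * (1 / \<theta>) - 2"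
      using \<theta> by (simp add: limit_density_def powr_minus_divide powr_numeral power2_eq_square power3_eq_cube field_simps)
    then show "((\<lambda>\<theta>. 2 * ln \<theta> - 2 * \<theta>) has_field_derivative \<theta>\<^sup>2 * limit_density 2 \<theta>) (at \<theta>)"
      using \<theta> by (auto intro!: derivative_eq_intros)
  qed
  then have eq: "limit_atom 2 + (\<integral>\<theta>. \<theta> ^ 2 * limit_density 2 \<theta> * indicator {1/2..1} \<theta> \<partial>lborel) = 2 * ln 2 - 1"
    by (simp add: limit_atom_def powr_minus_divide ln_div)
  \<comment> \<open>The factor P a - 1/2 vanishes at a = 2 and cancels the pole of a / (a - 2).\<close>
  define P where "P a = 2 powr (- (a - 1))" for a :: real
  have P2: "P 2 = 1/2" by (simp add: P_def powr_minus_divide)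
  have P': "(P has_field_derivative - (ln 2) / 2) (at 2)"
    unfolding P_def by (auto intro!: derivative_eq_intros simp: powr_minus_divide)
  then have slope: "((\<lambda>a. (P a - 1/2) / (a - 2)) \<longlongrightarrow> - (ln 2) / 2) (at 2)"
    by (simp add: has_field_derivative_iff P2)
  have P: "(P \<longlongrightarrow> 1/2) (at 2)" using DERIV_isCont[OF P'] by (simp add: isCont_def P2)
  have "((\<lambda>a. 1 - a / (a - 1) * (1 - P a) + a / (a - 1) * (- a * ((P a - 1/2) / (a - 2)) - 1/2)) \<longlongrightarrow>
     1 - 2 / (2 - 1) * (1 - 1/2) + 2 / (2 - 1) * (- 2 * (- (ln 2) / 2) - 1/2)) (at 2)"
    by (intro tendsto_intros slope P) auto
  moreover have "eventually (\<lambda>a. 1 - a / (a - 1) * (1 - P a) + a / (a - 1) * (- a * ((P a - 1/2) / (a - 2)) - 1/2)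
      = moment_formula 2 a) (at 2)"
  proof -
    have "eventually (\<lambda>a. a \<in> {1<..}) (at (2::real))"
      by (rule eventually_at_in_open') auto
    then show ?thesis
    proof eventually_elim
      case (elim a)
      have "- a * ((P a - 1/2) / (a - 2)) = a / (a - 2) * (1/2 - P a)"
        by (simp add: diff_divide_distrib algebra_simps)
      then show ?case using elim by (simp add: moment_formula_def limit_atom_def powr_minus_divide P_def)
    qed
  qed
  ultimately show ?thesis unfolding eq by (simp add: Lim_transform_eventually)
qed

lemma moment_formula_1:
  assumes "a \<noteq> 1"
  shows "moment_formula 1 a = mean_formula a"
proof -
  define x y where "x = a - 1" and "y = 1 - 2 powr (- x)"
  have x: "x \<noteq> 0" "a = 1 + x" using assms by (auto simp: x_def)
  have "moment_formula 1 a = (1 - (1 + x) / x * y) + (1 + x) / x * ((1 + x) / x * y - ln 2)"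
    using assms x by (simp add: moment_formula_def limit_atom_def y_def)
  also have "\<dots> = 1 + (1 + x) / x\<^sup>2 * (y - x * ln 2)"
    using x by (simp add: divide_simps power2_eq_square) (simp add: algebra_simps)
  finally show ?thesis by (simp add: mean_formula_def x_def y_def)
qed

lemma limit_integral_1_1:
  "limit_atom 1 + (\<integral>\<theta>. \<theta> ^ 1 * limit_density 1 \<theta> * indicator {1/2..1} \<theta> \<partial>lborel) = 1 - (ln 2)\<^sup>2 / 2"
proof -
  have "(\<integral>\<theta>. \<theta> ^ 1 * limit_density 1 \<theta> * indicator {1/2..1} \<theta> \<partial>lborel) =
      (ln 1 - (ln (2 * 1))\<^sup>2 / 2) - (ln (1/2) - (ln (2 * (1/2)))\<^sup>2 / 2)"
  proof (rule limit_density_FTC)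
    fix \<theta> :: real assume "1/2 \<le> \<theta>" "\<theta> \<le> 1"
    then have \<theta>: "\<theta> > 0" by simp
    have "\<theta> ^ 1 * limit_density 1 \<theta> = 1 / \<theta> - ln (2 * \<theta>) / \<theta>"
      using \<theta> by (simp add: limit_density_def power2_eq_square field_simps)
    then show "((\<lambda>\<theta>. ln \<theta> - (ln (2 * \<theta>))\<^sup>2 / 2) has_field_derivative \<theta> ^ 1 * limit_density 1 \<theta>) (at \<theta>)"
      using \<theta> by (auto intro!: derivative_eq_intros)
  qed
  then show ?thesis by (simp add: limit_atom_def ln_div)
qed

lemma mean_formula_limit_1: "(mean_formula \<longlongrightarrow> 1 - (ln 2)\<^sup>2 / 2) (at 1)"
  unfolding mean_formula_def power2_eq_square by real_asymp

text \<open>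
  Apart from the atom, the formula is \<open>H a / (a - 1)\<close> for a function \<open>H\<close> that is differentiable and
  vanishes at \<open>1\<close>. So its limit is the derivative of \<open>H\<close> at \<open>1\<close>, which agrees with the integral.
\<close>

lemma moment_formula_limit_1:
  assumes r: "r \<ge> 2"
  shows "(moment_formula r \<longlongrightarrow> limit_atom 1 + (\<integral>\<theta>. \<theta> ^ r * limit_density 1 \<theta> * indicator {1/2..1} \<theta> \<partial>lborel)) (at 1)"
proof -
  define s where "s = real r - 1"
  have s: "s > 0" using r by (simp add: s_def)
  define c where "c = 2 powr (- s)"
  have "(\<integral>\<theta>. \<theta> ^ r * limit_density 1 \<theta> * indicator {1/2..1} \<theta> \<partial>lborel) =
      (1 powr s / s * (1 - ln (2 * 1)) + 1 powr s / s\<^sup>2) - ((1/2) powr s / s * (1 - ln (2 * (1/2))) + (1/2) powr s / s\<^sup>2)"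
  proof (rule limit_density_FTC)
    fix \<theta> :: real assume "1/2 \<le> \<theta>" "\<theta> \<le> 1"
    then have \<theta>: "\<theta> > 0" by simp
    have "\<theta> ^ r = \<theta> powr (s - 1) * \<theta>\<^sup>2"
    proof -
      have "\<theta> powr (s - 1) * \<theta> powr 2 = \<theta> powr (real r)" unfolding powr_add[symmetric] by (simp add: s_def)
      then show ?thesis using \<theta> by (simp add: powr_realpow)
    qed
    then have f: "\<theta> ^ r * limit_density 1 \<theta> = \<theta> powr (s - 1) * (1 - ln (2 * \<theta>))"
      using \<theta> by (simp add: limit_density_def)
    have "\<theta> powr s = \<theta> powr (s - 1) * \<theta>" using \<theta> powr_add[of \<theta> "s - 1" 1] by simp
    then show "((\<lambda>\<theta>. \<theta> powr s / s * (1 - ln (2 * \<theta>)) + \<theta> powr s / s\<^sup>2) has_field_derivative \<theta> ^ r * limit_density 1 \<theta>) (at \<theta>)"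
      unfolding f using \<theta> s by (auto intro!: derivative_eq_intros simp: power2_eq_square field_simps)
  qed
  moreover have "(1/2) powr s = c" by (simp add: c_def powr_divide powr_minus_divide)
  ultimately have int: "(\<integral>\<theta>. \<theta> ^ r * limit_density 1 \<theta> * indicator {1/2..1} \<theta> \<partial>lborel) =
      (1 - c) / s + (1 - c) / s\<^sup>2 - ln 2 / s"
    by (simp add: diff_divide_distrib)
  define H where "H a = a * (a / (a - 1 - s) * (c - 2 powr (- (a - 1))) - (1 - c) / s)" for a
  have H1: "H 1 = 0" using s by (simp add: H_def field_simps)
  have "(H has_field_derivative (1 - c) / s + (1 - c) / s\<^sup>2 - ln 2 / s) (at 1)"
    unfolding H_def using s
    by (auto intro!: derivative_eq_intros simp: power2_eq_square field_simps)
  then have "((\<lambda>a. H a / (a - 1)) \<longlongrightarrow> (1 - c) / s + (1 - c) / s\<^sup>2 - ln 2 / s) (at 1)"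
    by (simp add: has_field_derivative_iff H1)
  moreover have "((\<lambda>a. 1 - a / (a - 1) * (1 - 2 powr (- (a - 1))) :: real) \<longlongrightarrow> 1 - ln 2) (at 1)"
    by real_asymp
  ultimately have "((\<lambda>a. (1 - a / (a - 1) * (1 - 2 powr (- (a - 1)))) + H a / (a - 1)) \<longlongrightarrow>
      (1 - ln 2) + ((1 - c) / s + (1 - c) / s\<^sup>2 - ln 2 / s)) (at 1)"
    by (intro tendsto_add)
  moreover have "eventually (\<lambda>a. (1 - a / (a - 1) * (1 - 2 powr (- (a - 1)))) + H a / (a - 1) = moment_formula r a) (at 1)"
    using eventually_neq_at_within[of 1]
  proof eventually_elim
    case (elim a)
    have "a - 1 - s = a - real r" by (simp add: s_def)
    then have "H a / (a - 1) = a / (a - 1) * (a / (a - real r) * (c - 2 powr (- (a - 1))) - 1 / s * (1 - c))"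
      by (simp add: H_def)
    then show ?case using elim r by (simp add: moment_formula_def limit_atom_def c_def s_def)
  qed
  ultimately show ?thesis unfolding int by (simp add: limit_atom_def Lim_transform_eventually)
qed

theorem theorem22:
  fixes c1 c2 \<alpha> :: real
  assumes "very_simple_increasing c1 c2"
    and "\<alpha> = vsit_alpha c1 c2"
  shows "(\<forall>r::nat. r \<ge> 1 \<longrightarrow>
      (\<lambda>n. measure_pmf.expectation (random_tree c1 c2 n)
              (\<lambda>T. (real (centroid_subtree_size T) / real n) ^ r))
        \<longlonglongrightarrow> limit_moment \<alpha> r
      \<and> (\<alpha> \<notin> {1, real r} \<longrightarrow> limit_moment \<alpha> r = moment_formula r \<alpha>)
      \<and> (\<alpha> \<in> {1, real r} \<longrightarrow> (moment_formula r \<longlongrightarrow> limit_moment \<alpha> r) (at \<alpha>)))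
    \<and> (\<lambda>n. measure_pmf.expectation (random_tree c1 c2 n)
              (\<lambda>T. real (centroid_subtree_size T) / real n))
        \<longlonglongrightarrow> limit_moment \<alpha> 1
    \<and> (\<alpha> \<noteq> 1 \<longrightarrow> limit_moment \<alpha> 1 = mean_formula \<alpha>)
    \<and> (\<alpha> = 1 \<longrightarrow> (mean_formula \<longlongrightarrow> limit_moment \<alpha> 1) (at \<alpha>))"
proof -
  note adm = admissible[OF assms(1), folded assms(2)]
  have bounds: "0 < \<alpha>" "\<alpha> \<le> 2" and nat: "\<alpha> = real r \<Longrightarrow> \<alpha> = 1 \<or> \<alpha> = 2" for r
  proof -
    have "real d / (real d - 1) \<le> 2" if "d \<ge> 2" for d :: nat using that by (simp add: divide_le_eq)
    then show "0 < \<alpha>" "\<alpha> \<le> 2" using adm by auto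
    assume "\<alpha> = real r"
    then have "0 < r" "r \<le> 2" using \<open>0 < \<alpha>\<close> \<open>\<alpha> \<le> 2\<close> by auto
    then show "\<alpha> = 1 \<or> \<alpha> = 2" using \<open>\<alpha> = real r\<close> by force
  qed
  note moment = limit_moment_eq[OF bounds]
  have lim: "(\<lambda>n. measure_pmf.expectation (random_tree c1 c2 n)
      (\<lambda>T. (real (centroid_subtree_size T) / real n) ^ r)) \<longlonglongrightarrow> limit_moment \<alpha> r" for r
    unfolding moment by (rule expectation_limit[OF assms])
  have generic: "limit_moment \<alpha> r = moment_formula r \<alpha>" if "r \<ge> 1" "\<alpha> \<notin> {1, real r}" for r
    unfolding moment using limit_integral_generic[OF that(1) bounds(1)] that(2) by simp
  have mean1: "(mean_formula \<longlongrightarrow> limit_moment \<alpha> 1) (at \<alpha>)" if "\<alpha> = 1"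
    unfolding moment unfolding that limit_integral_1_1 by (rule mean_formula_limit_1)
  have singular: "(moment_formula r \<longlongrightarrow> limit_moment \<alpha> r) (at \<alpha>)" if r: "r \<ge> 1" and \<alpha>: "\<alpha> \<in> {1, real r}" for r
  proof -
    \<comment> \<open>An integer in the interval (0, 2] is 1 or 2, so no other coincidences with r occur.\<close>
    consider "\<alpha> = 1" "r = 1" | "\<alpha> = 1" "r \<ge> 2" | "\<alpha> = 2" "r = 2"
      using \<alpha> nat[of r] r by fastforce
    then show ?thesis
    proof cases
      case 1
      have "eventually (\<lambda>a. mean_formula a = moment_formula 1 a) (at 1)"
        using eventually_neq_at_within[of 1] by eventually_elim (rule moment_formula_1[symmetric])
      with mean1[OF 1(1)] show ?thesis unfolding 1 by (rule Lim_transform_eventually)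
    next
      case 2
      then show ?thesis unfolding moment using moment_formula_limit_1 by simp
    next
      case 3
      then show ?thesis unfolding moment using moment_formula_limit_2 by simp
    qed
  qed
  show ?thesis
    using lim[of 1] lim generic generic[of 1] mean1 singular moment_formula_1[of \<alpha>] by auto
qed

end
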